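(* Let $G$ and $H$ be Lie groups with $\mathrm{Lie}(G)=\mathrm{Lie}(H)=\mathfrak{so}(3)$. On the Lie group $G\times H$ there is neither a left-invariant nearly para-Kähler structure of non-zero type (i.e. with $\|\nabla J\|^2\neq0$) nor a left-invariant nearly pseudo-Kähler structure with an indefinite metric.
   Context: Let $\varepsilon\in\{\pm1\}$. An almost $\varepsilon$-Hermitian structure on a $2m$-manifold $M$ is a triple $(g,J,\omega)$, where $J$ is an endomorphism field with $J^2=\varepsilon\,\mathrm{id}$ (and, if $\varepsilon=1$, both eigenbundles for $\pm1$ have rank $m$), $g$ is a pseudo-Riemannian metric with $g(J\cdot,J\cdot)=-\varepsilon g(\cdot,\cdot)$, and $\omega=g(\cdot,J\cdot)$. With $\nabla$ the Levi-Civita connection of $g$, it is nearly $\varepsilon$-Kähler if $(\nabla_XJ)X=0$ for all vector fields $X$; this is called nearly pseudo-Kähler for $\varepsilon=-1$ and nearly para-Kähler for $\varepsilon=1$. For such a structure $A(X,Y,Z)=g((\nabla_XJ)Y,Z)$ is a three-form, and $\|\nabla J\|^2=\|A\|^2$ denotes its squared length as a three-form with respect to $g$. *)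

theory Defs
  imports "HOL-Analysis.Analysis" "HOL-Library.Function_Algebras"
begin

section \<open>Pointwise vector space structure on function spaces\<close>

instantiation "fun" :: (type, real_vector) real_vector
begin

definition scaleR_fun_def: "c *\<^sub>R f = (\<lambda>x. c *\<^sub>R f x)"

instance
  by standard (simp_all add: scaleR_fun_def fun_eq_iff scaleR_add_right scaleR_add_left)

end

section \<open>Smooth manifolds\<close>

fun C_k_on :: "nat \<Rightarrow> 'e::euclidean_space set \<Rightarrow> ('e \<Rightarrow> 'f::euclidean_space) \<Rightarrow> bool" where
  "C_k_on 0 S f \<longleftrightarrow> continuous_on S f"
| "C_k_on (Suc k) S f \<longleftrightarrow>
     (\<forall>x\<in>S. f differentiable (at x)) \<and>
     (\<forall>v. C_k_on k S (\<lambda>x. frechet_derivative f (at x) v))"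

text \<open>Only used for open sets \<open>S\<close>.\<close>

definition smooth_on :: "'e::euclidean_space set \<Rightarrow> ('e \<Rightarrow> 'f::euclidean_space) \<Rightarrow> bool" where
  "smooth_on S f \<longleftrightarrow> (\<forall>k. C_k_on k S f)"

text \<open>A chart \<open>(U, \<phi>)\<close> is a map on an open set \<open>U\<close> of the manifold; the values of \<open>\<phi>\<close> outside
  \<open>U\<close> are irrelevant. The underlying set of a manifold is a whole type, which carries the topology.\<close>

type_synonym ('a, 'e) chart = "'a set \<times> ('a \<Rightarrow> 'e)"

definition smooth_atlas ::
  "('a::{t2_space,second_countable_topology}, 'e::euclidean_space) chart set \<Rightarrow> bool" where
  "smooth_atlas A \<longleftrightarrow>
     (\<forall>(U, \<phi>)\<in>A. open U \<and> open (\<phi> ` U) \<and> homeomorphism U (\<phi> ` U) \<phi> (inv_into U \<phi>)) \<and>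
     (\<Union>(U, \<phi>)\<in>A. U) = UNIV \<and>
     (\<forall>(U, \<phi>)\<in>A. \<forall>(V, \<psi>)\<in>A. smooth_on (\<phi> ` (U \<inter> V)) (\<psi> \<circ> inv_into U \<phi>))"

definition smooth_map ::
  "('a::topological_space, 'e::euclidean_space) chart set \<Rightarrow>
   ('b::topological_space, 'f::euclidean_space) chart set \<Rightarrow> ('a \<Rightarrow> 'b) \<Rightarrow> bool" where
  "smooth_map A B F \<longleftrightarrow> continuous_on UNIV F \<and>
     (\<forall>(U, \<phi>)\<in>A. \<forall>(V, \<psi>)\<in>B. smooth_on (\<phi> ` (U \<inter> F -` V)) (\<psi> \<circ> F \<circ> inv_into U \<phi>))"

definition prod_atlas ::
  "('a, 'e) chart set \<Rightarrow> ('b, 'f) chart set \<Rightarrow> ('a \<times> 'b, 'e \<times> 'f) chart set" where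
  "prod_atlas A B = {(U \<times> V, map_prod \<phi> \<psi>) | U \<phi> V \<psi>. (U, \<phi>) \<in> A \<and> (V, \<psi>) \<in> B}"

definition smooth_at ::
  "('a::topological_space, 'e::euclidean_space) chart set \<Rightarrow> 'a \<Rightarrow> ('a \<Rightarrow> real) \<Rightarrow> bool" where
  "smooth_at A p f \<longleftrightarrow> (\<exists>N. open N \<and> p \<in> N \<and>
     (\<forall>(U, \<phi>)\<in>A. smooth_on (\<phi> ` (U \<inter> N)) (f \<circ> inv_into U \<phi>)))"

definition smooth_fun ::
  "('a::topological_space, 'e::euclidean_space) chart set \<Rightarrow> ('a \<Rightarrow> real) \<Rightarrow> bool" where
  "smooth_fun A f \<longleftrightarrow> (\<forall>p. smooth_at A p f)"

section \<open>Tangent vectors and vector fields\<close>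

text \<open>A tangent vector at \<open>p\<close> is a directional derivative \<open>f \<mapsto> D (f \<circ> \<phi>\<inverse>) (\<phi> p) w\<close> in a chart,
  acting on functions \<open>f\<close> that are smooth near \<open>p\<close>. As HOL functions are total, it is given the value
  \<open>0\<close> on all other functions, so that two tangent vectors are equal as HOL objects
  iff they agree on the functions smooth near \<open>p\<close>.\<close>

type_synonym 'a tvec = "('a \<Rightarrow> real) \<Rightarrow> real"

type_synonym 'a vfield = "'a \<Rightarrow> 'a tvec"

definition chart_tvec ::
  "('a::topological_space, 'e::euclidean_space) chart set \<Rightarrow> ('a, 'e) chart \<Rightarrow> 'a \<Rightarrow> 'e \<Rightarrow> 'a tvec" where
  "chart_tvec A c p w = (\<lambda>f. if smooth_at A p f
     then frechet_derivative (f \<circ> inv_into (fst c) (snd c)) (at (snd c p)) w else 0)"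

definition tangent_space ::
  "('a::topological_space, 'e::euclidean_space) chart set \<Rightarrow> 'a \<Rightarrow> 'a tvec set" where
  "tangent_space A p = {chart_tvec A c p w | c w. c \<in> A \<and> p \<in> fst c}"

definition pushforward ::
  "('b::topological_space, 'f::euclidean_space) chart set \<Rightarrow> ('a \<Rightarrow> 'b) \<Rightarrow> 'a \<Rightarrow> 'a tvec \<Rightarrow> 'b tvec" where
  "pushforward B F p v = (\<lambda>f. if smooth_at B (F p) f then v (f \<circ> F) else 0)"

definition smooth_vfields ::
  "('a::topological_space, 'e::euclidean_space) chart set \<Rightarrow> 'a vfield set" where
  "smooth_vfields A = {X. (\<forall>p. X p \<in> tangent_space A p) \<and>
     (\<forall>p f. smooth_at A p f \<longrightarrow> smooth_at A p (\<lambda>q. X q f))}"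

definition vderiv :: "'a vfield \<Rightarrow> ('a \<Rightarrow> real) \<Rightarrow> ('a \<Rightarrow> real)" where
  "vderiv X f = (\<lambda>p. X p f)"

definition fscale :: "('a \<Rightarrow> real) \<Rightarrow> 'a vfield \<Rightarrow> 'a vfield" where
  "fscale f X = (\<lambda>p. f p *\<^sub>R X p)"

definition lie_bracket ::
  "('a::topological_space, 'e::euclidean_space) chart set \<Rightarrow> 'a vfield \<Rightarrow> 'a vfield \<Rightarrow> 'a vfield" where
  "lie_bracket A X Y = (\<lambda>p f. if smooth_at A p f
     then X p (vderiv Y f) - Y p (vderiv X f) else 0)"

section \<open>Lie groups and their Lie algebras\<close>

text \<open>The group is written additively but is not assumed to be commutative:
  the class \<open>group_add\<close> is the class of all groups, and \<open>(+) a\<close> is the left translation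
  by \<open>a\<close>. On a product type, \<open>+\<close> is the componentwise operation, i.e. the direct product.\<close>

definition lie_group ::
  "('a::{t2_space,second_countable_topology,group_add}, 'e::euclidean_space) chart set \<Rightarrow> bool" where
  "lie_group A \<longleftrightarrow> smooth_atlas A \<and>
     smooth_map (prod_atlas A A) A (\<lambda>(x, y). x + y) \<and> smooth_map A A uminus"

definition lie_algebra ::
  "('a::{topological_space,group_add}, 'e::euclidean_space) chart set \<Rightarrow> 'a vfield set" where
  "lie_algebra A = {X \<in> smooth_vfields A. \<forall>a p. pushforward A ((+) a) p (X p) = X (a + p)}"

definition so3 :: "(real^3^3) set" where
  "so3 = {M. transpose M = - M}"

text \<open>\<open>Lie(G) = so(3)\<close> is read as an isomorphism of Lie algebras.\<close>

definition has_lie_algebra_so3 ::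
  "('a::{topological_space,group_add}, 'e::euclidean_space) chart set \<Rightarrow> bool" where
  "has_lie_algebra_so3 A \<longleftrightarrow> (\<exists>\<Phi>. bij_betw \<Phi> so3 (lie_algebra A) \<and>
     (\<forall>M\<in>so3. \<forall>N\<in>so3. \<Phi> (M + N) = \<Phi> M + \<Phi> N) \<and>
     (\<forall>c. \<forall>M\<in>so3. \<Phi> (c *\<^sub>R M) = c *\<^sub>R \<Phi> M) \<and>
     (\<forall>M\<in>so3. \<forall>N\<in>so3. \<Phi> (M ** N - N ** M) = lie_bracket A (\<Phi> M) (\<Phi> N)))"

section \<open>Metrics, endomorphism fields and connections\<close>

text \<open>A tensor field is a family of maps indexed by the points; at \<open>p\<close>, only its
  values on \<open>tangent_space A p\<close> are relevant. Similarly, only the values of a connection on smooth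
  vector fields are relevant.\<close>

definition linear_at ::
  "('a::topological_space, 'e::euclidean_space) chart set \<Rightarrow> 'a \<Rightarrow> ('a tvec \<Rightarrow> 'v::real_vector) \<Rightarrow> bool"
  where
  "linear_at A p L \<longleftrightarrow>
     (\<forall>u\<in>tangent_space A p. \<forall>v\<in>tangent_space A p. L (u + v) = L u + L v) \<and>
     (\<forall>c. \<forall>u\<in>tangent_space A p. L (c *\<^sub>R u) = c *\<^sub>R L u)"

definition pseudo_riemannian_metric ::
  "('a::topological_space, 'e::euclidean_space) chart set \<Rightarrow>
   ('a \<Rightarrow> 'a tvec \<Rightarrow> 'a tvec \<Rightarrow> real) \<Rightarrow> bool" where
  "pseudo_riemannian_metric A g \<longleftrightarrow>
     (\<forall>p. \<forall>u\<in>tangent_space A p. \<forall>v\<in>tangent_space A p. g p u v = g p v u) \<and>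
     (\<forall>p. \<forall>u\<in>tangent_space A p. linear_at A p (g p u)) \<and>
     (\<forall>p. \<forall>u\<in>tangent_space A p. (\<forall>v\<in>tangent_space A p. g p u v = 0) \<longrightarrow> u = 0) \<and>
     (\<forall>X\<in>smooth_vfields A. \<forall>Y\<in>smooth_vfields A. smooth_fun A (\<lambda>p. g p (X p) (Y p)))"

definition endo_apply :: "('a \<Rightarrow> 'a tvec \<Rightarrow> 'a tvec) \<Rightarrow> 'a vfield \<Rightarrow> 'a vfield" where
  "endo_apply J X = (\<lambda>p. J p (X p))"

definition endomorphism_field ::
  "('a::topological_space, 'e::euclidean_space) chart set \<Rightarrow> ('a \<Rightarrow> 'a tvec \<Rightarrow> 'a tvec) \<Rightarrow> bool" where
  "endomorphism_field A J \<longleftrightarrow>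
     (\<forall>p. linear_at A p (J p)) \<and>
     (\<forall>p. \<forall>u\<in>tangent_space A p. J p u \<in> tangent_space A p) \<and>
     (\<forall>X\<in>smooth_vfields A. endo_apply J X \<in> smooth_vfields A)"

definition affine_connection ::
  "('a::topological_space, 'e::euclidean_space) chart set \<Rightarrow>
   ('a vfield \<Rightarrow> 'a vfield \<Rightarrow> 'a vfield) \<Rightarrow> bool" where
  "affine_connection A nab \<longleftrightarrow>
     (\<forall>X\<in>smooth_vfields A. \<forall>Y\<in>smooth_vfields A. nab X Y \<in> smooth_vfields A) \<and>
     (\<forall>X\<in>smooth_vfields A. \<forall>X'\<in>smooth_vfields A. \<forall>Y\<in>smooth_vfields A.
        nab (X + X') Y = nab X Y + nab X' Y \<and> nab Y (X + X') = nab Y X + nab Y X') \<and>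
     (\<forall>f. \<forall>X\<in>smooth_vfields A. \<forall>Y\<in>smooth_vfields A. smooth_fun A f \<longrightarrow>
        nab (fscale f X) Y = fscale f (nab X Y) \<and>
        nab X (fscale f Y) = fscale (vderiv X f) Y + fscale f (nab X Y))"

definition levi_civita ::
  "('a::topological_space, 'e::euclidean_space) chart set \<Rightarrow>
   ('a \<Rightarrow> 'a tvec \<Rightarrow> 'a tvec \<Rightarrow> real) \<Rightarrow> ('a vfield \<Rightarrow> 'a vfield \<Rightarrow> 'a vfield) \<Rightarrow> bool" where
  "levi_civita A g nab \<longleftrightarrow> affine_connection A nab \<and>
     (\<forall>X\<in>smooth_vfields A. \<forall>Y\<in>smooth_vfields A. nab X Y - nab Y X = lie_bracket A X Y) \<and>
     (\<forall>X\<in>smooth_vfields A. \<forall>Y\<in>smooth_vfields A. \<forall>Z\<in>smooth_vfields A.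
        vderiv X (\<lambda>p. g p (Y p) (Z p)) = (\<lambda>p. g p (nab X Y p) (Z p) + g p (Y p) (nab X Z p)))"

text \<open>\<open>cov_deriv_endo nab J X Y\<close> is \<open>(\<nabla>\<^sub>X J) Y\<close>.\<close>

definition cov_deriv_endo ::
  "('a vfield \<Rightarrow> 'a vfield \<Rightarrow> 'a vfield) \<Rightarrow> ('a \<Rightarrow> 'a tvec \<Rightarrow> 'a tvec) \<Rightarrow>
   'a vfield \<Rightarrow> 'a vfield \<Rightarrow> 'a vfield" where
  "cov_deriv_endo nab J X Y = nab X (endo_apply J Y) - endo_apply J (nab X Y)"

text \<open>Squared length at \<open>p\<close> of a three-form \<open>\<alpha>\<close> (as a function on vector fields):
  \<open>\<Sum>\<^bsub>i<j<k\<^esub> \<epsilon>\<^sub>i \<epsilon>\<^sub>j \<epsilon>\<^sub>k \<alpha>(E\<^sub>i,E\<^sub>j,E\<^sub>k)\<^sup>2\<close> for smooth vector fields \<open>E\<^sub>0,\<dots>,E\<^bsub>n-1\<^esub>\<close> which at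
  \<open>p\<close> form a pseudo-orthonormal basis with \<open>g(E\<^sub>i,E\<^sub>i) = \<epsilon>\<^sub>i \<in> {1,-1}\<close>; the value
  does not depend on their choice.\<close>

definition orthonormal_basis_at ::
  "('a::topological_space, 'e::euclidean_space) chart set \<Rightarrow>
   ('a \<Rightarrow> 'a tvec \<Rightarrow> 'a tvec \<Rightarrow> real) \<Rightarrow> 'a \<Rightarrow> (nat \<Rightarrow> 'a vfield) \<Rightarrow> bool" where
  "orthonormal_basis_at A g p E \<longleftrightarrow>
     (\<forall>i<DIM('e). E i \<in> smooth_vfields A) \<and>
     span ((\<lambda>i. E i p) ` {..<DIM('e)}) = tangent_space A p \<and>
     (\<forall>i<DIM('e). \<forall>j<DIM('e). if i = j then \<bar>g p (E i p) (E j p)\<bar> = 1 else g p (E i p) (E j p) = 0)"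

definition three_form_sqnorm ::
  "('a::topological_space, 'e::euclidean_space) chart set \<Rightarrow>
   ('a \<Rightarrow> 'a tvec \<Rightarrow> 'a tvec \<Rightarrow> real) \<Rightarrow>
   ('a vfield \<Rightarrow> 'a vfield \<Rightarrow> 'a vfield \<Rightarrow> 'a \<Rightarrow> real) \<Rightarrow> 'a \<Rightarrow> real" where
  "three_form_sqnorm A g \<alpha> p =
     (let E = (SOME E. orthonormal_basis_at A g p E); \<epsilon> = (\<lambda>i. g p (E i p) (E i p))
      in \<Sum>k<DIM('e). \<Sum>j<k. \<Sum>i<j. \<epsilon> i * \<epsilon> j * \<epsilon> k * (\<alpha> (E i) (E j) (E k) p)\<^sup>2)"

text \<open>For left-invariant structures, neither indefiniteness of \<open>g\<close> at \<open>p\<close> nor the value of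
  the squared length at \<open>p\<close> depends on \<open>p\<close>.\<close>

definition indefinite_at ::
  "('a::topological_space, 'e::euclidean_space) chart set \<Rightarrow>
   ('a \<Rightarrow> 'a tvec \<Rightarrow> 'a tvec \<Rightarrow> real) \<Rightarrow> 'a \<Rightarrow> bool" where
  "indefinite_at A g p \<longleftrightarrow>
     (\<exists>u\<in>tangent_space A p. g p u u > 0) \<and> (\<exists>u\<in>tangent_space A p. g p u u < 0)"

section \<open>Nearly \<open>\<epsilon>\<close>-Kaehler structures\<close>

definition almost_eps_hermitian ::
  "real \<Rightarrow> ('a::topological_space, 'e::euclidean_space) chart set \<Rightarrow>
   ('a \<Rightarrow> 'a tvec \<Rightarrow> 'a tvec \<Rightarrow> real) \<Rightarrow> ('a \<Rightarrow> 'a tvec \<Rightarrow> 'a tvec) \<Rightarrow>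
   ('a \<Rightarrow> 'a tvec \<Rightarrow> 'a tvec \<Rightarrow> real) \<Rightarrow> bool" where
  "almost_eps_hermitian \<epsilon> A g J \<omega> \<longleftrightarrow>
     even DIM('e) \<and> pseudo_riemannian_metric A g \<and> endomorphism_field A J \<and>
     (\<forall>p. \<forall>u\<in>tangent_space A p. J p (J p u) = \<epsilon> *\<^sub>R u) \<and>
     (\<epsilon> = 1 \<longrightarrow> (\<forall>p. dim {u \<in> tangent_space A p. J p u = u} = DIM('e) div 2 \<and>
                     dim {u \<in> tangent_space A p. J p u = - u} = DIM('e) div 2)) \<and>
     (\<forall>p. \<forall>u\<in>tangent_space A p. \<forall>v\<in>tangent_space A p. g p (J p u) (J p v) = - \<epsilon> * g p u v) \<and>
     (\<forall>p. \<forall>u\<in>tangent_space A p. \<forall>v\<in>tangent_space A p. \<omega> p u v = g p u (J p v))"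

text \<open>The Levi-Civita connection \<open>nab\<close> of \<open>g\<close> is an explicit argument below; it is unique as an
  operation on smooth vector fields.\<close>

definition nearly_eps_kaehler ::
  "real \<Rightarrow> ('a::topological_space, 'e::euclidean_space) chart set \<Rightarrow>
   ('a \<Rightarrow> 'a tvec \<Rightarrow> 'a tvec \<Rightarrow> real) \<Rightarrow> ('a \<Rightarrow> 'a tvec \<Rightarrow> 'a tvec) \<Rightarrow>
   ('a \<Rightarrow> 'a tvec \<Rightarrow> 'a tvec \<Rightarrow> real) \<Rightarrow> ('a vfield \<Rightarrow> 'a vfield \<Rightarrow> 'a vfield) \<Rightarrow> bool" where
  "nearly_eps_kaehler \<epsilon> A g J \<omega> nab \<longleftrightarrow>
     almost_eps_hermitian \<epsilon> A g J \<omega> \<and> levi_civita A g nab \<and>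
     (\<forall>X\<in>smooth_vfields A. cov_deriv_endo nab J X X = 0)"

abbreviation "nearly_para_kaehler \<equiv> nearly_eps_kaehler 1"

abbreviation "nearly_pseudo_kaehler \<equiv> nearly_eps_kaehler (-1)"

definition sqnorm_nabla_J ::
  "('a::topological_space, 'e::euclidean_space) chart set \<Rightarrow>
   ('a \<Rightarrow> 'a tvec \<Rightarrow> 'a tvec \<Rightarrow> real) \<Rightarrow> ('a \<Rightarrow> 'a tvec \<Rightarrow> 'a tvec) \<Rightarrow>
   ('a vfield \<Rightarrow> 'a vfield \<Rightarrow> 'a vfield) \<Rightarrow> 'a \<Rightarrow> real" where
  "sqnorm_nabla_J A g J nab =
     three_form_sqnorm A g (\<lambda>X Y Z p. g p (cov_deriv_endo nab J X Y p) (Z p))"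

definition left_invariant_structure ::
  "('a::{topological_space,group_add}, 'e::euclidean_space) chart set \<Rightarrow>
   ('a \<Rightarrow> 'a tvec \<Rightarrow> 'a tvec \<Rightarrow> real) \<Rightarrow> ('a \<Rightarrow> 'a tvec \<Rightarrow> 'a tvec) \<Rightarrow>
   ('a \<Rightarrow> 'a tvec \<Rightarrow> 'a tvec \<Rightarrow> real) \<Rightarrow> bool" where
  "left_invariant_structure A g J \<omega> \<longleftrightarrow>
     (\<forall>a p. \<forall>u\<in>tangent_space A p. \<forall>v\<in>tangent_space A p.
        g (a + p) (pushforward A ((+) a) p u) (pushforward A ((+) a) p v) = g p u v \<and>
        \<omega> (a + p) (pushforward A ((+) a) p u) (pushforward A ((+) a) p v) = \<omega> p u v) \<and>
     (\<forall>a p. \<forall>u\<in>tangent_space A p.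
        J (a + p) (pushforward A ((+) a) p u) = pushforward A ((+) a) p (J p u))"

end

theory Submission
  imports Defs
begin

text \<open>Evaluation at the identity turns a left-invariant structure into linear algebra on
  \<open>so(3) \<oplus> so(3) = \<real>\<^sup>3 \<oplus> \<real>\<^sup>3\<close>. Being nearly Kaehler, \<open>d\<omega>\<close> is a multiple of \<open>A\<close>, satisfies
  \<open>d\<omega>(JX,Y,Z) = d\<omega>(X,JY,Z)\<close>, and the Nijenhuis tensor is a multiple of \<open>J \<nabla>J\<close>. Since \<open>\<nabla>J\<close> anticommutes
  with \<open>J\<close>, its traces vanish, which by unimodularity forces \<open>\<omega>\<close> to be zero on each of the two
  factors. A singular value decomposition of the remaining block gives bases \<open>e\<^sub>i\<close>, \<open>f\<^sub>i\<close> of the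
  factors with \<open>\<omega>(e\<^sub>i,f\<^sub>j) = \<delta>\<^sub>i\<^sub>j p\<^sub>i\<close>; then \<open>J e\<^sub>i = a\<^sub>i e\<^sub>i + c\<^sub>i f\<^sub>i\<close>, the Nijenhuis equation reads
  \<open>a\<^sub>1 a\<^sub>2 = a\<^sub>2 a\<^sub>3 = a\<^sub>3 a\<^sub>1 = -\<epsilon>/3\<close>, which excludes \<open>\<epsilon> = 1\<close>
  because the product \<open>(a\<^sub>1 a\<^sub>2 a\<^sub>3)\<^sup>2\<close> is nonnegative, while for \<open>\<epsilon> = -1\<close> each of the three
  planes spanned by \<open>e\<^sub>i\<close>, \<open>f\<^sub>i\<close> is definite, with the same sign.\<close>

section \<open>Smooth functions on open subsets of Euclidean spaces\<close>

text \<open>Torsion-freeness and total skewness of A give -d omega = 3 A on left-invariant fields.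
  This removes the connection: the type condition and the Nijenhuis equation become identities in
  \<open>om\<close>, \<open>J\<close> and the bracket alone. The factor 3 here and the factor 4 in
  the Nijenhuis tensor produce the constant 1/3, because 4/3 - 1 = 1/3. The singular value
  decomposition is compatible with the Lie algebra structure because rotations preserve the cross
  product: the third singular vector of each factor is taken to be the cross product of the first
  two, at the price of a possibly negative third \<open>p\<close>. The three planes have the same
  sign because the products \<open>c_i * p_i\<close> do not depend on i. The obstacle on the
  geometric side is that so(3) is given through vector fields on the factors while the structure
  lives on the product. The bridge is the lift of a pair of fields. It has to respect brackets, so
  derivatives along different factors must commute, and this rests on the symmetry of second
  derivatives.\<close>

lemma C_k_on_cong:
  assumes "open S" "\<And>x. x \<in> S \<Longrightarrow> f x = g x" "C_k_on k S f"
  shows "C_k_on k S g"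
  using assms(2,3)
proof (induction k arbitrary: f g)
  case 0
  then show ?case using continuous_on_cong[of S S f g] by simp
next
  case (Suc k)
  have d: "f differentiable (at x)" if "x \<in> S" for x using Suc.prems(2) that by simp
  have "g differentiable (at x)" if "x \<in> S" for x
    using d[OF that] has_derivative_transform_within_open[of f _ x UNIV S g] assms(1) that Suc.prems(1)
    unfolding differentiable_def by blast
  moreover have "C_k_on k S (\<lambda>x. frechet_derivative g (at x) v)" for v
  proof (rule Suc.IH)
    show "C_k_on k S (\<lambda>x. frechet_derivative f (at x) v)" using Suc.prems(2) by simp
    show "frechet_derivative f (at x) v = frechet_derivative g (at x) v" if "x \<in> S" for x
      using frechet_derivative_transform_within_open[OF d[OF that] assms(1) that Suc.prems(1)] by simp
  qed
  ultimately show ?case by simp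
qed

lemma C_k_on_SucI:
  assumes "open S" "\<And>x. x \<in> S \<Longrightarrow> (f has_derivative f' x) (at x)" "\<And>v. C_k_on k S (\<lambda>x. f' x v)"
  shows "C_k_on (Suc k) S f"
  using assms(2) frechet_derivative_at[OF assms(2)] C_k_on_cong[OF assms(1) _ assms(3)]
  by (auto simp: differentiable_def)

lemma C_k_on_SucD:
  assumes "C_k_on (Suc k) S f"
  shows "x \<in> S \<Longrightarrow> (f has_derivative frechet_derivative f (at x)) (at x)"
    "C_k_on k S (\<lambda>x. frechet_derivative f (at x) v)"
  using assms by (auto simp flip: frechet_derivative_works)

lemma C_k_on_Suc_imp: "C_k_on (Suc k) S f \<Longrightarrow> C_k_on k S f"
proof (induction k arbitrary: f)
  case 0
  then show ?case
    by (simp add: continuous_at_imp_continuous_on differentiable_imp_continuous_within)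
next
  case (Suc k)
  then show ?case by simp
qed

lemma C_k_on_subset: "C_k_on k S f \<Longrightarrow> T \<subseteq> S \<Longrightarrow> C_k_on k T f"
proof (induction k arbitrary: f)
  case 0
  then show ?case using continuous_on_subset by auto
next
  case (Suc k)
  then show ?case by auto
qed

text \<open>Derivatives are taken at \<open>x\<close> and not within \<open>S\<close>, so only a
  neighbourhood of each point matters, and the sets \<open>T\<close> may leave
  \<open>S\<close>.\<close>

lemma C_k_on_locally:
  assumes "\<And>x. x \<in> S \<Longrightarrow> \<exists>T. open T \<and> x \<in> T \<and> C_k_on k T f"
  shows "C_k_on k S f"
  using assms
proof (induction k arbitrary: f)
  case 0
  have "isCont f x" if "x \<in> S" for x
    using 0[OF that] continuous_on_eq_continuous_at by auto
  then show ?case by (simp add: continuous_at_imp_continuous_on)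
next
  case (Suc k)
  have "f differentiable (at x)" if "x \<in> S" for x
    using Suc.prems[OF that] by auto
  moreover have "C_k_on k S (\<lambda>x. frechet_derivative f (at x) v)" for v
    using Suc.prems by (intro Suc.IH) fastforce
  ultimately show ?case by simp
qed

lemma C_k_on_const: "open S \<Longrightarrow> C_k_on k S (\<lambda>x. c)"
proof (induction k arbitrary: c)
  case (Suc k)
  show ?case by (rule C_k_on_SucI[OF Suc.prems has_derivative_const]) (rule Suc.IH[OF Suc.prems])
qed simp

lemma C_k_on_bounded_linear:
  assumes "open S" "bounded_linear h" "C_k_on k S f"
  shows "C_k_on k S (\<lambda>x. h (f x))"
  using assms(3)
proof (induction k arbitrary: f)
  case 0
  then show ?case using bounded_linear.continuous_on[OF assms(2)] by simp
next
  case (Suc k)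
  show ?case
    by (rule C_k_on_SucI[OF assms(1) bounded_linear.has_derivative[OF assms(2) C_k_on_SucD(1)[OF Suc.prems]]])
       (auto intro!: Suc.IH C_k_on_SucD(2)[OF Suc.prems])
qed

lemma C_k_on_inner: "open S \<Longrightarrow> C_k_on k S f \<Longrightarrow> C_k_on k S (\<lambda>x. f x \<bullet> c)"
  by (rule C_k_on_bounded_linear[OF _ bounded_linear_inner_left])

lemma C_k_on_id: "open S \<Longrightarrow> C_k_on k S (\<lambda>x. x)"
proof (cases k)
  case (Suc j)
  assume "open S"
  then show ?thesis
    unfolding Suc by (rule C_k_on_SucI[OF _ has_derivative_ident]) (rule C_k_on_const[OF \<open>open S\<close>])
qed simp

lemma C_k_on_add:
  assumes "open S" "C_k_on k S f" "C_k_on k S g"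
  shows "C_k_on k S (\<lambda>x. f x + g x)"
  using assms(2,3)
proof (induction k arbitrary: f g)
  case 0
  then show ?case by (simp add: continuous_on_add)
next
  case (Suc k)
  show ?case
    by (rule C_k_on_SucI[OF assms(1) has_derivative_add])
       (auto intro!: Suc.IH C_k_on_SucD[OF Suc.prems(1)] C_k_on_SucD[OF Suc.prems(2)])
qed

lemma C_k_on_sum:
  assumes "open S" "\<And>i. i \<in> I \<Longrightarrow> C_k_on k S (f i)"
  shows "C_k_on k S (\<lambda>x. \<Sum>i\<in>I. f i x)"
  using assms(2)
  by (induction I rule: infinite_finite_induct) (auto intro!: C_k_on_const C_k_on_add assms(1))

lemma C_k_on_scaleR:
  assumes "open S" "C_k_on k S r" "C_k_on k S f"
  shows "C_k_on k S (\<lambda>x. r x *\<^sub>R f x)"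
  using assms(2,3)
proof (induction k arbitrary: r f)
  case 0
  then show ?case by (simp add: continuous_on_scaleR)
next
  case (Suc k)
  show ?case
    by (rule C_k_on_SucI[OF assms(1) has_derivative_scaleR])
       (auto intro!: Suc.IH C_k_on_add assms(1) C_k_on_SucD[OF Suc.prems(1)] C_k_on_SucD[OF Suc.prems(2)]
         C_k_on_Suc_imp[OF Suc.prems(1)] C_k_on_Suc_imp[OF Suc.prems(2)])
qed

lemma C_k_on_Pair:
  assumes "open S" "C_k_on k S f" "C_k_on k S g"
  shows "C_k_on k S (\<lambda>x. (f x, g x))"
  using assms(2,3)
proof (induction k arbitrary: f g)
  case 0
  then show ?case by (simp add: continuous_on_Pair)
next
  case (Suc k)
  show ?case
    by (rule C_k_on_SucI[OF assms(1) has_derivative_Pair])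
       (auto intro!: Suc.IH C_k_on_SucD[OF Suc.prems(1)] C_k_on_SucD[OF Suc.prems(2)])
qed

lemma linear_Basis_expansion:
  fixes L :: "'a::euclidean_space \<Rightarrow> 'b::real_vector"
  assumes "linear L"
  shows "L x = (\<Sum>b\<in>Basis. (x \<bullet> b) *\<^sub>R L b)"
proof -
  have "L x = L (\<Sum>b\<in>Basis. (x \<bullet> b) *\<^sub>R b)" by (simp add: euclidean_representation)
  then show ?thesis using assms by (simp add: linear_sum linear_scale)
qed

lemma C_k_on_compose:
  assumes "open S" "open T" "C_k_on k S f" "C_k_on k T g" "f ` S \<subseteq> T"
  shows "C_k_on k S (\<lambda>x. g (f x))"
  using assms(3,4)
proof (induction k arbitrary: g)
  case 0
  then show ?case using continuous_on_compose2[of T g S f] assms(5) by simp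
next
  case (Suc k)
  have fT: "f x \<in> T" if "x \<in> S" for x using that assms(5) by auto
  \<comment> \<open>The chain rule evaluates the derivative of \<open>g\<close> in a direction
    depending on \<open>x\<close>, while \<open>C_k_on\<close> speaks of fixed directions. Expanding
    over \<open>Basis\<close> leaves scalar coefficients times derivatives of \<open>g\<close> in
    the fixed directions \<open>b\<close>, to which the induction hypothesis applies.\<close>
  let ?D = "\<lambda>x v. \<Sum>b\<in>Basis. (frechet_derivative f (at x) v \<bullet> b) *\<^sub>R frechet_derivative g (at (f x)) b"
  show ?case
  proof (rule C_k_on_SucI[OF assms(1)])
    fix x assume x: "x \<in> S"
    have "((\<lambda>x. g (f x)) has_derivative (\<lambda>v. frechet_derivative g (at (f x)) (frechet_derivative f (at x) v))) (at x)"
      using diff_chain_at[OF C_k_on_SucD(1)[OF Suc.prems(1) x] C_k_on_SucD(1)[OF Suc.prems(2) fT[OF x]]]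
      by (simp add: o_def)
    moreover have "linear (frechet_derivative g (at (f x)))"
      using C_k_on_SucD(1)[OF Suc.prems(2) fT[OF x]] has_derivative_linear by blast
    ultimately show "((\<lambda>x. g (f x)) has_derivative ?D x) (at x)"
      by (simp add: linear_Basis_expansion[of "frechet_derivative g (at (f x))"])
  next
    fix v
    show "C_k_on k S (\<lambda>x. ?D x v)"
      by (rule C_k_on_sum[OF assms(1)], rule C_k_on_scaleR[OF assms(1)],
          rule C_k_on_inner[OF assms(1) C_k_on_SucD(2)[OF Suc.prems(1)]],
          rule Suc.IH[OF C_k_on_Suc_imp[OF Suc.prems(1)] C_k_on_SucD(2)[OF Suc.prems(2)]])
  qed
qed

text \<open>An index shift: index \<open>Suc k\<close> for \<open>f\<close> is index
  \<open>k\<close> for its directional derivatives, and conversely index \<open>k\<close> follows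
  from \<open>Suc k\<close>, which also covers \<open>k = 0\<close>.\<close>

lemma smooth_on_iff:
  "smooth_on S f \<longleftrightarrow> (\<forall>x\<in>S. f differentiable (at x)) \<and>
     (\<forall>v. smooth_on S (\<lambda>x. frechet_derivative f (at x) v))"
proof
  assume s: "smooth_on S f"
  then have "C_k_on (Suc k) S f" for k unfolding smooth_on_def by blast
  then show "(\<forall>x\<in>S. f differentiable (at x)) \<and> (\<forall>v. smooth_on S (\<lambda>x. frechet_derivative f (at x) v))"
    unfolding smooth_on_def by auto
next
  assume r: "(\<forall>x\<in>S. f differentiable (at x)) \<and> (\<forall>v. smooth_on S (\<lambda>x. frechet_derivative f (at x) v))"
  then have "C_k_on (Suc k) S f" for k by (auto simp: smooth_on_def)
  then show "smooth_on S f" unfolding smooth_on_def by (blast intro: C_k_on_Suc_imp)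
qed

lemma smooth_on_has_derivative:
  "smooth_on S f \<Longrightarrow> x \<in> S \<Longrightarrow> (f has_derivative frechet_derivative f (at x)) (at x)"
  unfolding frechet_derivative_works[symmetric] using smooth_on_iff by blast

lemma smooth_on_linear_derivative:
  "smooth_on S f \<Longrightarrow> x \<in> S \<Longrightarrow> linear (frechet_derivative f (at x))"
  using smooth_on_has_derivative has_derivative_linear by blast

lemma smooth_on_derivative: "smooth_on S f \<Longrightarrow> smooth_on S (\<lambda>x. frechet_derivative f (at x) v)"
  using smooth_on_iff by blast

lemma smooth_on_cong: "smooth_on S f \<Longrightarrow> open S \<Longrightarrow> (\<And>x. x \<in> S \<Longrightarrow> f x = g x) \<Longrightarrow> smooth_on S g"
  unfolding smooth_on_def using C_k_on_cong by metis

lemma smooth_on_subset: "smooth_on S f \<Longrightarrow> T \<subseteq> S \<Longrightarrow> smooth_on T f"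
  unfolding smooth_on_def using C_k_on_subset by blast

lemma smooth_on_locally:
  "(\<And>x. x \<in> S \<Longrightarrow> \<exists>T. open T \<and> x \<in> T \<and> smooth_on T f) \<Longrightarrow> smooth_on S f"
  unfolding smooth_on_def using C_k_on_locally by metis

lemma smooth_on_continuous_on: "smooth_on S f \<Longrightarrow> continuous_on S f"
  unfolding smooth_on_def by (metis C_k_on.simps(1))

lemma smooth_on_const: "open S \<Longrightarrow> smooth_on S (\<lambda>x. c)"
  unfolding smooth_on_def using C_k_on_const by blast

lemma smooth_on_id: "open S \<Longrightarrow> smooth_on S (\<lambda>x. x)"
  unfolding smooth_on_def using C_k_on_id by blast

lemma smooth_on_bounded_linear:
  "open S \<Longrightarrow> bounded_linear h \<Longrightarrow> smooth_on S f \<Longrightarrow> smooth_on S (\<lambda>x. h (f x))"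
  unfolding smooth_on_def using C_k_on_bounded_linear by blast

lemma smooth_on_inner: "open S \<Longrightarrow> smooth_on S f \<Longrightarrow> smooth_on S (\<lambda>x. f x \<bullet> c)"
  unfolding smooth_on_def using C_k_on_inner by blast

lemma smooth_on_add: "open S \<Longrightarrow> smooth_on S f \<Longrightarrow> smooth_on S g \<Longrightarrow> smooth_on S (\<lambda>x. f x + g x)"
  unfolding smooth_on_def using C_k_on_add[of S _ f g] by blast

lemma smooth_on_sum:
  "open S \<Longrightarrow> (\<And>i. i \<in> I \<Longrightarrow> smooth_on S (f i)) \<Longrightarrow> smooth_on S (\<lambda>x. \<Sum>i\<in>I. f i x)"
  unfolding smooth_on_def by (simp add: C_k_on_sum)

lemma smooth_on_scaleR:
  "open S \<Longrightarrow> smooth_on S r \<Longrightarrow> smooth_on S f \<Longrightarrow> smooth_on S (\<lambda>x. r x *\<^sub>R f x)"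
  unfolding smooth_on_def using C_k_on_scaleR[of S _ r f] by blast

lemma smooth_on_Pair: "open S \<Longrightarrow> smooth_on S f \<Longrightarrow> smooth_on S g \<Longrightarrow> smooth_on S (\<lambda>x. (f x, g x))"
  unfolding smooth_on_def using C_k_on_Pair[of S _ f g] by blast

lemma smooth_on_compose:
  "open S \<Longrightarrow> open T \<Longrightarrow> smooth_on S f \<Longrightarrow> smooth_on T g \<Longrightarrow> f ` S \<subseteq> T \<Longrightarrow> smooth_on S (\<lambda>x. g (f x))"
  unfolding smooth_on_def using C_k_on_compose[of S T _ f g] by blast

text \<open>In a chart, a vector field acts as a derivative in a direction that varies with the
  point; this is what makes the result smooth again.\<close>

lemma smooth_on_derivative_apply:
  assumes "open S" "smooth_on S f" "smooth_on S \<xi>"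
  shows "smooth_on S (\<lambda>x. frechet_derivative f (at x) (\<xi> x))"
proof (rule smooth_on_cong[OF _ assms(1)])
  show "smooth_on S (\<lambda>x. \<Sum>b\<in>Basis. (\<xi> x \<bullet> b) *\<^sub>R frechet_derivative f (at x) b)"
    by (rule smooth_on_sum[OF assms(1)], rule smooth_on_scaleR[OF assms(1)],
        rule smooth_on_inner[OF assms(1,3)], rule smooth_on_derivative[OF assms(2)])
  show "(\<Sum>b\<in>Basis. (\<xi> x \<bullet> b) *\<^sub>R frechet_derivative f (at x) b) = frechet_derivative f (at x) (\<xi> x)"
    if "x \<in> S" for x
    using linear_Basis_expansion[OF smooth_on_linear_derivative[OF assms(2) that]] by metis
qed

section \<open>Symmetry of second derivatives\<close>

lemma second_difference_mvt:
  fixes f :: "'a::euclidean_space \<Rightarrow> real"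
  assumes f: "smooth_on (ball x r) f" and h: "h > 0" "h * (norm v + norm w) < r"
  shows "\<exists>a\<in>ball x r. f (x + h *\<^sub>R v + h *\<^sub>R w) - f (x + h *\<^sub>R v) - f (x + h *\<^sub>R w) + f x
    = h * h * frechet_derivative (\<lambda>y. frechet_derivative f (at y) v) (at a) w"
proof -
  let ?F = "\<lambda>y. frechet_derivative f (at y) v"
  have inb: "x + s *\<^sub>R v + t *\<^sub>R w \<in> ball x r" if "0 \<le> s" "s \<le> h" "0 \<le> t" "t \<le> h" for s t
  proof -
    have "norm (s *\<^sub>R v + t *\<^sub>R w) \<le> s * norm v + t * norm w"
      using norm_triangle_ineq[of "s *\<^sub>R v" "t *\<^sub>R w"] that by simp
    also have "\<dots> \<le> h * norm v + h * norm w"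
      using that by (intro add_mono mult_right_mono) auto
    finally have "norm (s *\<^sub>R v + t *\<^sub>R w) < r" using h by (simp add: distrib_left)
    moreover have "x - (x + s *\<^sub>R v + t *\<^sub>R w) = - (s *\<^sub>R v + t *\<^sub>R w)" by simp
    ultimately show ?thesis by (simp only: mem_ball dist_norm norm_minus_cancel)
  qed
  have line: "((\<lambda>s. g (b + s *\<^sub>R u)) has_real_derivative frechet_derivative g (at (b + s *\<^sub>R u)) u) (at s)"
    if "smooth_on (ball x r) g" "b + s *\<^sub>R u \<in> ball x r" for g :: "'a \<Rightarrow> real" and b u s
  proof -
    have "((\<lambda>s. b + s *\<^sub>R u) has_derivative (\<lambda>s. s *\<^sub>R u)) (at s)"
      by (auto intro!: derivative_eq_intros)
    then have "((\<lambda>s. g (b + s *\<^sub>R u)) has_derivative (\<lambda>s'. frechet_derivative g (at (b + s *\<^sub>R u)) (s' *\<^sub>R u))) (at s)"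
      using diff_chain_at[of "\<lambda>s. b + s *\<^sub>R u" "\<lambda>s. s *\<^sub>R u" s g] smooth_on_has_derivative[OF that] by (simp add: o_def)
    then show ?thesis
      unfolding has_field_derivative_def using smooth_on_linear_derivative[OF that]
      by (simp add: linear_scale mult_commute_abs)
  qed
  \<comment> \<open>The second difference is the increment of \<open>q\<close> over [0, h]. The mean
    value theorem in direction \<open>v\<close> turns it into a first difference of
    \<open>?F\<close> in direction \<open>w\<close>, to which the theorem is applied once
    more.\<close>
  define q where "q s = f (x + h *\<^sub>R w + s *\<^sub>R v) - f (x + s *\<^sub>R v)" for s
  have "\<exists>s>0. s < h \<and> q h - q 0 = (h - 0) * (?F (x + h *\<^sub>R w + s *\<^sub>R v) - ?F (x + s *\<^sub>R v))"
  proof (rule MVT2[OF h(1)])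
    fix s assume s: "0 \<le> s" "s \<le> h"
    show "(q has_real_derivative ?F (x + h *\<^sub>R w + s *\<^sub>R v) - ?F (x + s *\<^sub>R v)) (at s)"
      unfolding q_def using inb[of s h] inb[of s 0] s h
      by (intro DERIV_diff line f) (simp_all add: algebra_simps)
  qed
  then obtain s where s: "0 < s" "s < h"
    "q h - q 0 = h * (?F (x + h *\<^sub>R w + s *\<^sub>R v) - ?F (x + s *\<^sub>R v))" by auto
  define p where "p t = ?F (x + s *\<^sub>R v + t *\<^sub>R w)" for t
  have "\<exists>t>0. t < h \<and> p h - p 0 = (h - 0) * frechet_derivative ?F (at (x + s *\<^sub>R v + t *\<^sub>R w)) w"
  proof (rule MVT2[OF h(1)])
    fix t assume t: "0 \<le> t" "t \<le> h"
    show "(p has_real_derivative frechet_derivative ?F (at (x + s *\<^sub>R v + t *\<^sub>R w)) w) (at t)"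
      unfolding p_def by (intro line smooth_on_derivative f inb) (use s t in auto)
  qed
  then obtain t where t: "0 < t" "t < h"
    "p h - p 0 = h * frechet_derivative ?F (at (x + s *\<^sub>R v + t *\<^sub>R w)) w" by auto
  have "f (x + h *\<^sub>R v + h *\<^sub>R w) - f (x + h *\<^sub>R v) - f (x + h *\<^sub>R w) + f x = q h - q 0"
    by (simp add: q_def add.commute add.left_commute)
  also have "\<dots> = h * (p h - p 0)"
    using s(3) by (simp add: p_def add.commute add.left_commute)
  also have "\<dots> = h * h * frechet_derivative ?F (at (x + s *\<^sub>R v + t *\<^sub>R w)) w"
    using t(3) by simp
  finally show ?thesis using inb[of s t] s t by (intro bexI) auto
qed

text \<open>The second difference is unchanged when \<open>v\<close> and \<open>w\<close> are
  swapped, so the two mixed derivatives agree at suitable points \<open>a\<close> and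
  \<open>b\<close> close to \<open>x\<close>. By continuity each is within \<open>e\<close> of its
  value at \<open>x\<close>, which contradicts a gap of 2e there.\<close>

lemma symmetric_second_derivative:
  fixes f :: "'a::euclidean_space \<Rightarrow> real"
  assumes "open S" "smooth_on S f" "x \<in> S"
  shows "frechet_derivative (\<lambda>y. frechet_derivative f (at y) v) (at x) w
    = frechet_derivative (\<lambda>y. frechet_derivative f (at y) w) (at x) v" (is "?F v w x = ?F w v x")
proof (rule ccontr)
  assume ne: "?F v w x \<noteq> ?F w v x"
  define e where "e = \<bar>?F v w x - ?F w v x\<bar> / 2"
  have e: "e > 0" using ne by (simp add: e_def)
  have "isCont (\<lambda>y. ?F u u' y) x" for u u'
    using smooth_on_continuous_on[OF smooth_on_derivative[OF smooth_on_derivative[OF assms(2)]]]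
      assms(1,3) continuous_on_eq_continuous_at by blast
  then obtain r1 r2 where r12: "r1 > 0" "\<And>y. dist y x < r1 \<Longrightarrow> dist (?F v w y) (?F v w x) < e"
    "r2 > 0" "\<And>y. dist y x < r2 \<Longrightarrow> dist (?F w v y) (?F w v x) < e"
    unfolding continuous_at_eps_delta using e by meson
  obtain r0 where r0: "r0 > 0" "ball x r0 \<subseteq> S" using assms open_contains_ball by blast
  define r where "r = min r0 (min r1 r2)"
  have r: "r > 0" using r0 r12 by (simp add: r_def)
  have sm: "smooth_on (ball x r) f"
    using smooth_on_subset[OF assms(2)] r0(2) by (simp add: r_def subset_iff)
  \<comment> \<open>Small enough for the parallelogram to stay in the ball; the summand 1 keeps the
    denominator positive when \<open>v\<close> and \<open>w\<close> are both zero.\<close>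
  define h where "h = r / (2 * (norm v + norm w + 1))"
  have n: "norm v + norm w + 1 > 0" by (simp add: add_nonneg_pos)
  have h: "h > 0" using r n by (simp add: h_def)
  have "h * (norm v + norm w) < h * (2 * (norm v + norm w + 1))"
    using h n by (intro mult_strict_left_mono) (auto simp: add_nonneg_pos)
  also have "\<dots> = r" using n by (simp add: h_def)
  finally have hr: "h * (norm v + norm w) < r" .
  obtain a where a: "a \<in> ball x r" "f (x + h *\<^sub>R v + h *\<^sub>R w) - f (x + h *\<^sub>R v) - f (x + h *\<^sub>R w) + f x = h * h * ?F v w a"
    using second_difference_mvt[OF sm h hr] by blast
  obtain b where b: "b \<in> ball x r" "f (x + h *\<^sub>R w + h *\<^sub>R v) - f (x + h *\<^sub>R w) - f (x + h *\<^sub>R v) + f x = h * h * ?F w v b"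
    using second_difference_mvt[OF sm h, of w v] hr by (auto simp: add.commute)
  have "h * h * ?F v w a = h * h * ?F w v b"
    unfolding a(2)[symmetric] b(2)[symmetric] by (simp add: add.commute add.left_commute)
  then have "?F v w a = ?F w v b" using h by simp
  moreover have "dist (?F v w a) (?F v w x) < e" using a(1) r12(2)[of a] by (simp add: r_def dist_commute)
  moreover have "dist (?F w v b) (?F w v x) < e" using b(1) r12(4)[of b] by (simp add: r_def dist_commute)
  ultimately have "dist (?F v w x) (?F w v x) < e + e"
    using dist_triangle[of "?F v w x" "?F w v x" "?F v w a"] by (simp add: dist_commute)
  then show False by (simp add: e_def dist_real_def)
qed

section \<open>Tangent vectors and vector fields in charts\<close>

locale smooth_manifold =
  fixes A :: "('a::{t2_space,second_countable_topology}, 'e::euclidean_space) chart set"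
  assumes atlas: "smooth_atlas A"
begin

lemma chart_homeomorphism:
  assumes "(U, \<phi>) \<in> A"
  shows "open U" "open (\<phi> ` U)" "homeomorphism U (\<phi> ` U) \<phi> (inv_into U \<phi>)"
  using atlas assms unfolding smooth_atlas_def by fast+

lemma chart_inv [simp]:
  assumes "(U, \<phi>) \<in> A" "p \<in> U"
  shows "inv_into U \<phi> (\<phi> p) = p"
  using chart_homeomorphism(3)[OF assms(1)] assms(2) by (simp add: homeomorphism_def)

lemma chart_open_image:
  assumes "(U, \<phi>) \<in> A" "open N"
  shows "open (\<phi> ` (U \<inter> N))"
proof -
  have "openin (top_of_set (\<phi> ` U)) (\<phi> ` (U \<inter> N))"
    using homeomorphism_imp_open_map[OF chart_homeomorphism(3)[OF assms(1)]] assms(2)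
    by (simp add: openin_open_Int)
  then show ?thesis using chart_homeomorphism(2)[OF assms(1)] openin_open_trans by blast
qed

lemma chart_open_preimage:
  assumes "(U, \<phi>) \<in> A" "open T"
  shows "open (U \<inter> \<phi> -` T)"
  using chart_homeomorphism[OF assms(1)] assms(2) continuous_on_open_vimage[of U \<phi>]
  by (metis Int_commute homeomorphism_def)

lemma chart_transition:
  assumes "(U, \<phi>) \<in> A" "(V, \<psi>) \<in> A"
  shows "smooth_on (\<phi> ` (U \<inter> V)) (\<psi> \<circ> inv_into U \<phi>)"
  using atlas assms unfolding smooth_atlas_def by fast

lemma chart_exists: obtains U \<phi> where "(U, \<phi>) \<in> A" "p \<in> U"
proof -
  have "p \<in> (\<Union>(U, \<phi>)\<in>A. U)" using atlas unfolding smooth_atlas_def by simp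
  then show ?thesis using that by blast
qed

text \<open>One chart around \<open>p\<close> is enough: inside \<open>U\<close> every other chart
  is reached through a transition map. Hence the neighbourhood is shrunk to
  \<open>U \<inter> N\<close>.\<close>

lemma smooth_atI:
  assumes c: "(U, \<phi>) \<in> A" and N: "p \<in> U" "open N" "p \<in> N"
    and f: "smooth_on (\<phi> ` (U \<inter> N)) (f \<circ> inv_into U \<phi>)"
  shows "smooth_at A p f"
  unfolding smooth_at_def
proof (intro exI[of _ "U \<inter> N"] conjI)
  show "open (U \<inter> N)" "p \<in> U \<inter> N" using N chart_homeomorphism(1)[OF c] by auto
  show "\<forall>(V, \<psi>)\<in>A. smooth_on (\<psi> ` (V \<inter> (U \<inter> N))) (f \<circ> inv_into V \<psi>)"
  proof safe
    fix V \<psi> assume d: "(V, \<psi>) \<in> A"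
    let ?S = "\<psi> ` (V \<inter> (U \<inter> N))"
    have oS: "open ?S" using chart_open_image[OF d] N chart_homeomorphism(1)[OF c] by auto
    have t: "smooth_on ?S (\<phi> \<circ> inv_into V \<psi>)"
      by (rule smooth_on_subset[OF chart_transition[OF d c]]) auto
    have "smooth_on ?S (\<lambda>x. (f \<circ> inv_into U \<phi>) ((\<phi> \<circ> inv_into V \<psi>) x))"
      by (rule smooth_on_compose[OF oS chart_open_image[OF c N(2)] t f]) (use d in auto)
    then show "smooth_on ?S (f \<circ> inv_into V \<psi>)"
      by (rule smooth_on_cong[OF _ oS]) (use c d in auto)
  qed
qed

lemma smooth_atE:
  assumes "smooth_at A p f"
  obtains N where "open N" "p \<in> N"
    "\<And>U \<phi>. (U, \<phi>) \<in> A \<Longrightarrow> smooth_on (\<phi> ` (U \<inter> N)) (f \<circ> inv_into U \<phi>)"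
  using assms unfolding smooth_at_def by blast

lemma smooth_at_differentiable:
  assumes "smooth_at A p f" "(U, \<phi>) \<in> A" "p \<in> U"
  shows "(f \<circ> inv_into U \<phi> has_derivative frechet_derivative (f \<circ> inv_into U \<phi>) (at (\<phi> p))) (at (\<phi> p))"
proof -
  obtain N where "open N" "p \<in> N" "smooth_on (\<phi> ` (U \<inter> N)) (f \<circ> inv_into U \<phi>)"
    using smooth_atE[OF assms(1)] assms(2) by metis
  then show ?thesis using assms(3) by (intro smooth_on_has_derivative) auto
qed

lemma smooth_at_nbhd:
  assumes "smooth_at A p f"
  obtains N where "open N" "p \<in> N" "\<And>q. q \<in> N \<Longrightarrow> smooth_at A q f"
  using assms unfolding smooth_at_def by blast

lemma smooth_at_cong:
  assumes "open N" "p \<in> N" "\<And>q. q \<in> N \<Longrightarrow> f q = g q" "smooth_at A p f"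
  shows "smooth_at A p g"
proof -
  obtain N' where N': "open N'" "p \<in> N'"
    "\<And>U \<phi>. (U, \<phi>) \<in> A \<Longrightarrow> smooth_on (\<phi> ` (U \<inter> N')) (f \<circ> inv_into U \<phi>)"
    using smooth_atE[OF assms(4)] by blast
  obtain U \<phi> where c: "(U, \<phi>) \<in> A" "p \<in> U" using chart_exists by blast
  have o: "open (\<phi> ` (U \<inter> (N \<inter> N')))" using c assms(1) N'(1) by (intro chart_open_image) auto
  have "smooth_on (\<phi> ` (U \<inter> (N \<inter> N'))) (f \<circ> inv_into U \<phi>)"
    by (rule smooth_on_subset[OF N'(3)[OF c(1)]]) auto
  then have "smooth_on (\<phi> ` (U \<inter> (N \<inter> N'))) (g \<circ> inv_into U \<phi>)"
    by (rule smooth_on_cong[OF _ o]) (use c assms(3) in auto)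
  then show ?thesis using assms(1,2) N'(1,2) by (intro smooth_atI[OF c, of "N \<inter> N'"]) auto
qed

lemma smooth_at_add:
  assumes "smooth_at A p f" "smooth_at A p g"
  shows "smooth_at A p (\<lambda>q. f q + g q)"
proof -
  obtain N N' where N: "open N" "p \<in> N" "open N'" "p \<in> N'"
    "\<And>U \<phi>. (U, \<phi>) \<in> A \<Longrightarrow> smooth_on (\<phi> ` (U \<inter> N)) (f \<circ> inv_into U \<phi>)"
    "\<And>U \<phi>. (U, \<phi>) \<in> A \<Longrightarrow> smooth_on (\<phi> ` (U \<inter> N')) (g \<circ> inv_into U \<phi>)"
    using smooth_atE[OF assms(1)] smooth_atE[OF assms(2)] by metis
  obtain U \<phi> where c: "(U, \<phi>) \<in> A" "p \<in> U" using chart_exists by blast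
  have o: "open (\<phi> ` (U \<inter> (N \<inter> N')))" using c N by (intro chart_open_image) auto
  have "smooth_on (\<phi> ` (U \<inter> (N \<inter> N'))) (\<lambda>x. (f \<circ> inv_into U \<phi>) x + (g \<circ> inv_into U \<phi>) x)"
    by (rule smooth_on_add[OF o smooth_on_subset[OF N(5)[OF c(1)]] smooth_on_subset[OF N(6)[OF c(1)]]]) auto
  then show ?thesis using N by (intro smooth_atI[OF c, of "N \<inter> N'"]) (auto simp: o_def)
qed

section \<open>Tangent vectors in charts\<close>

lemma chart_tvec_add:
  assumes "(U, \<phi>) \<in> A" "p \<in> U"
  shows "chart_tvec A (U, \<phi>) p (w + w') = chart_tvec A (U, \<phi>) p w + chart_tvec A (U, \<phi>) p w'"
  using has_derivative_linear[OF smooth_at_differentiable[OF _ assms]]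
  by (auto simp: fun_eq_iff chart_tvec_def linear_add)

lemma chart_tvec_scale:
  assumes "(U, \<phi>) \<in> A" "p \<in> U"
  shows "chart_tvec A (U, \<phi>) p (c *\<^sub>R w) = c *\<^sub>R chart_tvec A (U, \<phi>) p w"
  using has_derivative_linear[OF smooth_at_differentiable[OF _ assms]]
  by (auto simp: fun_eq_iff chart_tvec_def linear_scale scaleR_fun_def)

lemma chart_tvec_change:
  assumes c: "(U, \<phi>) \<in> A" "p \<in> U" and d: "(V, \<psi>) \<in> A" "p \<in> V"
  shows "chart_tvec A (U, \<phi>) p w =
    chart_tvec A (V, \<psi>) p (frechet_derivative (\<psi> \<circ> inv_into U \<phi>) (at (\<phi> p)) w)"
proof
  fix f
  show "chart_tvec A (U, \<phi>) p w f =
    chart_tvec A (V, \<psi>) p (frechet_derivative (\<psi> \<circ> inv_into U \<phi>) (at (\<phi> p)) w) f"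
  proof (cases "smooth_at A p f")
    case True
    let ?S = "\<phi> ` (U \<inter> V)"
    have S: "open ?S" "\<phi> p \<in> ?S" using chart_open_image[OF c(1) chart_homeomorphism(1)[OF d(1)]] c d by auto
    have t: "(\<psi> \<circ> inv_into U \<phi> has_derivative frechet_derivative (\<psi> \<circ> inv_into U \<phi>) (at (\<phi> p))) (at (\<phi> p))"
      by (rule smooth_on_has_derivative[OF chart_transition[OF c(1) d(1)] S(2)])
    have "(\<psi> \<circ> inv_into U \<phi>) (\<phi> p) = \<psi> p" using c by simp
    then have "((f \<circ> inv_into V \<psi>) \<circ> (\<psi> \<circ> inv_into U \<phi>) has_derivative
      frechet_derivative (f \<circ> inv_into V \<psi>) (at (\<psi> p)) \<circ> frechet_derivative (\<psi> \<circ> inv_into U \<phi>) (at (\<phi> p))) (at (\<phi> p))"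
      using diff_chain_at[OF t] smooth_at_differentiable[OF True d] by simp
    then have "(f \<circ> inv_into U \<phi> has_derivative
      frechet_derivative (f \<circ> inv_into V \<psi>) (at (\<psi> p)) \<circ> frechet_derivative (\<psi> \<circ> inv_into U \<phi>) (at (\<phi> p))) (at (\<phi> p))"
      by (rule has_derivative_transform_within_open[OF _ S]) (use c d in auto)
    then show ?thesis using True
      by (simp add: chart_tvec_def frechet_derivative_at[symmetric])
  qed (simp add: chart_tvec_def)
qed

lemma tangent_space_chart:
  assumes "(U, \<phi>) \<in> A" "p \<in> U"
  shows "tangent_space A p = range (chart_tvec A (U, \<phi>) p)"
proof (intro set_eqI iffI)
  fix v assume "v \<in> tangent_space A p"
  then obtain V \<psi> w where "(V, \<psi>) \<in> A" "p \<in> V" "v = chart_tvec A (V, \<psi>) p w"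
    unfolding tangent_space_def by auto
  then show "v \<in> range (chart_tvec A (U, \<phi>) p)" using chart_tvec_change assms by blast
next
  fix v assume "v \<in> range (chart_tvec A (U, \<phi>) p)"
  then show "v \<in> tangent_space A p" using assms unfolding tangent_space_def by force
qed

lemma tangent_space_subspace: "subspace (tangent_space A p)"
proof -
  obtain U \<phi> where c: "(U, \<phi>) \<in> A" "p \<in> U" using chart_exists by blast
  have "linear (chart_tvec A (U, \<phi>) p)"
    by (rule linearI) (simp_all add: chart_tvec_add[OF c] chart_tvec_scale[OF c])
  then show ?thesis unfolding tangent_space_chart[OF c] by (rule linear_subspace_image) simp
qed

text \<open>Tangent vectors see only germs. The default value respects this too, since smoothness at
  \<open>p\<close> is itself a property of the germ.\<close>

lemma tangent_vector_cong:
  assumes v: "v \<in> tangent_space A p" and N: "open N" "p \<in> N" "\<And>q. q \<in> N \<Longrightarrow> f q = g q"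
  shows "v f = v g"
proof -
  obtain U \<phi> w where c: "(U, \<phi>) \<in> A" "p \<in> U" and v: "v = chart_tvec A (U, \<phi>) p w"
    using v unfolding tangent_space_def by auto
  have sm: "smooth_at A p f \<longleftrightarrow> smooth_at A p g"
    using smooth_at_cong[of N p f g] smooth_at_cong[of N p g f] N by auto
  show ?thesis
  proof (cases "smooth_at A p f")
    case True
    have "f \<circ> inv_into U \<phi> differentiable at (\<phi> p)"
      using smooth_at_differentiable[OF True c] by (auto simp: differentiable_def)
    then have "frechet_derivative (f \<circ> inv_into U \<phi>) (at (\<phi> p)) = frechet_derivative (g \<circ> inv_into U \<phi>) (at (\<phi> p))"
      by (rule frechet_derivative_transform_within_open[OF _ chart_open_image[OF c(1) N(1)]])
         (use c N in auto)
    then show ?thesis using sm True by (simp add: v chart_tvec_def)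
  qed (use sm in \<open>simp add: v chart_tvec_def\<close>)
qed

lemma tangent_vector_add:
  assumes v: "v \<in> tangent_space A p" and "smooth_at A p f" "smooth_at A p g"
  shows "v (\<lambda>q. f q + g q) = v f + v g"
proof -
  obtain U \<phi> w where c: "(U, \<phi>) \<in> A" "p \<in> U" and v: "v = chart_tvec A (U, \<phi>) p w"
    using v unfolding tangent_space_def by auto
  have "((\<lambda>x. (f \<circ> inv_into U \<phi>) x + (g \<circ> inv_into U \<phi>) x) has_derivative
    (\<lambda>w. frechet_derivative (f \<circ> inv_into U \<phi>) (at (\<phi> p)) w + frechet_derivative (g \<circ> inv_into U \<phi>) (at (\<phi> p)) w)) (at (\<phi> p))"
    by (intro has_derivative_add smooth_at_differentiable assms c)
  then have "frechet_derivative (\<lambda>x. f (inv_into U \<phi> x) + g (inv_into U \<phi> x)) (at (\<phi> p)) = (\<lambda>w.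
    frechet_derivative (f \<circ> inv_into U \<phi>) (at (\<phi> p)) w + frechet_derivative (g \<circ> inv_into U \<phi>) (at (\<phi> p)) w)"
    by (simp add: frechet_derivative_at[symmetric])
  then show ?thesis using smooth_at_add[OF assms(2,3)] assms(2,3)
    by (simp add: v chart_tvec_def o_def)
qed

lemma tangent_vector_const:
  assumes v: "v \<in> tangent_space A p"
  shows "v (\<lambda>q. k) = 0"
  using v unfolding tangent_space_def chart_tvec_def by (auto simp: o_def)

text \<open>A coordinate serves as a global function without any cut-off: \<open>smooth_at\<close>
  looks only at a neighbourhood of \<open>p\<close>, so the arbitrary values of the chart outside
  \<open>U\<close> do no harm.\<close>

lemma coordinate_smooth_at:
  assumes c: "(U, \<phi>) \<in> A" "p \<in> U"
  shows "smooth_at A p (\<lambda>q. \<phi> q \<bullet> b)"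
proof (rule smooth_atI[OF c, of UNIV])
  have o: "open (\<phi> ` (U \<inter> UNIV))" using chart_homeomorphism(2)[OF c(1)] by simp
  show "smooth_on (\<phi> ` (U \<inter> UNIV)) ((\<lambda>q. \<phi> q \<bullet> b) \<circ> inv_into U \<phi>)"
    by (rule smooth_on_cong[OF smooth_on_inner[OF o smooth_on_id[OF o]] o]) (use c in auto)
qed auto

text \<open>Reads off the components of a tangent vector, so that distinct \<open>w\<close> give
  distinct vectors.\<close>

lemma chart_tvec_coordinate:
  assumes c: "(U, \<phi>) \<in> A" "p \<in> U"
  shows "chart_tvec A (U, \<phi>) p w (\<lambda>q. \<phi> q \<bullet> b) = w \<bullet> b"
proof -
  have "((\<lambda>x. x \<bullet> b) has_derivative (\<lambda>w. w \<bullet> b)) (at (\<phi> p))"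
    by (rule bounded_linear.has_derivative[OF bounded_linear_inner_left has_derivative_ident])
  then have "((\<lambda>q. \<phi> q \<bullet> b) \<circ> inv_into U \<phi> has_derivative (\<lambda>w. w \<bullet> b)) (at (\<phi> p))"
    by (rule has_derivative_transform_within_open[OF _ chart_homeomorphism(2)[OF c(1)]]) (use c in auto)
  then show ?thesis using coordinate_smooth_at[OF c, of b]
    by (simp add: chart_tvec_def frechet_derivative_at[symmetric])
qed

section \<open>Smooth vector fields in coordinates\<close>

lemma smooth_vfield_tangent: "X \<in> smooth_vfields A \<Longrightarrow> X p \<in> tangent_space A p"
  by (simp add: smooth_vfields_def)

lemma smooth_vfield_smooth: "X \<in> smooth_vfields A \<Longrightarrow> smooth_at A p f \<Longrightarrow> smooth_at A p (\<lambda>q. X q f)"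
  by (simp add: smooth_vfields_def)

text \<open>The components are the values of \<open>X\<close> on the coordinate functions.
  \<open>X\<close> preserves smoothness at each point, and the resulting local statements are
  patched together by \<open>smooth_on_locally\<close>.\<close>

lemma smooth_vfield_coordinates:
  assumes X: "X \<in> smooth_vfields A" and c: "(U, \<phi>) \<in> A"
  obtains \<xi> where "smooth_on (\<phi> ` U) \<xi>" "\<And>p. p \<in> U \<Longrightarrow> X p = chart_tvec A (U, \<phi>) p (\<xi> (\<phi> p))"
proof
  define \<xi> where "\<xi> x = (\<Sum>b\<in>Basis. X (inv_into U \<phi> x) (\<lambda>q. \<phi> q \<bullet> b) *\<^sub>R b)" for x
  have o: "open (\<phi> ` U)" by (rule chart_homeomorphism(2)[OF c])
  have "smooth_on (\<phi> ` U) (\<lambda>x. X (inv_into U \<phi> x) (\<lambda>q. \<phi> q \<bullet> b))" for b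
  proof (rule smooth_on_locally)
    fix x assume "x \<in> \<phi> ` U"
    then obtain p where p: "p \<in> U" "x = \<phi> p" by blast
    have "smooth_at A p (\<lambda>q. X q (\<lambda>q. \<phi> q \<bullet> b))"
      by (rule smooth_vfield_smooth[OF X coordinate_smooth_at[OF c p(1)]])
    then obtain N where N: "open N" "p \<in> N"
      "smooth_on (\<phi> ` (U \<inter> N)) ((\<lambda>q. X q (\<lambda>q. \<phi> q \<bullet> b)) \<circ> inv_into U \<phi>)"
      using smooth_atE c by metis
    then show "\<exists>T. open T \<and> x \<in> T \<and> smooth_on T (\<lambda>x. X (inv_into U \<phi> x) (\<lambda>q. \<phi> q \<bullet> b))"
      using chart_open_image[OF c N(1)] p by (intro exI[of _ "\<phi> ` (U \<inter> N)"]) (auto simp: o_def)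
  qed
  then show "smooth_on (\<phi> ` U) \<xi>"
    unfolding \<xi>_def by (intro smooth_on_sum smooth_on_scaleR smooth_on_const o)
  fix p assume p: "p \<in> U"
  obtain w where w: "X p = chart_tvec A (U, \<phi>) p w"
    using smooth_vfield_tangent[OF X, of p] tangent_space_chart[OF c p] by auto
  have "\<xi> (\<phi> p) = (\<Sum>b\<in>Basis. (w \<bullet> b) *\<^sub>R b)"
    using c p by (simp add: \<xi>_def w chart_tvec_coordinate)
  then show "X p = chart_tvec A (U, \<phi>) p (\<xi> (\<phi> p))" by (simp add: w euclidean_representation)
qed

lemma smooth_vfieldI:
  assumes "\<And>p. \<exists>U \<phi> \<xi>. (U, \<phi>) \<in> A \<and> p \<in> U \<and> smooth_on (\<phi> ` U) \<xi> \<and>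
    (\<forall>q\<in>U. X q = chart_tvec A (U, \<phi>) q (\<xi> (\<phi> q)))"
  shows "X \<in> smooth_vfields A"
  unfolding smooth_vfields_def
proof (intro CollectI conjI allI impI)
  fix p
  obtain U \<phi> \<xi> where c: "(U, \<phi>) \<in> A" "p \<in> U" and \<xi>: "smooth_on (\<phi> ` U) \<xi>"
    "\<And>q. q \<in> U \<Longrightarrow> X q = chart_tvec A (U, \<phi>) q (\<xi> (\<phi> q))"
    using assms[of p] by blast
  show "X p \<in> tangent_space A p"
    using c \<xi>(2) tangent_space_chart by blast
  fix f assume "smooth_at A p f"
  then obtain N where N: "open N" "p \<in> N"
    "\<And>U \<phi>. (U, \<phi>) \<in> A \<Longrightarrow> smooth_on (\<phi> ` (U \<inter> N)) (f \<circ> inv_into U \<phi>)"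
    using smooth_atE by blast
  \<comment> \<open>\<open>chart_tvec\<close> falls back to 0 where \<open>f\<close> is not smooth,
    so the derivative formula for \<open>X q f\<close> needs smoothness at every \<open>q\<close>
    near \<open>p\<close>, not only at \<open>p\<close>.\<close>
  have sm: "smooth_at A q f" if "q \<in> N" for q
    using N that unfolding smooth_at_def by blast
  have o: "open (\<phi> ` (U \<inter> N))" by (rule chart_open_image[OF c(1) N(1)])
  have "smooth_on (\<phi> ` (U \<inter> N)) (\<lambda>x. frechet_derivative (f \<circ> inv_into U \<phi>) (at x) (\<xi> x))"
    by (rule smooth_on_derivative_apply[OF o N(3)[OF c(1)] smooth_on_subset[OF \<xi>(1)]]) auto
  then have "smooth_on (\<phi> ` (U \<inter> N)) ((\<lambda>q. X q f) \<circ> inv_into U \<phi>)"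
    by (rule smooth_on_cong[OF _ o]) (use c \<xi>(2) sm in \<open>auto simp: chart_tvec_def\<close>)
  then show "smooth_at A p (\<lambda>q. X q f)" by (rule smooth_atI[OF c N(1,2)])
qed

lemma smooth_at_const: "smooth_at A p (\<lambda>q. k)"
proof -
  obtain U \<phi> where c: "(U, \<phi>) \<in> A" "p \<in> U" using chart_exists by blast
  have "smooth_on (\<phi> ` (U \<inter> UNIV)) (\<lambda>x. k)"
    using chart_homeomorphism(2)[OF c(1)] by (simp add: smooth_on_const)
  then show ?thesis by (intro smooth_atI[OF c, of UNIV]) (auto simp: o_def)
qed

lemma zero_smooth_vfield: "0 \<in> smooth_vfields A"
  using subspace_0[OF tangent_space_subspace] smooth_at_const[of _ 0]
  unfolding smooth_vfields_def by simp

end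

section \<open>Maps between manifolds and product manifolds\<close>

lemma smooth_on_compose_fst:
  "open S \<Longrightarrow> open T \<Longrightarrow> smooth_on T g \<Longrightarrow> fst ` S \<subseteq> T \<Longrightarrow> smooth_on S (\<lambda>z. g (fst z))"
  by (rule smooth_on_compose[OF _ _ smooth_on_bounded_linear[OF _ bounded_linear_fst smooth_on_id]])

lemma smooth_on_compose_snd:
  "open S \<Longrightarrow> open T \<Longrightarrow> smooth_on T g \<Longrightarrow> snd ` S \<subseteq> T \<Longrightarrow> smooth_on S (\<lambda>z. g (snd z))"
  by (rule smooth_on_compose[OF _ _ smooth_on_bounded_linear[OF _ bounded_linear_snd smooth_on_id]])

lemma smooth_on_compose_Pair_right:
  "open S \<Longrightarrow> open T \<Longrightarrow> smooth_on T g \<Longrightarrow> (\<And>x. x \<in> S \<Longrightarrow> (c, x) \<in> T) \<Longrightarrow> smooth_on S (\<lambda>x. g (c, x))"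
  by (rule smooth_on_compose[OF _ _ smooth_on_Pair[OF _ smooth_on_const smooth_on_id]]) auto

lemma smooth_on_compose_Pair_left:
  "open S \<Longrightarrow> open T \<Longrightarrow> smooth_on T g \<Longrightarrow> (\<And>x. x \<in> S \<Longrightarrow> (x, c) \<in> T) \<Longrightarrow> smooth_on S (\<lambda>x. g (x, c))"
  by (rule smooth_on_compose[OF _ _ smooth_on_Pair[OF _ smooth_on_id smooth_on_const]]) auto

lemma (in smooth_manifold) chart_tvec_smooth_at:
  assumes c: "(U, \<phi>) \<in> A" "p \<in> U" and f: "smooth_at A p f"
  shows "smooth_at A p (\<lambda>q. chart_tvec A (U, \<phi>) q w f)"
    and "chart_tvec A (U, \<phi>) p w' (\<lambda>q. chart_tvec A (U, \<phi>) q w f)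
      = frechet_derivative (\<lambda>x. frechet_derivative (f \<circ> inv_into U \<phi>) (at x) w) (at (\<phi> p)) w'"
proof -
  obtain N where N: "open N" "p \<in> N"
    "\<And>U \<phi>. (U, \<phi>) \<in> A \<Longrightarrow> smooth_on (\<phi> ` (U \<inter> N)) (f \<circ> inv_into U \<phi>)"
    using smooth_atE[OF f] by blast
  have sm: "smooth_at A q f" if "q \<in> N" for q
    using N that unfolding smooth_at_def by blast
  let ?S = "\<phi> ` (U \<inter> N)"
  let ?g = "(\<lambda>q. chart_tvec A (U, \<phi>) q w f) \<circ> inv_into U \<phi>"
  have o: "open ?S" "\<phi> p \<in> ?S" using chart_open_image[OF c(1) N(1)] c N by auto
  have 1: "smooth_on ?S (\<lambda>x. frechet_derivative (f \<circ> inv_into U \<phi>) (at x) w)"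
    by (rule smooth_on_derivative[OF N(3)[OF c(1)]])
  have eq: "frechet_derivative (f \<circ> inv_into U \<phi>) (at x) w = ?g x" if "x \<in> ?S" for x
    using that c sm by (auto simp: chart_tvec_def)
  show s: "smooth_at A p (\<lambda>q. chart_tvec A (U, \<phi>) q w f)"
    by (rule smooth_atI[OF c N(1,2) smooth_on_cong[OF 1 o(1) eq]])
  have "frechet_derivative (\<lambda>x. frechet_derivative (f \<circ> inv_into U \<phi>) (at x) w) (at (\<phi> p)) =
    frechet_derivative ?g (at (\<phi> p))"
    using smooth_on_has_derivative[OF 1 o(2)] eq
    by (intro frechet_derivative_transform_within_open[OF _ o]) (auto simp: differentiable_def)
  then show "chart_tvec A (U, \<phi>) p w' (\<lambda>q. chart_tvec A (U, \<phi>) q w f)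
      = frechet_derivative (\<lambda>x. frechet_derivative (f \<circ> inv_into U \<phi>) (at x) w) (at (\<phi> p)) w'"
    using s by (simp add: chart_tvec_def)
qed

text \<open>Coordinate fields with constant coefficients commute, by the symmetry of the second
  derivative of \<open>f\<close> in the chart.\<close>

lemma (in smooth_manifold) chart_tvec_commute:
  assumes c: "(U, \<phi>) \<in> A" "p \<in> U" and f: "smooth_at A p f"
  shows "chart_tvec A (U, \<phi>) p w' (\<lambda>q. chart_tvec A (U, \<phi>) q w f)
    = chart_tvec A (U, \<phi>) p w (\<lambda>q. chart_tvec A (U, \<phi>) q w' f)"
proof -
  obtain N where N: "open N" "p \<in> N"
    "\<And>U \<phi>. (U, \<phi>) \<in> A \<Longrightarrow> smooth_on (\<phi> ` (U \<inter> N)) (f \<circ> inv_into U \<phi>)"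
    using smooth_atE[OF f] by blast
  show ?thesis
    unfolding chart_tvec_smooth_at(2)[OF assms]
    by (rule symmetric_second_derivative[OF chart_open_image[OF c(1) N(1)] N(3)[OF c(1)]])
       (use c N in auto)
qed

text \<open>Plays two roles: source and target of a map \<open>F\<close>, and the two factors of a
  product.\<close>

locale smooth_manifold_pair = A: smooth_manifold A + B: smooth_manifold B
  for A :: "('a::{t2_space,second_countable_topology}, 'e::euclidean_space) chart set"
    and B :: "('b::{t2_space,second_countable_topology}, 'f::euclidean_space) chart set"
begin

text \<open>\<open>F\<close> is required to be smooth only near \<open>p\<close> and in a single
  pair of charts, which is how slice inclusions and translations are presented later.\<close>

lemma smooth_at_compose:
  assumes c: "(U, \<phi>) \<in> A" and d: "(V, \<psi>) \<in> B" and N: "open N" "p \<in> N" "N \<subseteq> U" "F ` N \<subseteq> V"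
    and F: "smooth_on (\<phi> ` N) (\<psi> \<circ> F \<circ> inv_into U \<phi>)" and f: "smooth_at B (F p) f"
  shows "smooth_at A p (f \<circ> F)"
proof -
  obtain N' where N': "open N'" "F p \<in> N'"
    "\<And>U \<phi>. (U, \<phi>) \<in> B \<Longrightarrow> smooth_on (\<phi> ` (U \<inter> N')) (f \<circ> inv_into U \<phi>)"
    using B.smooth_atE[OF f] by blast
  let ?h = "\<psi> \<circ> F \<circ> inv_into U \<phi>"
  have UN: "U \<inter> N = N" using N(3) by auto
  have oN: "open (\<phi> ` N)" using A.chart_open_image[OF c N(1)] UN by simp
  have oT: "open (\<psi> ` (V \<inter> N'))" by (rule B.chart_open_image[OF d N'(1)])
  define S where "S = \<phi> ` N \<inter> ?h -` (\<psi> ` (V \<inter> N'))"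
  have oS: "open S"
    unfolding S_def by (rule continuous_on_open_vimage[THEN iffD1, rule_format, OF oN smooth_on_continuous_on[OF F] oT, unfolded Int_commute[of "_ -` _"]])
  have oU: "open (U \<inter> \<phi> -` S)" by (rule A.chart_open_preimage[OF c oS])
  have im: "\<phi> ` (U \<inter> (U \<inter> \<phi> -` S)) = S" using N(3) by (auto simp: S_def)
  have pS: "p \<in> U \<inter> \<phi> -` S"
  proof -
    have "p \<in> U" "F p \<in> V" using N by auto
    then show ?thesis using N N' A.chart_inv[OF c, of p] by (auto simp: S_def)
  qed
  have "smooth_on S (\<lambda>x. (f \<circ> inv_into V \<psi>) (?h x))"
    by (rule smooth_on_compose[OF oS oT smooth_on_subset[OF F] N'(3)[OF d]]) (auto simp: S_def)
  moreover have "(f \<circ> inv_into V \<psi>) (?h x) = ((f \<circ> F) \<circ> inv_into U \<phi>) x" if x: "x \<in> S" for x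
  proof -
    obtain q where "q \<in> N" "x = \<phi> q" using x unfolding S_def by blast
    moreover from this have "q \<in> U" "F q \<in> V" using N by auto
    ultimately show ?thesis by (simp add: A.chart_inv[OF c] B.chart_inv[OF d])
  qed
  ultimately have "smooth_on S ((f \<circ> F) \<circ> inv_into U \<phi>)"
    using smooth_on_cong[OF _ oS] by metis
  then show ?thesis using pS im by (intro A.smooth_atI[OF c _ oU]) auto
qed

lemma pushforward_chart_tvec:
  assumes c: "(U, \<phi>) \<in> A" and d: "(V, \<psi>) \<in> B" and N: "open N" "p \<in> N" "N \<subseteq> U" "F ` N \<subseteq> V"
    and F: "smooth_on (\<phi> ` N) (\<psi> \<circ> F \<circ> inv_into U \<phi>)"
  shows "pushforward B F p (chart_tvec A (U, \<phi>) p w) =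
    chart_tvec B (V, \<psi>) (F p) (frechet_derivative (\<psi> \<circ> F \<circ> inv_into U \<phi>) (at (\<phi> p)) w)"
proof
  fix f
  let ?h = "\<psi> \<circ> F \<circ> inv_into U \<phi>"
  show "pushforward B F p (chart_tvec A (U, \<phi>) p w) f =
    chart_tvec B (V, \<psi>) (F p) (frechet_derivative ?h (at (\<phi> p)) w) f"
  proof (cases "smooth_at B (F p) f")
    case True
    have pU: "p \<in> U" "F p \<in> V" using N by auto
    have UN: "U \<inter> N = N" using N(3) by auto
    have oN: "open (\<phi> ` N)" "\<phi> p \<in> \<phi> ` N" using A.chart_open_image[OF c N(1)] UN N by auto
    have h: "(?h has_derivative frechet_derivative ?h (at (\<phi> p))) (at (\<phi> p))"
      by (rule smooth_on_has_derivative[OF F oN(2)])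
    have hp: "?h (\<phi> p) = \<psi> (F p)" using c pU by simp
    have "((f \<circ> inv_into V \<psi>) \<circ> ?h has_derivative
      frechet_derivative (f \<circ> inv_into V \<psi>) (at (\<psi> (F p))) \<circ> frechet_derivative ?h (at (\<phi> p))) (at (\<phi> p))"
      by (rule diff_chain_at[OF h]) (unfold hp, rule B.smooth_at_differentiable[OF True d pU(2)])
    then have "((f \<circ> F) \<circ> inv_into U \<phi> has_derivative
      frechet_derivative (f \<circ> inv_into V \<psi>) (at (\<psi> (F p))) \<circ> frechet_derivative ?h (at (\<phi> p))) (at (\<phi> p))"
      by (rule has_derivative_transform_within_open[OF _ oN]) (use c d N in \<open>auto simp: subset_iff\<close>)
    then have "frechet_derivative ((f \<circ> F) \<circ> inv_into U \<phi>) (at (\<phi> p)) =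
      frechet_derivative (f \<circ> inv_into V \<psi>) (at (\<psi> (F p))) \<circ> frechet_derivative ?h (at (\<phi> p))"
      by (rule frechet_derivative_at[symmetric])
    then show ?thesis
      using True smooth_at_compose[OF assms True] by (simp add: pushforward_def chart_tvec_def)
  qed (simp add: pushforward_def chart_tvec_def)
qed

section \<open>The product atlas\<close>

abbreviation M where "M \<equiv> prod_atlas A B"

lemma prod_chart: "(U, \<phi>) \<in> A \<Longrightarrow> (V, \<psi>) \<in> B \<Longrightarrow> (Sigma U (\<lambda>_. V), map_prod \<phi> \<psi>) \<in> M"
  unfolding prod_atlas_def by blast

lemma prod_chart_inv:
  assumes "(U, \<phi>) \<in> A" "(V, \<psi>) \<in> B" "x \<in> \<phi> ` U" "y \<in> \<psi> ` V"
  shows "inv_into (Sigma U (\<lambda>_. V)) (map_prod \<phi> \<psi>) (x, y) = (inv_into U \<phi> x, inv_into V \<psi> y)"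
proof -
  have "inj_on \<phi> U" "inj_on \<psi> V"
    using A.chart_inv[OF assms(1)] B.chart_inv[OF assms(2)] by (metis inj_onI)+
  then have "inj_on (map_prod \<phi> \<psi>) (Sigma U (\<lambda>_. V))" by (rule map_prod_inj_on)
  then show ?thesis
    using assms by (intro inv_into_f_eq) (auto simp: A.chart_inv[OF assms(1)] B.chart_inv[OF assms(2)])
qed

lemma prod_chart_image: "map_prod \<phi> \<psi> ` (Sigma S (\<lambda>_. T)) = Sigma (\<phi> ` S) (\<lambda>_. \<psi> ` T)"
  by force

lemma prod_smooth_atlas: "smooth_atlas M"
  unfolding smooth_atlas_def
proof (intro conjI)
  show "\<forall>(U, \<phi>)\<in>M. open U \<and> open (\<phi> ` U) \<and> homeomorphism U (\<phi> ` U) \<phi> (inv_into U \<phi>)"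
  proof safe
    fix W \<kappa> assume "(W, \<kappa>) \<in> M"
    then obtain U \<phi> V \<psi> where c: "(U, \<phi>) \<in> A" and d: "(V, \<psi>) \<in> B"
      and W: "W = Sigma U (\<lambda>_. V)" "\<kappa> = map_prod \<phi> \<psi>"
      unfolding prod_atlas_def by blast
    note hc = A.chart_homeomorphism[OF c] note hd = B.chart_homeomorphism[OF d]
    show "open W" unfolding W using hc hd by (simp add: open_Times)
    show "open (\<kappa> ` W)" unfolding W prod_chart_image using hc hd by (simp add: open_Times)
    have 1: "continuous_on W \<kappa>"
    proof -
      have "continuous_on U \<phi>" "continuous_on V \<psi>" using hc(3) hd(3) by (simp_all add: homeomorphism_def)
      then have "continuous_on W (\<lambda>z. \<phi> (fst z))" "continuous_on W (\<lambda>z. \<psi> (snd z))"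
        using continuous_on_compose2[of U \<phi> W fst] continuous_on_compose2[of V \<psi> W snd]
        by (auto simp: W continuous_on_fst continuous_on_snd continuous_on_id)
      then have "continuous_on W (\<lambda>z. (\<phi> (fst z), \<psi> (snd z)))" by (rule continuous_on_Pair)
      then show ?thesis by (simp add: W(2) map_prod_def case_prod_beta')
    qed
    have 2: "continuous_on (\<kappa> ` W) (inv_into W \<kappa>)"
    proof -
      have "continuous_on (\<phi> ` U) (inv_into U \<phi>)" "continuous_on (\<psi> ` V) (inv_into V \<psi>)"
        using hc(3) hd(3) by (simp_all add: homeomorphism_def)
      then have "continuous_on (\<kappa> ` W) (\<lambda>z. inv_into U \<phi> (fst z))"
        "continuous_on (\<kappa> ` W) (\<lambda>z. inv_into V \<psi> (snd z))"
        using continuous_on_compose2[of "\<phi> ` U" "inv_into U \<phi>" "\<kappa> ` W" fst]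
          continuous_on_compose2[of "\<psi> ` V" "inv_into V \<psi>" "\<kappa> ` W" snd]
        by (auto simp: W prod_chart_image continuous_on_fst continuous_on_snd continuous_on_id)
      then have "continuous_on (\<kappa> ` W) (\<lambda>z. (inv_into U \<phi> (fst z), inv_into V \<psi> (snd z)))"
        by (rule continuous_on_Pair)
      moreover have "(inv_into U \<phi> (fst z), inv_into V \<psi> (snd z)) = inv_into W \<kappa> z" if "z \<in> \<kappa> ` W" for z
        using that prod_chart_inv[OF c d, of "fst z" "snd z"] unfolding W prod_chart_image by auto
      ultimately show ?thesis
        using continuous_on_cong[of "\<kappa> ` W" "\<kappa> ` W" "\<lambda>z. (inv_into U \<phi> (fst z), inv_into V \<psi> (snd z))"] by simp
    qed
    have "inj_on \<kappa> W"
      using A.chart_inv[OF c] B.chart_inv[OF d] unfolding W by (intro map_prod_inj_on; metis inj_onI)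
    then show "homeomorphism W (\<kappa> ` W) \<kappa> (inv_into W \<kappa>)"
      using 1 2 by (auto simp: homeomorphism_def f_inv_into_f)
  qed
  show "(\<Union>(U, \<phi>)\<in>M. U) = UNIV"
  proof (intro set_eqI iffI UNIV_I)
    fix m :: "'a \<times> 'b"
    obtain U \<phi> V \<psi> where "(U, \<phi>) \<in> A" "fst m \<in> U" "(V, \<psi>) \<in> B" "snd m \<in> V"
      using A.chart_exists B.chart_exists by metis
    then show "m \<in> (\<Union>(U, \<phi>)\<in>M. U)"
      by (intro UN_I[OF prod_chart]) (auto simp: mem_Times_iff)
  qed
  show "\<forall>(U, \<phi>)\<in>M. \<forall>(V, \<psi>)\<in>M. smooth_on (\<phi> ` (U \<inter> V)) (\<psi> \<circ> inv_into U \<phi>)"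
  proof safe
    fix W \<kappa> W' \<kappa>' assume "(W, \<kappa>) \<in> M" "(W', \<kappa>') \<in> M"
    then obtain U \<phi> V \<psi> U' \<phi>' V' \<psi>' where c: "(U, \<phi>) \<in> A" and d: "(V, \<psi>) \<in> B"
      and W: "W = Sigma U (\<lambda>_. V)" "\<kappa> = map_prod \<phi> \<psi>"
      and c': "(U', \<phi>') \<in> A" and d': "(V', \<psi>') \<in> B"
      and W': "W' = Sigma U' (\<lambda>_. V')" "\<kappa>' = map_prod \<phi>' \<psi>'"
      unfolding prod_atlas_def by blast
    let ?S = "\<phi> ` (U \<inter> U')" let ?T = "\<psi> ` (V \<inter> V')"
    have S: "open ?S" "open ?T"
      using A.chart_open_image[OF c A.chart_homeomorphism(1)[OF c']]
        B.chart_open_image[OF d B.chart_homeomorphism(1)[OF d']] by auto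
    have eq: "\<kappa> ` (W \<inter> W') = Sigma ?S (\<lambda>_. ?T)"
      unfolding W W' Times_Int_Times prod_chart_image ..
    have "smooth_on (Sigma ?S (\<lambda>_. ?T)) (\<lambda>z. ((\<phi>' \<circ> inv_into U \<phi>) (fst z), (\<psi>' \<circ> inv_into V \<psi>) (snd z)))"
      by (intro smooth_on_Pair smooth_on_compose_fst[OF _ S(1)] smooth_on_compose_snd[OF _ S(2)]
          open_Times S A.chart_transition c c' B.chart_transition d d') auto
    then show "smooth_on (\<kappa> ` (W \<inter> W')) (\<kappa>' \<circ> inv_into W \<kappa>)"
      unfolding eq
      by (rule smooth_on_cong[OF _ open_Times[OF S]])
         (auto simp: W W' prod_chart_inv[OF c d])
  qed
qed

sublocale M: smooth_manifold M
  by (rule smooth_manifold.intro[OF prod_smooth_atlas])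

end

context smooth_manifold_pair
begin

section \<open>Slice inclusions and lifted vector fields\<close>

lemma inject_left:
  assumes c: "(U, \<phi>) \<in> A" "p \<in> U" and d: "(V, \<psi>) \<in> B" "q \<in> V"
  shows "smooth_at M (p, q) f \<Longrightarrow> smooth_at A p (\<lambda>p'. f (p', q))"
    and "pushforward M (\<lambda>p'. (p', q)) p (chart_tvec A (U, \<phi>) p w)
      = chart_tvec M (Sigma U (\<lambda>_. V), map_prod \<phi> \<psi>) (p, q) (w, 0)"
proof -
  interpret AM: smooth_manifold_pair A M by unfold_locales
  let ?c = "map_prod \<phi> \<psi>"
  have N: "open U" "p \<in> U" "U \<subseteq> U" "(\<lambda>p'. (p', q)) ` U \<subseteq> Sigma U (\<lambda>_. V)"
    using A.chart_homeomorphism(1)[OF c(1)] c d by auto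
  have o: "open (\<phi> ` U)" by (rule A.chart_homeomorphism(2)[OF c(1)])
  have eq: "(x, \<psi> q) = (?c \<circ> (\<lambda>p'. (p', q)) \<circ> inv_into U \<phi>) x" if "x \<in> \<phi> ` U" for x
    using that A.chart_inv[OF c(1)] by auto
  have sm: "smooth_on (\<phi> ` U) (?c \<circ> (\<lambda>p'. (p', q)) \<circ> inv_into U \<phi>)"
    by (rule smooth_on_cong[OF smooth_on_Pair[OF o smooth_on_id[OF o] smooth_on_const[OF o]] o eq])
  note hyps = c(1) prod_chart[OF c(1) d(1)] N sm
  show "smooth_at A p (\<lambda>p'. f (p', q))" if "smooth_at M (p, q) f"
    using AM.smooth_at_compose[OF hyps that] by (simp add: o_def)
  have "((\<lambda>x. (x, \<psi> q)) has_derivative (\<lambda>w. (w, 0))) (at (\<phi> p))"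
    by (intro has_derivative_Pair has_derivative_ident has_derivative_const)
  then have "(?c \<circ> (\<lambda>p'. (p', q)) \<circ> inv_into U \<phi> has_derivative (\<lambda>w. (w, 0))) (at (\<phi> p))"
    by (rule has_derivative_transform_within_open[OF _ o]) (use c eq in auto)
  from frechet_derivative_at[OF this]
  show "pushforward M (\<lambda>p'. (p', q)) p (chart_tvec A (U, \<phi>) p w)
      = chart_tvec M (Sigma U (\<lambda>_. V), ?c) (p, q) (w, 0)"
    using AM.pushforward_chart_tvec[OF hyps, of w] by (metis (no_types, lifting))
qed

lemma inject_right:
  assumes c: "(U, \<phi>) \<in> A" "p \<in> U" and d: "(V, \<psi>) \<in> B" "q \<in> V"
  shows "smooth_at M (p, q) f \<Longrightarrow> smooth_at B q (\<lambda>q'. f (p, q'))"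
    and "pushforward M (\<lambda>q'. (p, q')) q (chart_tvec B (V, \<psi>) q w)
      = chart_tvec M (Sigma U (\<lambda>_. V), map_prod \<phi> \<psi>) (p, q) (0, w)"
proof -
  interpret BM: smooth_manifold_pair B M by unfold_locales
  let ?c = "map_prod \<phi> \<psi>"
  have N: "open V" "q \<in> V" "V \<subseteq> V" "(\<lambda>q'. (p, q')) ` V \<subseteq> Sigma U (\<lambda>_. V)"
    using B.chart_homeomorphism(1)[OF d(1)] c d by auto
  have o: "open (\<psi> ` V)" by (rule B.chart_homeomorphism(2)[OF d(1)])
  have eq: "(\<phi> p, x) = (?c \<circ> (\<lambda>q'. (p, q')) \<circ> inv_into V \<psi>) x" if "x \<in> \<psi> ` V" for x
    using that B.chart_inv[OF d(1)] by auto
  have sm: "smooth_on (\<psi> ` V) (?c \<circ> (\<lambda>q'. (p, q')) \<circ> inv_into V \<psi>)"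
    by (rule smooth_on_cong[OF smooth_on_Pair[OF o smooth_on_const[OF o] smooth_on_id[OF o]] o eq])
  note hyps = d(1) prod_chart[OF c(1) d(1)] N sm
  show "smooth_at B q (\<lambda>q'. f (p, q'))" if "smooth_at M (p, q) f"
    using BM.smooth_at_compose[OF hyps that] by (simp add: o_def)
  have "((\<lambda>x. (\<phi> p, x)) has_derivative (\<lambda>w. (0, w))) (at (\<psi> q))"
    by (intro has_derivative_Pair has_derivative_ident has_derivative_const)
  then have "(?c \<circ> (\<lambda>q'. (p, q')) \<circ> inv_into V \<psi> has_derivative (\<lambda>w. (0, w))) (at (\<psi> q))"
    by (rule has_derivative_transform_within_open[OF _ o]) (use d eq in auto)
  from frechet_derivative_at[OF this]
  show "pushforward M (\<lambda>q'. (p, q')) q (chart_tvec B (V, \<psi>) q w)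
      = chart_tvec M (Sigma U (\<lambda>_. V), ?c) (p, q) (0, w)"
    using BM.pushforward_chart_tvec[OF hyps, of w] by (metis (no_types, lifting))
qed

lemma smooth_at_slice:
  assumes "smooth_at M (p, q) f"
  shows "smooth_at A p (\<lambda>p'. f (p', q))" "smooth_at B q (\<lambda>q'. f (p, q'))"
proof -
  obtain U \<phi> where c: "(U, \<phi>) \<in> A" "p \<in> U" using A.chart_exists by blast
  obtain V \<psi> where d: "(V, \<psi>) \<in> B" "q \<in> V" using B.chart_exists by blast
  show "smooth_at A p (\<lambda>p'. f (p', q))" "smooth_at B q (\<lambda>q'. f (p, q'))"
    by (rule inject_left(1)[OF c d assms] inject_right(1)[OF c d assms])+
qed

text \<open>A function can have smooth slices without being smooth. Going through
  \<open>pushforward\<close>, instead of applying \<open>X\<close> and \<open>Y\<close> to the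
  slices directly, builds in the default value 0 at such functions, so that the result is a tangent
  vector of the product.\<close>

definition prod_lift :: "'a vfield \<Rightarrow> 'b vfield \<Rightarrow> ('a \<times> 'b) vfield" where
  "prod_lift X Y = (\<lambda>(p, q). pushforward M (\<lambda>p'. (p', q)) p (X p) + pushforward M (\<lambda>q'. (p, q')) q (Y q))"

lemma prod_lift_apply:
  "smooth_at M (p, q) f \<Longrightarrow> prod_lift X Y (p, q) f = X p (\<lambda>p'. f (p', q)) + Y q (\<lambda>q'. f (p, q'))"
  by (simp add: prod_lift_def pushforward_def o_def)

lemma prod_lift_nonsmooth: "\<not> smooth_at M (p, q) f \<Longrightarrow> prod_lift X Y (p, q) f = 0"
  by (simp add: prod_lift_def pushforward_def)

lemma prod_lift_add: "prod_lift (X + X') (Y + Y') = prod_lift X Y + prod_lift X' Y'"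
  by (auto simp: fun_eq_iff prod_lift_def pushforward_def)

lemma prod_lift_scale: "prod_lift (c *\<^sub>R X) (c *\<^sub>R Y) = c *\<^sub>R prod_lift X Y"
  by (auto simp: fun_eq_iff prod_lift_def pushforward_def scaleR_fun_def algebra_simps)

lemma prod_lift_chart:
  assumes c: "(U, \<phi>) \<in> A" "p \<in> U" and d: "(V, \<psi>) \<in> B" "q \<in> V"
    and "X p = chart_tvec A (U, \<phi>) p w" "Y q = chart_tvec B (V, \<psi>) q w'"
  shows "prod_lift X Y (p, q) = chart_tvec M (Sigma U (\<lambda>_. V), map_prod \<phi> \<psi>) (p, q) (w, w')"
proof -
  have "(w, w') = (w, 0) + (0, w')" by simp
  then show ?thesis
    using assms M.chart_tvec_add[OF prod_chart[OF c(1) d(1)], of "(p, q)" "(w, 0)" "(0, w')"]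
    by (simp add: prod_lift_def inject_left(2)[OF c d] inject_right(2)[OF c d])
qed

lemma prod_lift_smooth_vfield:
  assumes X: "X \<in> smooth_vfields A" and Y: "Y \<in> smooth_vfields B"
  shows "prod_lift X Y \<in> smooth_vfields M"
proof (rule M.smooth_vfieldI)
  fix m :: "'a \<times> 'b"
  obtain U \<phi> where c: "(U, \<phi>) \<in> A" "fst m \<in> U" using A.chart_exists by blast
  obtain V \<psi> where d: "(V, \<psi>) \<in> B" "snd m \<in> V" using B.chart_exists by blast
  obtain \<xi> where \<xi>: "smooth_on (\<phi> ` U) \<xi>" "\<And>p. p \<in> U \<Longrightarrow> X p = chart_tvec A (U, \<phi>) p (\<xi> (\<phi> p))"
    using A.smooth_vfield_coordinates[OF X c(1)] by blast
  obtain \<eta> where \<eta>: "smooth_on (\<psi> ` V) \<eta>" "\<And>q. q \<in> V \<Longrightarrow> Y q = chart_tvec B (V, \<psi>) q (\<eta> (\<psi> q))"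
    using B.smooth_vfield_coordinates[OF Y d(1)] by blast
  let ?W = "Sigma U (\<lambda>_. V)" let ?c = "map_prod \<phi> \<psi>" let ?\<zeta> = "\<lambda>z. (\<xi> (fst z), \<eta> (snd z))"
  have o: "open (\<phi> ` U)" "open (\<psi> ` V)"
    using A.chart_homeomorphism(2)[OF c(1)] B.chart_homeomorphism(2)[OF d(1)] .
  have "smooth_on (?c ` ?W) ?\<zeta>"
    unfolding prod_chart_image
    by (intro smooth_on_Pair smooth_on_compose_fst[OF _ o(1) \<xi>(1)] smooth_on_compose_snd[OF _ o(2) \<eta>(1)]
        open_Times o) auto
  moreover have "prod_lift X Y m' = chart_tvec M (?W, ?c) m' (?\<zeta> (?c m'))" if "m' \<in> ?W" for m'
    using that by (cases m') (auto intro!: prod_lift_chart[OF c(1) _ d(1) _ \<xi>(2) \<eta>(2)])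
  moreover have "(?W, ?c) \<in> M" "m \<in> ?W" using prod_chart[OF c(1) d(1)] c d by (auto simp: mem_Times_iff)
  ultimately show "\<exists>W \<kappa> \<zeta>. (W, \<kappa>) \<in> M \<and> m \<in> W \<and> smooth_on (\<kappa> ` W) \<zeta> \<and>
    (\<forall>q\<in>W. prod_lift X Y q = chart_tvec M (W, \<kappa>) q (\<zeta> (\<kappa> q)))"
    by blast
qed

text \<open>When a lift is applied to the derivative along another lift, the inner one is evaluated
  at nearby points of both slices, and \<open>prod_lift_apply\<close> needs smoothness at each of
  them.\<close>

lemma slice_nbhd:
  assumes "smooth_at M (p, q) f"
  obtains N N' where "open N" "p \<in> N" "\<And>p'. p' \<in> N \<Longrightarrow> smooth_at M (p', q) f"
    "open N'" "q \<in> N'" "\<And>q'. q' \<in> N' \<Longrightarrow> smooth_at M (p, q') f"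
proof -
  obtain W where W: "open W" "(p, q) \<in> W" "\<And>m. m \<in> W \<Longrightarrow> smooth_at M m f"
    using M.smooth_at_nbhd[OF assms] by blast
  obtain N N' where "open N" "open N'" "(p, q) \<in> Sigma N (\<lambda>_. N')" "Sigma N (\<lambda>_. N') \<subseteq> W"
    using open_prod_elim[OF W(1,2)] by blast
  then show ?thesis using W(3) by (intro that[of N N']) auto
qed

text \<open>Both vectors are extended near the point by constant-coefficient fields of one product
  chart, with components \<open>(w, 0)\<close> and \<open>(0, w')\<close>. Such fields commute, and
  agreement near the point suffices by locality.\<close>

lemma tangent_vectors_commute:
  assumes v: "v \<in> tangent_space A p" and u: "u \<in> tangent_space B q" and f: "smooth_at M (p, q) f"
  shows "u (\<lambda>q'. v (\<lambda>p'. f (p', q'))) = v (\<lambda>p'. u (\<lambda>q'. f (p', q')))"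
proof -
  obtain U \<phi> w where c: "(U, \<phi>) \<in> A" "p \<in> U" and v': "v = chart_tvec A (U, \<phi>) p w"
    using v unfolding tangent_space_def by auto
  obtain V \<psi> w' where d: "(V, \<psi>) \<in> B" "q \<in> V" and u': "u = chart_tvec B (V, \<psi>) q w'"
    using u unfolding tangent_space_def by auto
  let ?c = "(Sigma U (\<lambda>_. V), map_prod \<phi> \<psi>)"
  have cM: "?c \<in> M" "(p, q) \<in> Sigma U (\<lambda>_. V)" using prod_chart[OF c(1) d(1)] c d by auto
  obtain N N' where N: "open N" "p \<in> N" "\<And>p'. p' \<in> N \<Longrightarrow> smooth_at M (p', q) f"
    "open N'" "q \<in> N'" "\<And>q'. q' \<in> N' \<Longrightarrow> smooth_at M (p, q') f"
    using slice_nbhd[OF f] by blast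
  define k where "k m = chart_tvec M ?c m (w, 0) f" for m
  define l where "l m = chart_tvec M ?c m (0, w') f" for m
  have kl: "smooth_at M (p, q) k" "smooth_at M (p, q) l"
    unfolding k_def l_def by (rule M.chart_tvec_smooth_at(1)[OF cM f])+
  have "v (\<lambda>p'. f (p', q')) = k (p, q')" if "q' \<in> N' \<inter> V" for q'
    using inject_left(2)[OF c d(1), of q' w] that N(6)[of q']
    by (auto simp: k_def v' pushforward_def o_def fun_eq_iff dest: spec[of _ f])
  then have "u (\<lambda>q'. v (\<lambda>p'. f (p', q'))) = u (\<lambda>q'. k (p, q'))"
    using N(4,5) d B.chart_homeomorphism(1)[OF d(1)]
    by (intro B.tangent_vector_cong[OF u, of "N' \<inter> V"]) auto
  also have "\<dots> = chart_tvec M ?c (p, q) (0, w') k"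
    using inject_right(2)[OF c d, of w'] kl(1)
    by (auto simp: u' pushforward_def o_def fun_eq_iff dest: spec[of _ k])
  also have "\<dots> = chart_tvec M ?c (p, q) (w, 0) l"
    unfolding k_def l_def by (rule M.chart_tvec_commute[OF cM f])
  also have "\<dots> = v (\<lambda>p'. l (p', q))"
    using inject_left(2)[OF c d, of w] kl(2)
    by (auto simp: v' pushforward_def o_def fun_eq_iff dest: spec[of _ l])
  also have "\<dots> = v (\<lambda>p'. u (\<lambda>q'. f (p', q')))"
  proof -
    have "l (p', q) = u (\<lambda>q'. f (p', q'))" if "p' \<in> N \<inter> U" for p'
      using inject_right(2)[OF c(1) _ d, of p' w'] that N(3)[of p']
      by (auto simp: l_def u' pushforward_def o_def fun_eq_iff dest: spec[of _ f])
    then show ?thesis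
      using N(1,2) c A.chart_homeomorphism(1)[OF c(1)]
      by (intro A.tangent_vector_cong[OF v, of "N \<inter> U"]) auto
  qed
  finally show ?thesis .
qed

lemma prod_lift_prod_lift:
  assumes X: "X \<in> smooth_vfields A" "X' \<in> smooth_vfields A" and Y: "Y \<in> smooth_vfields B" "Y' \<in> smooth_vfields B"
    and f: "smooth_at M (p, q) f"
  shows "prod_lift X Y (p, q) (vderiv (prod_lift X' Y') f) =
    X p (\<lambda>p'. X' p' (\<lambda>p'. f (p', q))) + X p (\<lambda>p'. Y' q (\<lambda>q'. f (p', q')))
    + (Y q (\<lambda>q'. X' p (\<lambda>p'. f (p', q'))) + Y q (\<lambda>q'. Y' q' (\<lambda>q'. f (p, q'))))"
proof -
  have tX: "X p \<in> tangent_space A p" and tY: "Y q \<in> tangent_space B q"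
    by (rule A.smooth_vfield_tangent[OF X(1)] B.smooth_vfield_tangent[OF Y(1)])+
  obtain N N' where N: "open N" "p \<in> N" "\<And>p'. p' \<in> N \<Longrightarrow> smooth_at M (p', q) f"
    "open N'" "q \<in> N'" "\<And>q'. q' \<in> N' \<Longrightarrow> smooth_at M (p, q') f"
    using slice_nbhd[OF f] by blast
  have g: "smooth_at M (p, q) (\<lambda>m. prod_lift X' Y' m f)"
    by (rule M.smooth_vfield_smooth[OF prod_lift_smooth_vfield[OF X(2) Y(2)] f])
  \<comment> \<open>Splitting a tangent vector over a sum needs both summands smooth. The mixed ones
    are slices of the derivative of \<open>f\<close> along a lift with one component zero, hence the
    zero fields here.\<close>
  have gX: "smooth_at M (p, q) (\<lambda>m. prod_lift X' 0 m f)"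
    by (rule M.smooth_vfield_smooth[OF prod_lift_smooth_vfield[OF X(2) B.zero_smooth_vfield] f])
  have gY: "smooth_at M (p, q) (\<lambda>m. prod_lift 0 Y' m f)"
    by (rule M.smooth_vfield_smooth[OF prod_lift_smooth_vfield[OF A.zero_smooth_vfield Y(2)] f])
  have A1: "smooth_at A p (\<lambda>p'. X' p' (\<lambda>p'. f (p', q)))"
    by (rule A.smooth_vfield_smooth[OF X(2) smooth_at_slice(1)[OF f]])
  have A2: "smooth_at A p (\<lambda>p'. Y' q (\<lambda>q'. f (p', q')))"
    by (rule A.smooth_at_cong[OF N(1,2) _ smooth_at_slice(1)[OF gY]]) (simp add: prod_lift_apply N(3))
  have B1: "smooth_at B q (\<lambda>q'. Y' q' (\<lambda>q'. f (p, q')))"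
    by (rule B.smooth_vfield_smooth[OF Y(2) smooth_at_slice(2)[OF f]])
  have B2: "smooth_at B q (\<lambda>q'. X' p (\<lambda>p'. f (p', q')))"
    by (rule B.smooth_at_cong[OF N(4,5) _ smooth_at_slice(2)[OF gX]]) (simp add: prod_lift_apply N(6))
  have "prod_lift X Y (p, q) (vderiv (prod_lift X' Y') f) =
    X p (\<lambda>p'. prod_lift X' Y' (p', q) f) + Y q (\<lambda>q'. prod_lift X' Y' (p, q') f)"
    using prod_lift_apply[OF g] by (simp add: vderiv_def)
  also have "X p (\<lambda>p'. prod_lift X' Y' (p', q) f) =
    X p (\<lambda>p'. X' p' (\<lambda>p'. f (p', q)) + Y' q (\<lambda>q'. f (p', q')))"
    by (rule A.tangent_vector_cong[OF tX N(1,2)]) (simp add: prod_lift_apply N(3))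
  also have "\<dots> = X p (\<lambda>p'. X' p' (\<lambda>p'. f (p', q))) + X p (\<lambda>p'. Y' q (\<lambda>q'. f (p', q')))"
    by (rule A.tangent_vector_add[OF tX A1 A2])
  also have "Y q (\<lambda>q'. prod_lift X' Y' (p, q') f) =
    Y q (\<lambda>q'. X' p (\<lambda>p'. f (p', q')) + Y' q' (\<lambda>q'. f (p, q')))"
    by (rule B.tangent_vector_cong[OF tY N(4,5)]) (simp add: prod_lift_apply N(6))
  also have "\<dots> = Y q (\<lambda>q'. X' p (\<lambda>p'. f (p', q'))) + Y q (\<lambda>q'. Y' q' (\<lambda>q'. f (p, q')))"
    by (rule B.tangent_vector_add[OF tY B2 B1])
  finally show ?thesis .
qed

text \<open>Of the four second-order terms of each product, the two mixed ones are common to both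
  orders by \<open>tangent_vectors_commute\<close> and cancel; the rest are the brackets in the
  factors.\<close>

lemma lie_bracket_prod_lift:
  assumes X: "X \<in> smooth_vfields A" "X' \<in> smooth_vfields A" and Y: "Y \<in> smooth_vfields B" "Y' \<in> smooth_vfields B"
  shows "lie_bracket M (prod_lift X Y) (prod_lift X' Y') = prod_lift (lie_bracket A X X') (lie_bracket B Y Y')"
proof (intro ext)
  fix m :: "'a \<times> 'b" and f
  obtain p q where m: "m = (p, q)" by (cases m)
  show "lie_bracket M (prod_lift X Y) (prod_lift X' Y') m f = prod_lift (lie_bracket A X X') (lie_bracket B Y Y') m f"
  proof (cases "smooth_at M m f")
    case True
    then have f: "smooth_at M (p, q) f" using m by simp
    note t = A.smooth_vfield_tangent B.smooth_vfield_tangent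
    have 1: "Y q (\<lambda>q'. X' p (\<lambda>p'. f (p', q'))) = X' p (\<lambda>p'. Y q (\<lambda>q'. f (p', q')))"
      by (rule tangent_vectors_commute[OF t(1)[OF X(2)] t(2)[OF Y(1)] f])
    have 2: "Y' q (\<lambda>q'. X p (\<lambda>p'. f (p', q'))) = X p (\<lambda>p'. Y' q (\<lambda>q'. f (p', q')))"
      by (rule tangent_vectors_commute[OF t(1)[OF X(1)] t(2)[OF Y(2)] f])
    have "lie_bracket M (prod_lift X Y) (prod_lift X' Y') m f =
      prod_lift X Y (p, q) (vderiv (prod_lift X' Y') f) - prod_lift X' Y' (p, q) (vderiv (prod_lift X Y) f)"
      using True by (simp add: lie_bracket_def m)
    also have "\<dots> = prod_lift (lie_bracket A X X') (lie_bracket B Y Y') m f"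
      unfolding prod_lift_prod_lift[OF X Y f] prod_lift_prod_lift[OF X(2,1) Y(2,1) f] 1 2 m
        prod_lift_apply[OF f]
      using smooth_at_slice[OF f] by (simp add: lie_bracket_def vderiv_def)
    finally show ?thesis .
  next
    case False
    then show ?thesis by (simp add: m lie_bracket_def prod_lift_nonsmooth)
  qed
qed

end

section \<open>Left-invariant vector fields\<close>

lemma (in smooth_manifold_pair) pushforward_tangent_space:
  assumes "(U, \<phi>) \<in> A" "(V, \<psi>) \<in> B" "open N" "p \<in> N" "N \<subseteq> U" "F ` N \<subseteq> V"
    and "smooth_on (\<phi> ` N) (\<psi> \<circ> F \<circ> inv_into U \<phi>)" and v: "v \<in> tangent_space A p"
  shows "pushforward B F p v \<in> tangent_space B (F p)"
proof -
  have "p \<in> U" "F p \<in> V" using assms by auto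
  then show ?thesis
    using v pushforward_chart_tvec[OF assms(1-7)] unfolding A.tangent_space_chart[OF assms(1) \<open>p \<in> U\<close>]
      B.tangent_space_chart[OF assms(2) \<open>F p \<in> V\<close>] by auto
qed

locale lie_group_manifold = smooth_manifold A
  for A :: "('a::{t2_space,second_countable_topology,group_add}, 'e::euclidean_space) chart set" +
  assumes lie_group: "lie_group A"

sublocale lie_group_manifold \<subseteq> AA: smooth_manifold_pair A A
  by unfold_locales

context lie_group_manifold
begin

lemma multiplication_smooth:
  assumes "(U, \<phi>) \<in> A" "(V, \<psi>) \<in> A" "(W, \<kappa>) \<in> A"
  shows "smooth_on (map_prod \<phi> \<psi> ` (Sigma U (\<lambda>_. V) \<inter> (\<lambda>(x, y). x + y) -` W))
      (\<kappa> \<circ> (\<lambda>(x, y). x + y) \<circ> inv_into (Sigma U (\<lambda>_. V)) (map_prod \<phi> \<psi>))"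
    and "open (map_prod \<phi> \<psi> ` (Sigma U (\<lambda>_. V) \<inter> (\<lambda>(x, y). x + y) -` W))"
proof -
  have s: "smooth_map (prod_atlas A A) A (\<lambda>(x, y). x + y)" using lie_group by (simp add: lie_group_def)
  then show "smooth_on (map_prod \<phi> \<psi> ` (Sigma U (\<lambda>_. V) \<inter> (\<lambda>(x, y). x + y) -` W))
      (\<kappa> \<circ> (\<lambda>(x, y). x + y) \<circ> inv_into (Sigma U (\<lambda>_. V)) (map_prod \<phi> \<psi>))"
    unfolding smooth_map_def using AA.prod_chart[OF assms(1,2)] assms(3) by fast
  have "open ((\<lambda>(x, y). x + y) -` W :: ('a \<times> 'a) set)"
    using s chart_homeomorphism(1)[OF assms(3)] unfolding smooth_map_def by (simp add: open_vimage)
  then show "open (map_prod \<phi> \<psi> ` (Sigma U (\<lambda>_. V) \<inter> (\<lambda>(x, y). x + y) -` W))"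
    by (rule AA.M.chart_open_image[OF AA.prod_chart[OF assms(1,2)]])
qed

lemma open_translation_preimage:
  assumes "open N"
  shows "open ((+) (a::'a) -` N)"
proof -
  have "continuous_on UNIV (\<lambda>(x, y). x + y :: 'a)"
    using lie_group by (simp add: lie_group_def smooth_map_def)
  then have "continuous_on UNIV (\<lambda>p. (\<lambda>(x, y). x + y :: 'a) (a, p))"
    by (rule continuous_on_compose2[OF _ continuous_on_Pair[OF continuous_on_const continuous_on_id]]) auto
  then show ?thesis using open_vimage[OF assms] by simp
qed

text \<open>Translation by \<open>a\<close> is multiplication with its first argument frozen at
  \<open>a\<close>, so its smoothness is inherited from joint smoothness of the
  multiplication.\<close>

lemma translation_chart:
  assumes c: "(U, \<phi>) \<in> A" and d: "(V, \<psi>) \<in> A" and e: "(W, \<kappa>) \<in> A" "a \<in> W"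
  shows "smooth_on (\<phi> ` (U \<inter> (+) a -` V)) (\<psi> \<circ> (+) a \<circ> inv_into U \<phi>)"
    and "x \<in> \<phi> ` U \<Longrightarrow> (\<psi> \<circ> (+) a \<circ> inv_into U \<phi>) x
      = (\<psi> \<circ> (\<lambda>(x, y). x + y) \<circ> inv_into (Sigma W (\<lambda>_. U)) (map_prod \<kappa> \<phi>)) (\<kappa> a, x)"
proof -
  let ?g = "\<psi> \<circ> (\<lambda>(x, y). x + y) \<circ> inv_into (Sigma W (\<lambda>_. U)) (map_prod \<kappa> \<phi>)"
  show eq: "(\<psi> \<circ> (+) a \<circ> inv_into U \<phi>) x = ?g (\<kappa> a, x)" if "x \<in> \<phi> ` U" for x
    using that e AA.prod_chart_inv[OF e(1) c, of "\<kappa> a" x] chart_inv[OF e] by simp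
  have o: "open (\<phi> ` (U \<inter> (+) a -` V))"
    by (intro chart_open_image[OF c] open_translation_preimage chart_homeomorphism(1)[OF d])
  have "smooth_on (\<phi> ` (U \<inter> (+) a -` V)) (\<lambda>x. ?g (\<kappa> a, x))"
    by (rule smooth_on_compose_Pair_right[OF o multiplication_smooth(2,1)[OF e(1) c d]])
       (use e in force)
  then show "smooth_on (\<phi> ` (U \<inter> (+) a -` V)) (\<psi> \<circ> (+) a \<circ> inv_into U \<phi>)"
    by (rule smooth_on_cong[OF _ o]) (use eq in auto)
qed

lemma translation_smooth:
  assumes c: "(U, \<phi>) \<in> A" and d: "(V, \<psi>) \<in> A"
  shows "smooth_on (\<phi> ` (U \<inter> (+) a -` V)) (\<psi> \<circ> (+) a \<circ> inv_into U \<phi>)"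
    "open (U \<inter> (+) a -` V)"
  using chart_exists[of a] translation_chart(1)[OF c d]
    chart_homeomorphism(1)[OF c] open_translation_preimage[OF chart_homeomorphism(1)[OF d]]
  by (metis, blast)

lemma smooth_at_translation:
  assumes f: "smooth_at A (a + p) f"
  shows "smooth_at A p (f \<circ> (+) a)"
proof -
  obtain U \<phi> where c: "(U, \<phi>) \<in> A" "p \<in> U" using chart_exists by blast
  obtain V \<psi> where d: "(V, \<psi>) \<in> A" "a + p \<in> V" using chart_exists by blast
  show ?thesis
    by (rule AA.smooth_at_compose[OF c(1) d(1) translation_smooth(2)[OF c(1) d(1)] _ _ _
          translation_smooth(1)[OF c(1) d(1)] f]) (use c d in auto)
qed

lemma left_invariant_extension:
  assumes v: "v \<in> tangent_space A 0"
  defines "X \<equiv> \<lambda>q. pushforward A ((+) q) 0 v"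
  shows "X \<in> lie_algebra A" "X 0 = v"
proof -
  obtain U \<phi> w where c: "(U, \<phi>) \<in> A" "0 \<in> U" and v': "v = chart_tvec A (U, \<phi>) 0 w"
    using v unfolding tangent_space_def by auto
  have "X \<in> smooth_vfields A"
  proof (rule smooth_vfieldI)
    fix p
    obtain V \<psi> where d: "(V, \<psi>) \<in> A" "p \<in> V" using chart_exists by blast
    let ?g = "\<psi> \<circ> (\<lambda>(x, y). x + y) \<circ> inv_into (Sigma V (\<lambda>_. U)) (map_prod \<psi> \<phi>)"
    let ?S = "map_prod \<psi> \<phi> ` (Sigma V (\<lambda>_. U) \<inter> (\<lambda>(x, y). x + y) -` V)"
    \<comment> \<open>The components of \<open>X\<close> are the partial derivative of the
      multiplication in its second argument at the identity, in direction \<open>w\<close>. They are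
      smooth in \<open>x\<close> because the multiplication is jointly smooth; separate smoothness
      of each translation would not give this.\<close>
    define \<xi> where "\<xi> x = frechet_derivative ?g (at (x, \<phi> 0)) (0, w)" for x
    note g = multiplication_smooth[OF d(1) c(1) d(1)]
    have mem: "(\<psi> q, \<phi> 0) \<in> ?S" if "q \<in> V" for q using that c by force
    have "smooth_on (\<psi> ` V) \<xi>"
      unfolding \<xi>_def
      by (rule smooth_on_compose_Pair_left[OF chart_homeomorphism(2)[OF d(1)] g(2) smooth_on_derivative[OF g(1)]])
         (use mem in auto)
    moreover have "X q = chart_tvec A (V, \<psi>) q (\<xi> (\<psi> q))" if q: "q \<in> V" for q
    proof -
      let ?h = "\<psi> \<circ> (+) q \<circ> inv_into U \<phi>"
      have o: "open (\<phi> ` U)" "\<phi> 0 \<in> \<phi> ` U" using chart_homeomorphism(2)[OF c(1)] c by auto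
      have "((\<lambda>y. (\<psi> q, y)) has_derivative (\<lambda>w. (0, w))) (at (\<phi> 0))"
        by (intro has_derivative_Pair has_derivative_ident has_derivative_const)
      from diff_chain_at[OF this smooth_on_has_derivative[OF g(1) mem[OF q]]]
      have "((\<lambda>y. ?g (\<psi> q, y)) has_derivative (\<lambda>w. frechet_derivative ?g (at (\<psi> q, \<phi> 0)) (0, w))) (at (\<phi> 0))"
        by (simp add: o_def)
      then have "(?h has_derivative (\<lambda>w. frechet_derivative ?g (at (\<psi> q, \<phi> 0)) (0, w))) (at (\<phi> 0))"
        by (rule has_derivative_transform_within_open[OF _ o])
           (use translation_chart(2)[OF c(1) d(1) d(1) q] in auto)
      from frechet_derivative_at[OF this]
      have "frechet_derivative ?h (at (\<phi> 0)) w = \<xi> (\<psi> q)" by (simp add: \<xi>_def fun_eq_iff)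
      moreover have "X q = chart_tvec A (V, \<psi>) (q + 0) (frechet_derivative ?h (at (\<phi> 0)) w)"
        unfolding X_def v'
        by (rule AA.pushforward_chart_tvec[OF c(1) d(1) translation_smooth(2)[OF c(1) d(1)] _ _ _
              translation_smooth(1)[OF c(1) d(1)]]) (use c q in auto)
      ultimately show ?thesis by simp
    qed
    ultimately show "\<exists>V \<psi> \<xi>. (V, \<psi>) \<in> A \<and> p \<in> V \<and> smooth_on (\<psi> ` V) \<xi> \<and>
      (\<forall>q\<in>V. X q = chart_tvec A (V, \<psi>) q (\<xi> (\<psi> q)))"
      using d by blast
  qed
  moreover have "pushforward A ((+) a) p (X p) = X (a + p)" for a p
    using smooth_at_translation[of a p]
    by (auto simp: X_def pushforward_def fun_eq_iff o_def add.assoc)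
  ultimately show "X \<in> lie_algebra A" by (simp add: lie_algebra_def)
  show "X 0 = v"
    by (auto simp: X_def pushforward_def fun_eq_iff o_def v' chart_tvec_def)
qed

lemma lie_algebra_smooth: "X \<in> lie_algebra A \<Longrightarrow> X \<in> smooth_vfields A"
  by (simp add: lie_algebra_def)

lemma lie_algebra_translate: "X \<in> lie_algebra A \<Longrightarrow> X a = pushforward A ((+) a) 0 (X 0)"
  unfolding lie_algebra_def by (metis (mono_tags, lifting) add.right_neutral mem_Collect_eq)

lemma lie_algebra_eq_0: "X \<in> lie_algebra A \<Longrightarrow> X 0 = 0 \<Longrightarrow> X = 0"
proof
  fix a assume "X \<in> lie_algebra A" "X 0 = 0"
  then have "X a = pushforward A ((+) a) 0 0" using lie_algebra_translate[of X a] by simp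
  then show "X a = 0 a" by (simp add: fun_eq_iff pushforward_def)
qed

end

section \<open>The product of two Lie groups\<close>

locale lie_group_pair = A: lie_group_manifold A + B: lie_group_manifold B
  for A :: "('a::{t2_space,second_countable_topology,group_add}, 'e::euclidean_space) chart set"
    and B :: "('b::{t2_space,second_countable_topology,group_add}, 'f::euclidean_space) chart set"

sublocale lie_group_pair \<subseteq> P: smooth_manifold_pair A B
  by unfold_locales

context lie_group_pair
begin

abbreviation M where "M \<equiv> prod_atlas A B"

text \<open>A left translation of the product group is a product of left translations, and
  translations are what left-invariance of a structure on \<open>M\<close> refers to.\<close>

lemma prod_translation_smooth:
  fixes a :: 'a and b :: 'b
  assumes "(U, \<phi>) \<in> A" "(V, \<psi>) \<in> B" "(U', \<phi>') \<in> A" "(V', \<psi>') \<in> B"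
  defines "N \<equiv> Sigma (U \<inter> (+) a -` U') (\<lambda>_. V \<inter> (+) b -` V')"
  shows "open N" "smooth_on (map_prod \<phi> \<psi> ` N)
    (map_prod \<phi>' \<psi>' \<circ> (+) (a, b) \<circ> inv_into (Sigma U (\<lambda>_. V)) (map_prod \<phi> \<psi>))"
proof -
  note a = A.translation_smooth[OF assms(1,3), of a] note b = B.translation_smooth[OF assms(2,4), of b]
  show "open N" unfolding N_def by (rule open_Times[OF a(2) b(2)])
  have o: "open (\<phi> ` (U \<inter> (+) a -` U'))" "open (\<psi> ` (V \<inter> (+) b -` V'))"
    using A.chart_open_image[OF assms(1) a(2)] B.chart_open_image[OF assms(2) b(2)] by (simp_all add: Int_absorb2 flip: Int_assoc)
  have im: "map_prod \<phi> \<psi> ` N = Sigma (\<phi> ` (U \<inter> (+) a -` U')) (\<lambda>_. \<psi> ` (V \<inter> (+) b -` V'))"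
    unfolding N_def by (rule P.prod_chart_image)
  have "smooth_on (map_prod \<phi> \<psi> ` N) (\<lambda>z. ((\<phi>' \<circ> (+) a \<circ> inv_into U \<phi>) (fst z), (\<psi>' \<circ> (+) b \<circ> inv_into V \<psi>) (snd z)))"
    unfolding im
    by (intro smooth_on_Pair smooth_on_compose_fst[OF _ o(1) a(1)] smooth_on_compose_snd[OF _ o(2) b(1)]
        open_Times o) auto
  then show "smooth_on (map_prod \<phi> \<psi> ` N)
    (map_prod \<phi>' \<psi>' \<circ> (+) (a, b) \<circ> inv_into (Sigma U (\<lambda>_. V)) (map_prod \<phi> \<psi>))"
    by (rule smooth_on_cong)
       (unfold im, rule open_Times[OF o], auto simp: P.prod_chart_inv[OF assms(1,2)])
qed

lemma prod_translation:
  shows "smooth_at M (m + n) f \<Longrightarrow> smooth_at M n (f \<circ> (+) m)"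
    and "v \<in> tangent_space M n \<Longrightarrow> pushforward M ((+) m) n v \<in> tangent_space M (m + n)"
proof -
  interpret MM: smooth_manifold_pair M M by unfold_locales
  obtain a b where m: "m = (a, b)" by (cases m)
  obtain p q where n: "n = (p, q)" by (cases n)
  obtain U \<phi> where c: "(U, \<phi>) \<in> A" "p \<in> U" using A.chart_exists by blast
  obtain V \<psi> where d: "(V, \<psi>) \<in> B" "q \<in> V" using B.chart_exists by blast
  obtain U' \<phi>' where c': "(U', \<phi>') \<in> A" "a + p \<in> U'" using A.chart_exists by blast
  obtain V' \<psi>' where d': "(V', \<psi>') \<in> B" "b + q \<in> V'" using B.chart_exists by blast
  let ?N = "Sigma (U \<inter> (+) a -` U') (\<lambda>_. V \<inter> (+) b -` V')"
  have N: "open ?N" "n \<in> ?N" "?N \<subseteq> Sigma U (\<lambda>_. V)" "(+) m ` ?N \<subseteq> Sigma U' (\<lambda>_. V')"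
    using prod_translation_smooth(1)[OF c(1) d(1) c'(1) d'(1)] c d c' d' by (auto simp: m n)
  note hyps = P.prod_chart[OF c(1) d(1)] P.prod_chart[OF c'(1) d'(1)] N
    prod_translation_smooth(2)[OF c(1) d(1) c'(1) d'(1), of a b, folded m]
  show "smooth_at M n (f \<circ> (+) m)" if "smooth_at M (m + n) f"
    by (rule MM.smooth_at_compose[OF hyps that])
  show "pushforward M ((+) m) n v \<in> tangent_space M (m + n)" if "v \<in> tangent_space M n"
    by (rule MM.pushforward_tangent_space[OF hyps that])
qed

lemma prod_lift_translate:
  assumes X: "X \<in> lie_algebra A" and Y: "Y \<in> lie_algebra B"
  shows "P.prod_lift X Y m = pushforward M ((+) m) 0 (P.prod_lift X Y 0)"
proof
  fix f
  obtain a b where m: "m = (a, b)" by (cases m)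
  show "P.prod_lift X Y m f = pushforward M ((+) m) 0 (P.prod_lift X Y 0) f"
  proof (cases "smooth_at M m f")
    case True
    then have f: "smooth_at M (a, b) f" using m by simp
    have "smooth_at M (0, 0) (f \<circ> (+) m)"
      using prod_translation(1)[of m 0 f] True by (simp flip: zero_prod_def)
    then have "pushforward M ((+) m) 0 (P.prod_lift X Y 0) f =
      X 0 (\<lambda>p'. f (a + p', b)) + Y 0 (\<lambda>q'. f (a, b + q'))"
      using True by (simp add: pushforward_def zero_prod_def P.prod_lift_apply) (simp add: m)
    also have "X 0 (\<lambda>p'. f (a + p', b)) = X a (\<lambda>p'. f (p', b))"
      using fun_cong[OF A.lie_algebra_translate[OF X, of a], of "\<lambda>p'. f (p', b)"] P.smooth_at_slice(1)[OF f]
      by (simp add: pushforward_def o_def)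
    also have "Y 0 (\<lambda>q'. f (a, b + q')) = Y b (\<lambda>q'. f (a, q'))"
      using fun_cong[OF B.lie_algebra_translate[OF Y, of b], of "\<lambda>q'. f (a, q')"] P.smooth_at_slice(2)[OF f]
      by (simp add: pushforward_def o_def)
    finally show ?thesis using P.prod_lift_apply[OF f] m by simp
  next
    case False
    then show ?thesis using P.prod_lift_nonsmooth[of a b f] by (simp add: m pushforward_def)
  qed
qed

text \<open>Together with \<open>prod_lift_inj_at_0\<close> this identifies pairs of left-invariant
  fields with the tangent space of the product at the identity. In a product chart a vector splits
  into components \<open>w1\<close> and \<open>w2\<close>, each of which extends left-invariantly
  over its own factor.\<close>

lemma prod_lift_surj_at_0:
  assumes "w \<in> tangent_space M 0"
  obtains X Y where "X \<in> lie_algebra A" "Y \<in> lie_algebra B" "P.prod_lift X Y 0 = w"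
proof -
  obtain U \<phi> where c: "(U, \<phi>) \<in> A" "0 \<in> U" using A.chart_exists by blast
  obtain V \<psi> where d: "(V, \<psi>) \<in> B" "0 \<in> V" using B.chart_exists by blast
  have "tangent_space M (0, 0) = range (chart_tvec M (Sigma U (\<lambda>_. V), map_prod \<phi> \<psi>) (0, 0))"
    using P.M.tangent_space_chart[OF P.prod_chart[OF c(1) d(1)], of "(0, 0)"] c d by simp
  then obtain w1 w2 where w: "w = chart_tvec M (Sigma U (\<lambda>_. V), map_prod \<phi> \<psi>) (0, 0) (w1, w2)"
    using assms by (auto simp: zero_prod_def)
  have t: "chart_tvec A (U, \<phi>) 0 w1 \<in> tangent_space A 0" "chart_tvec B (V, \<psi>) 0 w2 \<in> tangent_space B 0"
    unfolding A.tangent_space_chart[OF c] B.tangent_space_chart[OF d] by auto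
  obtain X where X: "X \<in> lie_algebra A" "X 0 = chart_tvec A (U, \<phi>) 0 w1"
    using A.left_invariant_extension[OF t(1)] by blast
  obtain Y where Y: "Y \<in> lie_algebra B" "Y 0 = chart_tvec B (V, \<psi>) 0 w2"
    using B.left_invariant_extension[OF t(2)] by blast
  have "P.prod_lift X Y (0, 0) = w"
    unfolding w by (rule P.prod_lift_chart[where X = X and Y = Y, OF c d X(2) Y(2)])
  then show thesis using that[OF X(1) Y(1)] by (simp add: zero_prod_def)
qed

lemma prod_lift_inj_at_0:
  assumes X: "X \<in> lie_algebra A" and Y: "Y \<in> lie_algebra B" and 0: "P.prod_lift X Y 0 = 0"
  shows "X = 0" "Y = 0"
proof -
  obtain U \<phi> where c: "(U, \<phi>) \<in> A" "0 \<in> U" using A.chart_exists by blast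
  obtain V \<psi> where d: "(V, \<psi>) \<in> B" "0 \<in> V" using B.chart_exists by blast
  obtain w1 where w1: "X 0 = chart_tvec A (U, \<phi>) 0 w1"
    using A.smooth_vfield_tangent[OF A.lie_algebra_smooth[OF X], of 0] A.tangent_space_chart[OF c] by auto
  obtain w2 where w2: "Y 0 = chart_tvec B (V, \<psi>) 0 w2"
    using B.smooth_vfield_tangent[OF B.lie_algebra_smooth[OF Y], of 0] B.tangent_space_chart[OF d] by auto
  have e: "(Sigma U (\<lambda>_. V), map_prod \<phi> \<psi>) \<in> M" "(0, 0) \<in> Sigma U (\<lambda>_. V)"
    using P.prod_chart[OF c(1) d(1)] c d by auto
  have z: "chart_tvec M (Sigma U (\<lambda>_. V), map_prod \<phi> \<psi>) (0, 0) (w1, w2) = 0"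
    using 0 P.prod_lift_chart[where X = X and Y = Y, OF c d w1 w2] by (simp add: zero_prod_def)
  \<comment> \<open>Tested on the coordinate in its own direction, the vector returns its squared
    length.\<close>
  have "(w1, w2) \<bullet> (w1, w2) = chart_tvec M (Sigma U (\<lambda>_. V), map_prod \<phi> \<psi>) (0, 0) (w1, w2)
      (\<lambda>m. map_prod \<phi> \<psi> m \<bullet> (w1, w2))"
    by (rule P.M.chart_tvec_coordinate[OF e, symmetric])
  also have "\<dots> = 0" by (simp only: z zero_fun_apply)
  finally have "(w1, w2) = 0" by (simp only: inner_eq_zero_iff)
  then have "w1 = 0" "w2 = 0" by (simp_all add: zero_prod_def)
  then have "X 0 = 0" "Y 0 = 0"
    using A.chart_tvec_scale[OF c, of 0 0] B.chart_tvec_scale[OF d, of 0 0] by (simp_all add: w1 w2)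
  then show "X = 0" "Y = 0" using A.lie_algebra_eq_0[OF X] B.lie_algebra_eq_0[OF Y] by simp_all
qed

end

section \<open>Linear algebra on so(3) + so(3)\<close>

definition so3_sum_bracket :: "(real^3) \<times> (real^3) \<Rightarrow> (real^3) \<times> (real^3) \<Rightarrow> (real^3) \<times> (real^3)" where
  "so3_sum_bracket u v = (cross3 (fst u) (fst v), cross3 (snd u) (snd v))"

lemma so3_sum_bracket_add_left: "so3_sum_bracket (u + v) w = so3_sum_bracket u w + so3_sum_bracket v w"
  and so3_sum_bracket_add_right: "so3_sum_bracket u (v + w) = so3_sum_bracket u v + so3_sum_bracket u w"
  and so3_sum_bracket_diff_left: "so3_sum_bracket (u - v) w = so3_sum_bracket u w - so3_sum_bracket v w"
  and so3_sum_bracket_diff_right: "so3_sum_bracket u (v - w) = so3_sum_bracket u v - so3_sum_bracket u w"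
  and so3_sum_bracket_scale_left: "so3_sum_bracket (c *\<^sub>R u) w = c *\<^sub>R so3_sum_bracket u w"
  and so3_sum_bracket_scale_right: "so3_sum_bracket u (c *\<^sub>R w) = c *\<^sub>R so3_sum_bracket u w"
  and so3_sum_bracket_zero_left: "so3_sum_bracket 0 w = 0"
  and so3_sum_bracket_zero_right: "so3_sum_bracket w 0 = 0"
  and so3_sum_bracket_minus_left: "so3_sum_bracket (- u) w = - so3_sum_bracket u w"
  and so3_sum_bracket_minus_right: "so3_sum_bracket u (- w) = - so3_sum_bracket u w"
  and so3_sum_bracket_self: "so3_sum_bracket u u = 0"
  by (auto simp: so3_sum_bracket_def prod_eq_iff cross_add_left cross_add_right
      Cross3.left_diff_distrib Cross3.right_diff_distrib cross_mult_left cross_mult_right)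

lemmas so3_sum_bracket_simps = so3_sum_bracket_add_left so3_sum_bracket_add_right
  so3_sum_bracket_diff_left so3_sum_bracket_diff_right so3_sum_bracket_scale_left so3_sum_bracket_scale_right so3_sum_bracket_zero_left
  so3_sum_bracket_zero_right so3_sum_bracket_minus_left so3_sum_bracket_minus_right
  so3_sum_bracket_self

lemma so3_sum_bracket_skew: "so3_sum_bracket u v = - so3_sum_bracket v u"
  by (simp add: so3_sum_bracket_def cross_skew[of "fst u"] cross_skew[of "snd u"])

text \<open>Invariance of the standard inner product under the adjoint action. It yields
  unimodularity (the trace of ad vanishes) and moves brackets from one argument to the
  other.\<close>

lemma so3_sum_bracket_inner: "so3_sum_bracket u v \<bullet> w = u \<bullet> so3_sum_bracket v w"
  by (simp add: so3_sum_bracket_def inner_prod_def inner_commute[of "fst u"] inner_commute[of "snd u"]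
      cross_triple[of "fst u"] cross_triple[of "snd u"])

definition operator_trace :: "('a::euclidean_space \<Rightarrow> 'a) \<Rightarrow> real" where
  "operator_trace f = (\<Sum>b\<in>Basis. f b \<bullet> b)"

lemma operator_trace_commute:
  fixes f g :: "'a::euclidean_space \<Rightarrow> 'a"
  assumes "linear f" "linear g"
  shows "operator_trace (f \<circ> g) = operator_trace (g \<circ> f)"
proof -
  have *: "f' (g' b) \<bullet> b = (\<Sum>c\<in>Basis. (g' b \<bullet> c) * (f' c \<bullet> b))" if "linear f'" for f' g' :: "'a \<Rightarrow> 'a" and b
  proof -
    have "f' (g' b) = f' (\<Sum>c\<in>Basis. (g' b \<bullet> c) *\<^sub>R c)"
      by (simp add: euclidean_representation)
    also have "\<dots> = (\<Sum>c\<in>Basis. (g' b \<bullet> c) *\<^sub>R f' c)"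
      using that by (simp add: linear_sum linear_scale)
    finally show ?thesis by (simp add: inner_sum_left)
  qed
  have "operator_trace (f \<circ> g) = (\<Sum>b\<in>Basis. \<Sum>c\<in>Basis. (g b \<bullet> c) * (f c \<bullet> b))"
    unfolding operator_trace_def o_def by (intro sum.cong refl *[of f g] assms)
  moreover have "operator_trace (g \<circ> f) = (\<Sum>b\<in>Basis. \<Sum>c\<in>Basis. (f b \<bullet> c) * (g c \<bullet> b))"
    unfolding operator_trace_def o_def by (intro sum.cong refl *[of g f] assms)
  moreover have "\<dots> = (\<Sum>b\<in>Basis. \<Sum>c\<in>Basis. (g b \<bullet> c) * (f c \<bullet> b))"
    by (subst sum.swap) (simp only: mult.commute)
  ultimately show ?thesis by simp
qed

text \<open>One step of a singular value decomposition: \<open>P\<close> attains its maximum over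
  the compact product of the two unit spheres, and the first-order conditions at a maximum are the
  two orthogonality statements.\<close>

lemma bilinear_form_max:
  fixes P :: "'a::euclidean_space \<Rightarrow> 'b::euclidean_space \<Rightarrow> real"
  assumes P: "bilinear P" and S: "subspace S" "S \<noteq> {0}" and T: "subspace T" "T \<noteq> {0}"
  shows "\<exists>u\<in>S. \<exists>v\<in>T. norm u = 1 \<and> norm v = 1 \<and>
    (\<forall>w\<in>T. w \<bullet> v = 0 \<longrightarrow> P u w = 0) \<and> (\<forall>w\<in>S. w \<bullet> u = 0 \<longrightarrow> P w v = 0)"
proof -
  have unit: "\<exists>u\<in>V. norm u = 1" if V: "subspace V" "V \<noteq> {0}" for V :: "'c::euclidean_space set"
  proof -
    obtain u where "u \<in> V" "u \<noteq> 0" using V subspace_0[OF V(1)] by blast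
    then show ?thesis
      by (intro bexI[of _ "(1 / norm u) *\<^sub>R u"]) (auto intro: subspace_scale V)
  qed
  define K where "K = (S \<inter> sphere 0 1) \<times> (T \<inter> sphere 0 1)"
  have "compact K" unfolding K_def
    by (intro compact_Times closed_Int_compact closed_subspace compact_sphere S T)
  moreover have "K \<noteq> {}" using unit[OF S] unit[OF T] by (auto simp: K_def)
  moreover have "continuous_on K (\<lambda>z. P (fst z) (snd z))"
    using P by (intro bilinear_continuous_on_compose[where h=P] continuous_intros)
  ultimately have "\<exists>z\<in>K. \<forall>z'\<in>K. P (fst z') (snd z') \<le> P (fst z) (snd z)"
    by (rule continuous_attains_sup)
  then obtain z where z: "z \<in> K" "\<And>z'. z' \<in> K \<Longrightarrow> P (fst z') (snd z') \<le> P (fst z) (snd z)"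
    by blast
  obtain u v where uv: "z = (u, v)" by (cases z)
  have u: "u \<in> S" "norm u = 1" and v: "v \<in> T" "norm v = 1" using z(1) uv by (auto simp: K_def)
  have mx: "P a b \<le> P u v" if "a \<in> S" "norm a = 1" "b \<in> T" "norm b = 1" for a b
    using z(2)[of "(a, b)"] that uv by (auto simp: K_def)
  text \<open>If \<open>L w\<close> were nonzero, moving from \<open>u\<close> along a multiple of \<open>w\<close> would increase \<open>L a / norm a\<close>.\<close>
  have key: "L w = 0" if L: "linear L" and V: "subspace V" "u \<in> V" "norm u = 1" "w \<in> V" "w \<bullet> u = 0"
    and le: "\<And>a. a \<in> V \<Longrightarrow> norm a = 1 \<Longrightarrow> L a \<le> L u"
    for L :: "'c::euclidean_space \<Rightarrow> real" and V u w
  proof (rule ccontr)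
    assume nz: "L w \<noteq> 0"
    have hom: "L a \<le> L u * norm a" if "a \<in> V" for a
    proof (cases "a = 0")
      case True then show ?thesis using L by (simp add: linear_0)
    next
      case False
      have "L ((1 / norm a) *\<^sub>R a) \<le> L u"
        by (rule le) (use False that V(1) in \<open>auto intro: subspace_scale\<close>)
      then show ?thesis using False L by (simp add: linear_scale field_simps)
    qed
    define N where "N = w \<bullet> w"
    have N: "N > 0" using nz L by (auto simp: N_def linear_0)
    have u: "u \<bullet> u = 1" "u \<bullet> w = 0" using V(3,5) by (simp_all add: norm_eq_1 inner_commute)
    have nrm: "(norm (x *\<^sub>R u + y *\<^sub>R w))\<^sup>2 = x\<^sup>2 + y\<^sup>2 * N" for x y
      unfolding power2_norm_eq_inner inner_add_left inner_add_right inner_scaleR_left inner_scaleR_right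
        V(5) u N_def by (simp add: power2_eq_square)
    have pos: "L u \<ge> 0"
      using hom[of "- u"] V(1-3) L by (simp add: linear_neg subspace_neg)
    \<comment> \<open>The vector with coefficients \<open>x\<close> and \<open>y\<close> represents
      \<open>L\<close> on the span of \<open>u\<close> and \<open>w\<close>, so \<open>L\<close>
      takes its squared norm \<open>n\<^sup>2\<close> as value there. Maximality bounds this by
      \<open>x * n\<close>, although \<open>n\<close> exceeds \<open>x\<close> as soon as
      \<open>L w\<close> is nonzero.\<close>
    define x where "x = L u"
    define y where "y = L w / N"
    have "x\<^sup>2 + y\<^sup>2 * N = L (x *\<^sub>R u + y *\<^sub>R w)"
      using L N by (simp add: linear_add linear_scale x_def y_def power2_eq_square)
    also have "\<dots> \<le> x * norm (x *\<^sub>R u + y *\<^sub>R w)"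
      unfolding x_def by (rule hom) (intro subspace_add subspace_scale V)
    finally have le2: "n\<^sup>2 \<le> x * n" if "n = norm (x *\<^sub>R u + y *\<^sub>R w)" for n
      using that by (simp add: nrm)
    define n where "n = norm (x *\<^sub>R u + y *\<^sub>R w)"
    have "y\<^sup>2 * N > 0" using nz N by (simp add: y_def)
    then have n2: "n\<^sup>2 > x\<^sup>2" by (simp add: n_def nrm)
    then have "n > x" using power2_less_imp_less[of x n] by (simp add: n_def)
    then have "n * n > x * n" using pos x_def by (intro mult_strict_right_mono) auto
    then show False using le2[of n] by (simp add: n_def power2_eq_square)
  qed
  have lu: "linear (P u)" and lv: "linear (\<lambda>a. P a v)" using P by (auto simp: bilinear_def)
  have "P u w = 0" if "w \<in> T" "w \<bullet> v = 0" for w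
    by (rule key[OF lu T(1), of v w]) (use v u that mx in auto)
  moreover have "P w v = 0" if "w \<in> S" "w \<bullet> u = 0" for w
    by (rule key[OF lv S(1), of u w]) (use v u that mx in auto)
  ultimately show ?thesis using u v by blast
qed

text \<open>Completing an orthonormal pair by its cross product gives a basis with the standard
  structure constants of so(3). For the expansion, a remainder orthogonal to all three vectors has
  both cross and dot product zero with the unit vector \<open>cross3 a b\<close>, hence
  vanishes.\<close>

lemma cross3_orthonormal:
  assumes "norm a = 1" "norm b = 1" "b \<bullet> a = 0"
  shows "cross3 b (cross3 a b) = a" "cross3 (cross3 a b) a = b" "norm (cross3 a b) = 1"
    "x = (x \<bullet> a) *\<^sub>R a + (x \<bullet> b) *\<^sub>R b + (x \<bullet> cross3 a b) *\<^sub>R cross3 a b"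
proof -
  note ab = assms(1,2)[unfolded norm_eq_1] assms(3) assms(3)[unfolded inner_commute[of b]]
  show "cross3 b (cross3 a b) = a" using ab by (simp add: Lagrange)
  show "cross3 (cross3 a b) a = b" using ab by (subst cross_skew) (simp add: Lagrange)
  have nc: "cross3 a b \<bullet> cross3 a b = 1" using ab by (simp add: dot_cross)
  then show "norm (cross3 a b) = 1" by (simp add: norm_eq_1)
  define y where "y = x - ((x \<bullet> a) *\<^sub>R a + (x \<bullet> b) *\<^sub>R b + (x \<bullet> cross3 a b) *\<^sub>R cross3 a b)"
  have y: "y \<bullet> a = 0" "y \<bullet> b = 0" "y \<bullet> cross3 a b = 0"
    using ab nc by (simp_all add: y_def inner_diff_left inner_add_left dot_cross_self)
  then have "cross3 y (cross3 a b) = 0" by (simp add: Lagrange)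
  then have "(norm y)\<^sup>2 = 0"
    using norm_cross_dot[of y "cross3 a b"] y(3) \<open>norm (cross3 a b) = 1\<close> by simp
  then show "x = (x \<bullet> a) *\<^sub>R a + (x \<bullet> b) *\<^sub>R b + (x \<bullet> cross3 a b) *\<^sub>R cross3 a b"
    by (simp add: y_def)
qed

text \<open>The geometric conditions evaluated on left-invariant fields at the identity.
  \<open>D_metric\<close> has no derivative term because the metric is constant on such
  fields.\<close>

locale so3_sum_nearly_kaehler =
  fixes eps :: real
    and G :: "(real^3) \<times> (real^3) \<Rightarrow> (real^3) \<times> (real^3) \<Rightarrow> real"
    and J :: "(real^3) \<times> (real^3) \<Rightarrow> (real^3) \<times> (real^3)"
    and D :: "(real^3) \<times> (real^3) \<Rightarrow> (real^3) \<times> (real^3) \<Rightarrow> (real^3) \<times> (real^3)"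
  assumes eps: "eps = 1 \<or> eps = -1"
    and G_bilinear: "bilinear G" and G_sym: "G u v = G v u"
    and G_nondegenerate: "(\<And>v. G u v = 0) \<Longrightarrow> u = 0"
    and J_linear: "linear J" and J_J: "J (J u) = eps *\<^sub>R u"
    and G_J_J: "G (J u) (J v) = - eps * G u v"
    and D_bilinear: "bilinear D"
    and D_torsion_free: "D u v - D v u = so3_sum_bracket u v"
    and D_metric: "G (D u v) w + G v (D u w) = 0"
    and D_J_self: "D u (J u) = J (D u u)"
begin

lemmas G_lin = bilinear_ladd[OF G_bilinear] bilinear_radd[OF G_bilinear]
    bilinear_lsub[OF G_bilinear] bilinear_rsub[OF G_bilinear]
    bilinear_lmul[OF G_bilinear] bilinear_rmul[OF G_bilinear]
    bilinear_lneg[OF G_bilinear] bilinear_rneg[OF G_bilinear]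
    bilinear_lzero[OF G_bilinear] bilinear_rzero[OF G_bilinear]

lemmas D_lin = bilinear_ladd[OF D_bilinear] bilinear_radd[OF D_bilinear]
    bilinear_lsub[OF D_bilinear] bilinear_rsub[OF D_bilinear]
    bilinear_lmul[OF D_bilinear] bilinear_rmul[OF D_bilinear]
    bilinear_lneg[OF D_bilinear] bilinear_rneg[OF D_bilinear]
    bilinear_lzero[OF D_bilinear] bilinear_rzero[OF D_bilinear]

lemmas J_lin = linear_add[OF J_linear] linear_diff[OF J_linear] linear_scale[OF J_linear]
    linear_neg[OF J_linear] linear_0[OF J_linear]

lemma eps_sq: "eps * eps = 1"
  using eps by auto

lemma G_J: "G (J u) v = - G u (J v)"
proof -
  have "eps * G (J u) v = - eps * G u (J v)"
    using G_J_J[of u "J v"] by (simp add: J_J G_lin)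
  then show ?thesis using eps by auto
qed

section \<open>The fundamental form, its exterior derivative and the Nijenhuis tensor\<close>

definition om where "om u v = G u (J v)"

lemma om_bilinear: "bilinear om"
  unfolding om_def bilinear_def
  by (intro conjI allI linearI) (simp_all add: G_lin J_lin)

lemmas om_lin = bilinear_ladd[OF om_bilinear] bilinear_radd[OF om_bilinear]
    bilinear_lsub[OF om_bilinear] bilinear_rsub[OF om_bilinear]
    bilinear_lmul[OF om_bilinear] bilinear_rmul[OF om_bilinear]
    bilinear_lneg[OF om_bilinear] bilinear_rneg[OF om_bilinear]
    bilinear_lzero[OF om_bilinear] bilinear_rzero[OF om_bilinear]

lemma om_skew: "om u v = - om v u"
  unfolding om_def using G_J[of u v] G_sym by simp

lemma om_self [simp]: "om u u = 0"
  using om_skew[of u u] by simp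

lemma om_J: "om (J u) v = - om u (J v)"
  unfolding om_def by (rule G_J)

lemma om_J_right: "om u (J v) = eps * G u v"
  by (simp add: om_def J_J G_lin)

lemma om_nondegenerate: "(\<And>v. om u v = 0) \<Longrightarrow> u = 0"
  using G_nondegenerate[of u] eps om_J_right by (metis mult_eq_0_iff zero_neq_neg_one zero_neq_one)

text \<open>This is the covariant derivative of \<open>J\<close> along \<open>u\<close>, applied to
  \<open>v\<close>.\<close>

definition B where "B u v = D u (J v) - J (D u v)"

lemma B_skew: "B u v = - B v u"
proof -
  have "D (u + v) (J (u + v)) = J (D (u + v) (u + v))" by (rule D_J_self)
  then have "D u (J v) + D v (J u) = J (D u v) + J (D v u)"
    by (simp add: D_lin J_lin D_J_self add.commute)
  then show ?thesis by (simp add: B_def algebra_simps)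
qed

lemma B_J: "B u (J v) = - J (B u v)"
  by (simp add: B_def J_J J_lin D_lin)

lemma G_D: "G (D u v) w = - G v (D u w)"
  using D_metric[of u v w] by simp

lemma G_B_skew: "G (B u v) w = - G v (B u w)"
  by (simp add: B_def G_lin G_J G_D)

text \<open>Minus the exterior derivative of \<open>om\<close> on left-invariant fields, where the
  terms that differentiate values of \<open>om\<close> vanish.\<close>

definition T where
  "T u v w = om (so3_sum_bracket u v) w + om (so3_sum_bracket v w) u + om (so3_sum_bracket w u) v"

text \<open>Replacing each bracket by its torsion-free expression in \<open>D\<close> regroups the
  terms into the cyclic sum of \<open>G (B u v) w\<close>. That form is totally skew, so the three
  summands coincide.\<close>

lemma T_eq: "T u v w = 3 * G (B u v) w"
proof -
  have 1: "G (B u v) w = G (D u v) (J w) - G (D u w) (J v)" for u v w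
    by (simp add: B_def G_lin G_J) (metis G_D G_sym)
  have 2: "G (B v w) u = G (B u v) w"
    using G_B_skew[of v w u] G_sym[of w] B_skew[of v u] by (simp add: G_lin)
  have 3: "G (B w u) v = G (B u v) w"
    using G_B_skew[of u v w] G_sym[of v] B_skew[of u w] by (simp add: G_lin)
  have "T u v w = G (B u v) w + G (B v w) u + G (B w u) v"
    unfolding T_def om_def D_torsion_free[symmetric] G_lin 1 by simp
  then show ?thesis using 2 3 by simp
qed

lemma T_swap: "T u v w = - T v u w"
  by (simp add: T_eq B_skew[of u v] G_lin)

text \<open>Holds because \<open>B\<close> is skew and anticommutes with \<open>J\<close> in its
  second argument, hence also in its first.\<close>

lemma T_J: "T (J u) v w = T u (J v) w"
  using B_skew[of "J u" v] by (simp add: T_eq B_J G_lin B_skew[of v u] J_lin)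

lemma T_J_self: "T (J u) u w = 0"
  using T_J[of u u w] T_swap[of "J u" u w] by simp

text \<open>The Nijenhuis tensor is a sum of four terms each equal to \<open>- J (B u v)\<close>,
  which explains the 4; the 3 comes from \<open>T_eq\<close>. Pairing with \<open>w\<close> and
  moving \<open>J\<close> across \<open>om\<close> leaves only brackets, \<open>om\<close> and
  \<open>J\<close>.\<close>

lemma Nijenhuis:
  "om (so3_sum_bracket (J u) (J v)) w + om (so3_sum_bracket (J u) v) (J w)
     + om (so3_sum_bracket u (J v)) (J w) + eps * om (so3_sum_bracket u v) w
   = (4 * eps / 3) * T u v w"
proof -
  have J': "om x (J w) = - om (J x) w" for x by (simp add: om_J)
  have "so3_sum_bracket (J u) (J v) - J (so3_sum_bracket (J u) v)
     - J (so3_sum_bracket u (J v)) + eps *\<^sub>R so3_sum_bracket u v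
    = B (J u) v - B (J v) u + J (B v u) - J (B u v)"
    unfolding D_torsion_free[symmetric] B_def J_lin J_J by (simp add: scaleR_diff_right)
  also have "\<dots> = - 4 *\<^sub>R J (B u v)"
    using scaleR_left_distrib[of 2 2 "J (B u v)"]
    by (simp add: scaleR_2 B_skew[of "J u"] B_skew[of "J v"] B_J B_skew[of v u] J_lin)
  finally have "om (so3_sum_bracket (J u) (J v) - J (so3_sum_bracket (J u) v)
     - J (so3_sum_bracket u (J v)) + eps *\<^sub>R so3_sum_bracket u v) w = om (- 4 *\<^sub>R J (B u v)) w"
    by simp
  then show ?thesis
    by (simp add: om_lin J' om_J_right T_eq om_J)
qed

text \<open>The operators \<open>B z\<close> and \<open>J \<circ> B z\<close> anticommute with \<open>J\<close> and so have trace zero. For the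
  inverse \<open>K\<close> of \<open>om\<close> this reads \<open>tr (K \<circ> ad z) = 0\<close> for all \<open>z\<close>, i.e. the diagonal blocks of \<open>K\<close>
  vanish.\<close>

lemma operator_trace_J_B: "operator_trace (\<lambda>y. J (B z y)) = 0"
proof -
  have lB: "linear (B z)"
    unfolding B_def by (rule linearI) (simp_all add: D_lin J_lin scaleR_diff_right)
  have "operator_trace ((B z) \<circ> J) = operator_trace (J \<circ> B z)"
    by (rule operator_trace_commute[OF lB J_linear])
  moreover have "operator_trace (B z \<circ> J) = - operator_trace (J \<circ> B z)"
    by (simp add: operator_trace_def B_J sum_negf)
  ultimately show ?thesis by (simp add: o_def)
qed

lemma om_diagonal_blocks: "om (x, 0) (x', 0) = 0" "om (0, y) (0, y') = 0"
proof -
  \<comment> \<open>The operator representing \<open>om\<close> with respect to the standard inner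
    product; its inverse \<open>K\<close> is again skew.\<close>
  define Om where "Om u = (\<Sum>b\<in>Basis. om u b *\<^sub>R b)" for u
  have Om: "om u v = Om u \<bullet> v" for u v
  proof -
    have "om u v = om u (\<Sum>b\<in>Basis. (v \<bullet> b) *\<^sub>R b)" by (simp add: euclidean_representation)
    also have "\<dots> = (\<Sum>b\<in>Basis. (v \<bullet> b) * om u b)"
      by (simp add: bilinear_def linear_sum[OF conjunct1[OF om_bilinear[unfolded bilinear_def], rule_format]] om_lin)
    also have "\<dots> = Om u \<bullet> v"
      by (simp add: Om_def inner_sum_left inner_commute[of v] mult.commute)
    finally show ?thesis .
  qed
  have lOm: "linear Om"
    by (rule linearI; rule euclidean_eqI) (simp_all add: Om[symmetric] om_lin inner_add_left)
  have iOm: "inj Om"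
    unfolding linear_injective_0[OF lOm] by (metis Om inner_zero_left om_nondegenerate)
  obtain K where K: "linear K" "\<And>x. K (Om x) = x" "\<And>x. Om (K x) = x"
    using linear_injective_isomorphism[OF lOm iOm] by metis
  have omK: "om (K u) v = u \<bullet> v" for u v by (simp add: Om K)
  have K_skew: "K u \<bullet> v = - (u \<bullet> K v)" for u v
    using om_skew[of "K u" "K v"] by (simp add: omK inner_commute)
  let ?ad = so3_sum_bracket
  have lad: "linear (?ad z)" for z
    by (rule linearI) (simp_all add: so3_sum_bracket_simps)
  have tr_ad: "operator_trace (?ad z) = 0" for z
  proof -
    have "?ad z b \<bullet> b = 0" for b by (simp add: so3_sum_bracket_inner so3_sum_bracket_self)
    then show ?thesis by (simp add: operator_trace_def)
  qed
  have trK: "operator_trace (K \<circ> ?ad (Om z)) = 0" for z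
  proof -
    \<comment> \<open>This is \<open>T_eq\<close> as an identity of operators in \<open>y\<close>:
      each term of \<open>T z y w\<close> is written as \<open>om\<close> of some vector with
      \<open>w\<close>, and nondegeneracy strips off \<open>w\<close>. When traces are taken, the
      last operator becomes ad z after a cyclic permutation, so only the middle one
      survives.\<close>
    have C: "(- 3 * eps) *\<^sub>R J (B z y) = ?ad z y - K (?ad (Om z) y) - K (?ad z (Om y))" (is "?l = ?r") for y
    proof -
      have "om ?l w = om ?r w" for w
      proof -
        have "om ?l w = T z y w"
          by (simp add: om_def G_lin G_J_J T_eq eps_sq mult.assoc[symmetric])
        also have "\<dots> = om (?ad z y) w - om z (?ad y w) - om y (?ad w z)"
          unfolding T_def using om_skew[of "?ad y w" z] om_skew[of "?ad w z" y] by simp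
        also have "\<dots> = om ?r w"
          by (simp add: om_lin omK so3_sum_bracket_inner) (simp add: Om so3_sum_bracket_inner[symmetric] so3_sum_bracket_skew[of w z] so3_sum_bracket_skew[of z "Om y"])
        finally show ?thesis .
      qed
      then show ?thesis using om_nondegenerate[of "?l - ?r"] by (simp add: om_lin)
    qed
    have "operator_trace (\<lambda>y. (- 3 * eps) *\<^sub>R J (B z y)) = - 3 * eps * operator_trace (\<lambda>y. J (B z y))"
      by (simp add: operator_trace_def sum_distrib_left)
    then have "0 = operator_trace (\<lambda>y. ?ad z y - K (?ad (Om z) y) - K (?ad z (Om y)))"
      by (simp only: operator_trace_J_B C mult_zero_right)
    also have "\<dots> = operator_trace (?ad z) - operator_trace (K \<circ> ?ad (Om z)) - operator_trace ((K \<circ> ?ad z) \<circ> Om)"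
      by (simp add: operator_trace_def inner_diff_left sum_subtractf)
    also have "operator_trace ((K \<circ> ?ad z) \<circ> Om) = operator_trace (Om \<circ> (K \<circ> ?ad z))"
      by (intro operator_trace_commute linear_compose K lad lOm)
    also have "Om \<circ> (K \<circ> ?ad z) = ?ad z" by (simp add: fun_eq_iff K)
    finally show ?thesis by (simp add: tr_ad o_def)
  qed
  then have trK: "operator_trace (K \<circ> ?ad z) = 0" for z
    by (metis K(3))
  have trK': "(\<Sum>b\<in>Basis. ?ad z b \<bullet> K b) = 0" for z
    using trK[of z] by (simp add: operator_trace_def K_skew sum_negf)
  have Basis3: "(Basis :: (real^3) set) = {axis 1 1, axis 2 1, axis 3 1}"
    by (auto simp: Basis_vec_def) (metis exhaust_3)
  have sum3: "(\<Sum>b\<in>Basis. f b) = f (axis 1 1) + f (axis 2 1) + f (axis 3 1)" for f :: "real^3 \<Rightarrow> real"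
    unfolding Basis3 by (simp add: axis_eq_axis)
  have sum_prod: "(\<Sum>b\<in>Basis. f b) = (\<Sum>b\<in>Basis. f (b, 0)) + (\<Sum>b\<in>Basis. f (0, b))"
    for f :: "(real^3) \<times> (real^3) \<Rightarrow> real"
    unfolding Basis_prod_def
    by (subst sum.union_disjoint) (auto simp: sum.reindex inj_on_def)
  \<comment> \<open>For \<open>z\<close> in one factor, ad z annihilates the other one, so the trace
    involves a single diagonal block of \<open>K\<close>.\<close>
  have tr1: "(\<Sum>b\<in>Basis. ?ad (x, 0) (b, 0) \<bullet> K (b, 0)) = 0" for x
    using trK'[of "(x, 0)", unfolded sum_prod] by (simp add: so3_sum_bracket_def flip: zero_prod_def)
  have tr2: "(\<Sum>b\<in>Basis. ?ad (0, x) (0, b) \<bullet> K (0, b)) = 0" for x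
    using trK'[of "(0, x)", unfolded sum_prod] by (simp add: so3_sum_bracket_def flip: zero_prod_def)
  note tr12 = tr1[unfolded sum3, of "axis 1 1"] tr1[unfolded sum3, of "axis 2 1"]
    tr1[unfolded sum3, of "axis 3 1"] tr2[unfolded sum3, of "axis 1 1"] tr2[unfolded sum3, of "axis 2 1"]
    tr2[unfolded sum3, of "axis 3 1"]
  have self: "u \<bullet> K u = 0" for u using K_skew[of u u] by (simp add: inner_commute)
  have ax: "u \<bullet> K v = 0 \<and> v \<bullet> K u = 0" if "u \<bullet> K v = v \<bullet> K u" for u v
    using that K_skew[of u v] by (simp add: inner_commute)
  \<comment> \<open>For \<open>z\<close> an axis, the trace condition says that two transposed
    entries of the block agree; as \<open>K\<close> is skew, they vanish.\<close>
  have "(axis 2 1, 0) \<bullet> K (axis 3 1, 0) = (axis 3 1, 0) \<bullet> K (axis 2 1, 0)"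
    "(axis 3 1, 0) \<bullet> K (axis 1 1, 0) = (axis 1 1, 0) \<bullet> K (axis 3 1, 0)"
    "(axis 1 1, 0) \<bullet> K (axis 2 1, 0) = (axis 2 1, 0) \<bullet> K (axis 1 1, 0)"
    "(0, axis 2 1) \<bullet> K (0, axis 3 1) = (0, axis 3 1) \<bullet> K (0, axis 2 1)"
    "(0, axis 3 1) \<bullet> K (0, axis 1 1) = (0, axis 1 1) \<bullet> K (0, axis 3 1)"
    "(0, axis 1 1) \<bullet> K (0, axis 2 1) = (0, axis 2 1) \<bullet> K (0, axis 1 1)"
    using tr12 by (simp_all add: so3_sum_bracket_def cross_basis inner_prod_def)
  note this[THEN ax]
  then have Kaxis: "(axis i 1, 0) \<bullet> K (axis j 1, 0) = 0" "(0, axis i 1) \<bullet> K (0, axis j 1) = 0" for i j :: 3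
    using exhaust_3[of i] exhaust_3[of j] self by auto
  have Kb: "fst (K (axis j 1, 0)) = 0" "snd (K (0, axis j 1)) = 0" for j :: 3
    using Kaxis[of _ j] by (simp_all add: vec_eq_iff inner_prod_def inner_axis inner_axis')
  have "fst (K (x, 0)) $ j = 0" "snd (K (0, x)) $ j = 0" for x j
    using K_skew[of "(x, 0)" "(axis j 1, 0)"] K_skew[of "(0, x)" "(0, axis j 1)"]
    by (simp_all add: Kb inner_prod_def inner_axis)
  then have K1: "fst (K (x, 0)) = 0" and K2: "snd (K (0, x)) = 0" for x
    by (simp_all add: vec_eq_iff)
  \<comment> \<open>\<open>K\<close> exchanges the two factors, hence so does its inverse: the part
    \<open>s\<close> of \<open>Om (x, 0)\<close> in the first factor satisfies
    \<open>K (s, 0) = 0\<close>.\<close>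
  have Om1: "fst (Om (x, 0)) = 0" for x
  proof -
    obtain s t where st: "Om (x, 0) = (s, t)" by (cases "Om (x, 0)")
    have "K (s, 0) + K (0, t) = (x, 0)"
      using K(2)[of "(x, 0)"] st by (simp flip: linear_add[OF K(1)])
    then have "snd (K (s, 0)) = 0" using K2[of t] by (metis add.right_neutral snd_add snd_conv)
    then have "K (s, 0) = 0" using K1[of s] by (simp add: prod_eq_iff)
    then show ?thesis using K(3)[of "(s, 0)"] linear_0[OF lOm] st by (simp add: zero_prod_def)
  qed
  have Om2: "snd (Om (0, x)) = 0" for x
  proof -
    obtain s t where st: "Om (0, x) = (s, t)" by (cases "Om (0, x)")
    have "K (s, 0) + K (0, t) = (0, x)"
      using K(2)[of "(0, x)"] st by (simp flip: linear_add[OF K(1)])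
    then have "fst (K (0, t)) = 0" using K1[of s] by (metis add.left_neutral fst_add fst_conv)
    then have "K (0, t) = 0" using K2[of t] by (simp add: prod_eq_iff)
    then show ?thesis using K(3)[of "(0, t)"] linear_0[OF lOm] st by (simp add: zero_prod_def)
  qed
  show "om (x, 0) (x', 0) = 0" "om (0, y) (0, y') = 0"
    using Om1[of x] Om2[of y] by (auto simp: Om inner_prod_def)
qed

text \<open>A simultaneous normal form for the bracket and \<open>om\<close>, given by relations
  instead of coordinates. It is therefore stable under cyclic rotation of the indices and, up to the
  signs of the \<open>p\<close>, under exchange of the factors, so that each computation below is
  done for one index only.\<close>

definition adapted where
  "adapted e1 e2 e3 f1 f2 f3 p1 p2 p3 \<longleftrightarrow>
     so3_sum_bracket e1 e2 = e3 \<and> so3_sum_bracket e2 e3 = e1 \<and> so3_sum_bracket e3 e1 = e2 \<and>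
     so3_sum_bracket f1 f2 = f3 \<and> so3_sum_bracket f2 f3 = f1 \<and> so3_sum_bracket f3 f1 = f2 \<and>
     (\<forall>e\<in>{e1, e2, e3}. \<forall>f\<in>{f1, f2, f3}. so3_sum_bracket e f = 0) \<and>
     (\<forall>e\<in>{e1, e2, e3}. \<forall>e'\<in>{e1, e2, e3}. om e e' = 0) \<and>
     (\<forall>f\<in>{f1, f2, f3}. \<forall>f'\<in>{f1, f2, f3}. om f f' = 0) \<and>
     om e1 f1 = p1 \<and> om e1 f2 = 0 \<and> om e1 f3 = 0 \<and>
     om e2 f1 = 0 \<and> om e2 f2 = p2 \<and> om e2 f3 = 0 \<and>
     om e3 f1 = 0 \<and> om e3 f2 = 0 \<and> om e3 f3 = p3 \<and>
     p1 \<noteq> 0 \<and> p2 \<noteq> 0 \<and> p3 \<noteq> 0 \<and>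
     (\<forall>u. \<exists>x1 x2 x3 y1 y2 y3. u = x1 *\<^sub>R e1 + x2 *\<^sub>R e2 + x3 *\<^sub>R e3 +
        y1 *\<^sub>R f1 + y2 *\<^sub>R f2 + y3 *\<^sub>R f3)"

lemma adapted_rotate:
  assumes "adapted e1 e2 e3 f1 f2 f3 p1 p2 p3"
  shows "adapted e2 e3 e1 f2 f3 f1 p2 p3 p1"
proof -
  have "\<exists>x2 x3 x1 y2 y3 y1. u = x2 *\<^sub>R e2 + x3 *\<^sub>R e3 + x1 *\<^sub>R e1 + y2 *\<^sub>R f2 + y3 *\<^sub>R f3 + y1 *\<^sub>R f1"
    for u
  proof -
    obtain x1 x2 x3 y1 y2 y3 where "u = x1 *\<^sub>R e1 + x2 *\<^sub>R e2 + x3 *\<^sub>R e3 +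
        y1 *\<^sub>R f1 + y2 *\<^sub>R f2 + y3 *\<^sub>R f3"
      using assms unfolding adapted_def by blast
    then have "u = x2 *\<^sub>R e2 + x3 *\<^sub>R e3 + x1 *\<^sub>R e1 + y2 *\<^sub>R f2 + y3 *\<^sub>R f3 + y1 *\<^sub>R f1"
      by (simp only: ac_simps)
    then show ?thesis by blast
  qed
  then show ?thesis using assms unfolding adapted_def by simp
qed

lemma adapted_flip:
  assumes "adapted e1 e2 e3 f1 f2 f3 p1 p2 p3"
  shows "adapted f1 f2 f3 e1 e2 e3 (- p1) (- p2) (- p3)"
proof -
  have "\<exists>x1 x2 x3 y1 y2 y3. u = x1 *\<^sub>R f1 + x2 *\<^sub>R f2 + x3 *\<^sub>R f3 + y1 *\<^sub>R e1 + y2 *\<^sub>R e2 + y3 *\<^sub>R e3"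
    for u
  proof -
    obtain x1 x2 x3 y1 y2 y3 where "u = x1 *\<^sub>R e1 + x2 *\<^sub>R e2 + x3 *\<^sub>R e3 +
        y1 *\<^sub>R f1 + y2 *\<^sub>R f2 + y3 *\<^sub>R f3"
      using assms unfolding adapted_def by blast
    then have "u = y1 *\<^sub>R f1 + y2 *\<^sub>R f2 + y3 *\<^sub>R f3 + x1 *\<^sub>R e1 + x2 *\<^sub>R e2 + x3 *\<^sub>R e3"
      by (simp only: ac_simps)
    then show ?thesis by blast
  qed
  moreover have "so3_sum_bracket f e = 0" if "f \<in> {f1, f2, f3}" "e \<in> {e1, e2, e3}" for e f
  proof -
    have "so3_sum_bracket e f = 0" using that assms unfolding adapted_def by blast
    then show ?thesis using so3_sum_bracket_skew[of f e] by simp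
  qed
  ultimately show ?thesis
    using assms om_skew[of f1 e1] om_skew[of f1 e2] om_skew[of f1 e3] om_skew[of f2 e1]
      om_skew[of f2 e2] om_skew[of f2 e3] om_skew[of f3 e1] om_skew[of f3 e2] om_skew[of f3 e3]
    unfolding adapted_def by simp
qed

lemma adapted_simps:
  assumes "adapted e1 e2 e3 f1 f2 f3 p1 p2 p3"
  shows "so3_sum_bracket e1 e2 = e3" "so3_sum_bracket e2 e3 = e1" "so3_sum_bracket e3 e1 = e2"
    "so3_sum_bracket e2 e1 = - e3" "so3_sum_bracket e3 e2 = - e1" "so3_sum_bracket e1 e3 = - e2"
    "so3_sum_bracket f1 f2 = f3" "so3_sum_bracket f2 f3 = f1" "so3_sum_bracket f3 f1 = f2"
    "so3_sum_bracket f2 f1 = - f3" "so3_sum_bracket f3 f2 = - f1" "so3_sum_bracket f1 f3 = - f2"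
    "so3_sum_bracket e1 f1 = 0" "so3_sum_bracket e1 f2 = 0" "so3_sum_bracket e1 f3 = 0"
    "so3_sum_bracket e2 f1 = 0" "so3_sum_bracket e2 f2 = 0" "so3_sum_bracket e2 f3 = 0"
    "so3_sum_bracket e3 f1 = 0" "so3_sum_bracket e3 f2 = 0" "so3_sum_bracket e3 f3 = 0"
    "so3_sum_bracket f1 e1 = 0" "so3_sum_bracket f2 e1 = 0" "so3_sum_bracket f3 e1 = 0"
    "so3_sum_bracket f1 e2 = 0" "so3_sum_bracket f2 e2 = 0" "so3_sum_bracket f3 e2 = 0"
    "so3_sum_bracket f1 e3 = 0" "so3_sum_bracket f2 e3 = 0" "so3_sum_bracket f3 e3 = 0"
    "om e1 e2 = 0" "om e2 e3 = 0" "om e3 e1 = 0" "om e2 e1 = 0" "om e3 e2 = 0" "om e1 e3 = 0"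
    "om f1 f2 = 0" "om f2 f3 = 0" "om f3 f1 = 0" "om f2 f1 = 0" "om f3 f2 = 0" "om f1 f3 = 0"
    "om e1 f1 = p1" "om e1 f2 = 0" "om e1 f3 = 0"
    "om e2 f1 = 0" "om e2 f2 = p2" "om e2 f3 = 0"
    "om e3 f1 = 0" "om e3 f2 = 0" "om e3 f3 = p3"
    "om f1 e1 = - p1" "om f2 e1 = 0" "om f3 e1 = 0"
    "om f1 e2 = 0" "om f2 e2 = - p2" "om f3 e2 = 0"
    "om f1 e3 = 0" "om f2 e3 = 0" "om f3 e3 = - p3"
proof -
  show "so3_sum_bracket e2 e1 = - e3" "so3_sum_bracket e3 e2 = - e1" "so3_sum_bracket e1 e3 = - e2"
    using assms so3_sum_bracket_skew unfolding adapted_def by metis+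
  show "so3_sum_bracket f2 f1 = - f3" "so3_sum_bracket f3 f2 = - f1" "so3_sum_bracket f1 f3 = - f2"
    using assms so3_sum_bracket_skew unfolding adapted_def by metis+
qed (use assms adapted_flip[OF assms] in \<open>simp_all add: adapted_def\<close>)

text \<open>\<open>T (J e1) e1\<close> vanishes against \<open>e2\<close> and \<open>e3\<close>,
  which removes \<open>y3\<close> and \<open>y2\<close>. These go first: testing against
  \<open>f3\<close> and \<open>f2\<close> mixes \<open>x2\<close> with \<open>y2\<close> and
  \<open>x3\<close> with \<open>y3\<close>.\<close>

lemma adapted_J:
  assumes A: "adapted e1 e2 e3 f1 f2 f3 p1 p2 p3"
  shows "\<exists>a c. J e1 = a *\<^sub>R e1 + c *\<^sub>R f1"
proof -
  note S = adapted_simps[OF A] om_lin so3_sum_bracket_simps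
  have p: "p1 \<noteq> 0" "p2 \<noteq> 0" "p3 \<noteq> 0" using A by (simp_all add: adapted_def)
  obtain x1 x2 x3 y1 y2 y3 where J: "J e1 = x1 *\<^sub>R e1 + x2 *\<^sub>R e2 + x3 *\<^sub>R e3 +
        y1 *\<^sub>R f1 + y2 *\<^sub>R f2 + y3 *\<^sub>R f3"
    using A unfolding adapted_def by blast
  have "y3 = 0" using T_J_self[of e1 e2] p by (simp add: J T_def S)
  have "y2 = 0" using T_J_self[of e1 e3] p by (simp add: J T_def S)
  have "x2 = 0" using T_J_self[of e1 f3] p \<open>y2 = 0\<close> by (simp add: J T_def S)
  moreover have "x3 = 0" using T_J_self[of e1 f2] p \<open>y3 = 0\<close> by (simp add: J T_def S)
  moreover note \<open>y3 = 0\<close> \<open>y2 = 0\<close>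
  ultimately show ?thesis using J by auto
qed

lemma adapted_coefficients:
  assumes A: "adapted e1 e2 e3 f1 f2 f3 p1 p2 p3"
    and J: "J e1 = a1 *\<^sub>R e1 + c1 *\<^sub>R f1" "J e2 = a2 *\<^sub>R e2 + c2 *\<^sub>R f2" "J e3 = a3 *\<^sub>R e3 + c3 *\<^sub>R f3"
      "J f1 = d1 *\<^sub>R f1 + b1 *\<^sub>R e1" "J f2 = d2 *\<^sub>R f2 + b2 *\<^sub>R e2" "J f3 = d3 *\<^sub>R f3 + b3 *\<^sub>R e3"
  shows "d1 = - a1" "c1 * p1 = c2 * p2" "b2 = - c2" "a1 * a1 + b1 * c1 = eps"
    "a1 * a2 - a1 * a3 - a2 * a3 = eps / 3"
proof -
  note S = adapted_simps[OF A] om_lin so3_sum_bracket_simps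
  have p: "p1 \<noteq> 0" "p2 \<noteq> 0" "p3 \<noteq> 0" using A by (simp_all add: adapted_def)
  have d: "d1 = - a1" "d2 = - a2" "d3 = - a3"
    using om_J[of e1 f1] om_J[of e2 f2] om_J[of e3 f3] p by (simp_all add: J S) algebra+
  then show "d1 = - a1" by simp
  show "c1 * p1 = c2 * p2" using T_J[of e1 e2 e3] by (simp add: J T_def S)
  \<comment> \<open>The three instances chain to \<open>a2 * p1 - c2 * p3 = a3 * p1 - c3 * p2 = - a1
    * p1 = a2 * p1 + b2 * p3\<close>.\<close>
  have "p3 * c2 = - p3 * b2"
    using T_J[of e3 f1 e2] T_J[of e2 e3 f1] T_J[of e1 f2 f3]
    by (simp add: J T_def S d) algebra
  then have "p3 * (c2 + b2) = 0" by (simp add: algebra_simps)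
  then show "b2 = - c2" using p by (simp add: add_eq_0_iff)
  have "(a1 * a1 + b1 * c1) * p1 = eps * p1"
    using arg_cong[OF J_J[of e1], of "\<lambda>u. om u f1"]
    by (simp add: J S J_lin d) algebra
  then show "a1 * a1 + b1 * c1 = eps" using p by simp
  \<comment> \<open>Here \<open>T e1 e2 f3 = p3\<close>. The right-hand side contributes 4/3 of
    \<open>eps * p3\<close> and the last term on the left takes away one, which leaves 1/3.\<close>
  have "p3 * (3 * (a1 * a2 - a1 * a3 - a2 * a3) - eps) = 0"
    using Nijenhuis[of e1 e2 f3] by (simp add: J T_def S d) algebra
  then show "a1 * a2 - a1 * a3 - a2 * a3 = eps / 3" using p by simp
qed

text \<open>Two maximisation steps suffice: the third pair is forced up to sign, and the cross
  product fixes that sign so that the bracket relations hold. The \<open>p\<close> are nonzero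
  because the diagonal blocks of the nondegenerate \<open>om\<close> vanish.\<close>

lemma adapted_exists: "\<exists>e1 e2 e3 f1 f2 f3 p1 p2 p3. adapted e1 e2 e3 f1 f2 f3 p1 p2 p3"
proof -
  define P where "P x y = om (x, 0) (0, y)" for x y
  have P: "bilinear P"
  proof -
    have "(x + x', 0) = (x, 0) + (x', 0::real^3)" "(c *\<^sub>R x, 0) = c *\<^sub>R (x, 0::real^3)"
      "(0, x + x') = (0::real^3, x) + (0, x')" "(0, c *\<^sub>R x) = c *\<^sub>R (0::real^3, x)" for x x' :: "real^3" and c
      by simp_all
    then show ?thesis unfolding bilinear_def P_def by (intro conjI allI linearI) (simp_all only: om_lin real_scaleR_def)
  qed
  obtain u1 v1 where 1: "norm u1 = 1" "norm v1 = 1"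
    "\<And>w. w \<bullet> v1 = 0 \<Longrightarrow> P u1 w = 0" "\<And>w. w \<bullet> u1 = 0 \<Longrightarrow> P w v1 = 0"
    using bilinear_form_max[OF P, of UNIV UNIV] by (auto simp: UNIV_not_singleton)
  have ne: "{x. x \<bullet> a = 0} \<noteq> {0}" for a :: "real^3"
  proof -
    obtain b where "b \<noteq> 0" "orthogonal a b"
      using orthogonal_to_vector_exists[of a] by auto
    then have "b \<in> {x. x \<bullet> a = 0}" by (simp add: orthogonal_def inner_commute)
    then show ?thesis using \<open>b \<noteq> 0\<close> by blast
  qed
  have sub: "subspace {x. x \<bullet> a = 0}" for a :: "real^3"
    by (auto simp: subspace_def inner_add_left)
  obtain u2 v2 where 2: "norm u2 = 1" "norm v2 = 1" "u2 \<bullet> u1 = 0" "v2 \<bullet> v1 = 0"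
    "\<And>w. w \<bullet> v1 = 0 \<Longrightarrow> w \<bullet> v2 = 0 \<Longrightarrow> P u2 w = 0" "\<And>w. w \<bullet> u1 = 0 \<Longrightarrow> w \<bullet> u2 = 0 \<Longrightarrow> P w v2 = 0"
    using bilinear_form_max[OF P sub[of u1] ne[of u1] sub[of v1] ne[of v1]] by auto
  define u3 where "u3 = cross3 u1 u2"
  define v3 where "v3 = cross3 v1 v2"
  note U = cross3_orthonormal[OF 1(1) 2(1,3), folded u3_def]
  note V = cross3_orthonormal[OF 1(2) 2(2,4), folded v3_def]
  have o: "u3 \<bullet> u1 = 0" "u3 \<bullet> u2 = 0" "v3 \<bullet> v1 = 0" "v3 \<bullet> v2 = 0"
    unfolding u3_def v3_def by (simp_all add: dot_cross_self)
  have off: "P u1 v2 = 0" "P u1 v3 = 0" "P u2 v1 = 0" "P u3 v1 = 0" "P u2 v3 = 0" "P u3 v2 = 0"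
    using 1 2 o by auto
  have span: "\<exists>x1 x2 x3 y1 y2 y3. u = x1 *\<^sub>R (u1, 0) + x2 *\<^sub>R (u2, 0) + x3 *\<^sub>R (u3, 0) +
        y1 *\<^sub>R (0, v1) + y2 *\<^sub>R (0, v2) + y3 *\<^sub>R (0, v3)" for u :: "(real^3) \<times> (real^3)"
  proof -
    have "fst u = (fst u \<bullet> u1) *\<^sub>R u1 + (fst u \<bullet> u2) *\<^sub>R u2 + (fst u \<bullet> u3) *\<^sub>R u3"
      "snd u = (snd u \<bullet> v1) *\<^sub>R v1 + (snd u \<bullet> v2) *\<^sub>R v2 + (snd u \<bullet> v3) *\<^sub>R v3"
      by (rule U V)+
    then show ?thesis by (intro exI) (rule prod_eqI; simp)
  qed
  have nz: "P u1 v1 \<noteq> 0" "P u2 v2 \<noteq> 0" "P u3 v3 \<noteq> 0"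
  proof -
    have *: "norm u = 1 \<Longrightarrow> \<not> (P u v1 = 0 \<and> P u v2 = 0 \<and> P u v3 = 0)" for u
    proof
      assume u: "norm u = 1" and z: "P u v1 = 0 \<and> P u v2 = 0 \<and> P u v3 = 0"
      have "om (u, 0) w = 0" for w
      proof -
        obtain x1 x2 x3 y1 y2 y3 where w: "w = x1 *\<^sub>R (u1, 0) + x2 *\<^sub>R (u2, 0) + x3 *\<^sub>R (u3, 0) +
            y1 *\<^sub>R (0, v1) + y2 *\<^sub>R (0, v2) + y3 *\<^sub>R (0, v3)" using span by blast
        show ?thesis using z unfolding w om_lin by (simp add: om_diagonal_blocks P_def)
      qed
      then have "(u, 0) = (0 :: (real^3) \<times> (real^3))" by (rule om_nondegenerate)
      then show False using u by (simp add: prod_eq_iff)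
    qed
    show "P u1 v1 \<noteq> 0" "P u2 v2 \<noteq> 0" "P u3 v3 \<noteq> 0"
      using *[of u1] *[of u2] *[of u3] 1 2 U off by auto
  qed
  have "adapted (u1, 0) (u2, 0) (u3, 0) (0, v1) (0, v2) (0, v3) (P u1 v1) (P u2 v2) (P u3 v3)"
    unfolding adapted_def
    by (intro conjI allI span; simp add: nz[unfolded P_def] off[unfolded P_def] U(1,2) V(1,2) so3_sum_bracket_def
        u3_def[symmetric] v3_def[symmetric] om_diagonal_blocks P_def zero_prod_def)
  then show ?thesis by blast
qed

theorem definite: "eps = -1 \<and> ((\<forall>u. G u u \<ge> 0) \<or> (\<forall>u. G u u \<le> 0))"
proof -
  obtain e1 e2 e3 f1 f2 f3 p1 p2 p3 where A: "adapted e1 e2 e3 f1 f2 f3 p1 p2 p3"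
    using adapted_exists by blast
  note A2 = adapted_rotate[OF A] note A3 = adapted_rotate[OF A2]
  obtain a1 c1 a2 c2 a3 c3 where J: "J e1 = a1 *\<^sub>R e1 + c1 *\<^sub>R f1" "J e2 = a2 *\<^sub>R e2 + c2 *\<^sub>R f2"
    "J e3 = a3 *\<^sub>R e3 + c3 *\<^sub>R f3"
    using adapted_J[OF A] adapted_J[OF A2] adapted_J[OF A3] by blast
  obtain d1 b1 d2 b2 d3 b3 where J': "J f1 = d1 *\<^sub>R f1 + b1 *\<^sub>R e1" "J f2 = d2 *\<^sub>R f2 + b2 *\<^sub>R e2"
    "J f3 = d3 *\<^sub>R f3 + b3 *\<^sub>R e3"
    using adapted_J[OF adapted_flip[OF A]] adapted_J[OF adapted_flip[OF A2]]
      adapted_J[OF adapted_flip[OF A3]] by blast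
  have p: "p1 \<noteq> 0" "p2 \<noteq> 0" "p3 \<noteq> 0" using A by (simp_all add: adapted_def)
  note C1 = adapted_coefficients[OF A J J']
  note C2 = adapted_coefficients[OF A2 J(2,3,1) J'(2,3,1)]
  note C3 = adapted_coefficients[OF A3 J(3,1,2) J'(3,1,2)]
  have eps': "eps = -1"
  proof (rule ccontr)
    assume "eps \<noteq> -1"
    then have e: "eps = 1" using eps by simp
    \<comment> \<open>Adding two of the three rotated equations cancels two of the products and
      isolates the third.\<close>
    have 1: "a1 * a2 = - 1/3" "a2 * a3 = - 1/3" "a3 * a1 = - 1/3"
      using C1(5) C2(5) C3(5) unfolding e by (simp_all add: mult.commute)
    have "a1\<^sup>2 * (a2 * a3) = (a1 * a2) * (a3 * a1)" by (simp add: power2_eq_square)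
    then have "a1\<^sup>2 * (-1/3) = 1/9" unfolding 1 by simp
    then show False using zero_le_power2[of a1] by linarith
  qed
  \<comment> \<open>The products \<open>c_i * p_i\<close>, not the \<open>c_i\<close> themselves,
    agree for the three planes. They are the coefficients of the squares in
    \<open>om u (J u)\<close>, so the sign of \<open>c\<close> decides the sign of the metric on all
    planes at once.\<close>
  define c where "c = c1 * p1"
  have c: "c1 * p1 = c" "c2 * p2 = c" "c3 * p3 = c" using C1(2) C2(2) by (auto simp: c_def)
  \<comment> \<open>On the first plane \<open>J\<close> squares to -1, which with
    \<open>b1 = - c1\<close> reads \<open>a1 * a1 - c1 * c1 = -1\<close>; this is multiplied by the
    square of \<open>p1\<close>, and likewise for the others. It makes the discriminant of each
    binary form negative.\<close>
  have q: "(a1 * p1)\<^sup>2 + p1\<^sup>2 = c\<^sup>2" "(a2 * p2)\<^sup>2 + p2\<^sup>2 = c\<^sup>2" "(a3 * p3)\<^sup>2 + p3\<^sup>2 = c\<^sup>2"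
    using C1(4) C2(4) C3(4) C1(3) C2(3) C3(3) c eps' by (simp_all add: power2_eq_square) algebra+
  have "c \<noteq> 0" using q(1) p(1) sum_power2_eq_zero_iff[of "a1 * p1" p1] by auto
  have le: "c * G u u \<le> 0" for u
  proof -
    obtain x1 x2 x3 y1 y2 y3 where u: "u = x1 *\<^sub>R e1 + x2 *\<^sub>R e2 + x3 *\<^sub>R e3 +
        y1 *\<^sub>R f1 + y2 *\<^sub>R f2 + y3 *\<^sub>R f3"
      using A unfolding adapted_def by blast
    have om_uu: "om u (J u) =
        (c1 * p1 * x1\<^sup>2 - 2 * (a1 * p1) * x1 * y1 + c1 * p1 * y1\<^sup>2)
      + (c2 * p2 * x2\<^sup>2 - 2 * (a2 * p2) * x2 * y2 + c2 * p2 * y2\<^sup>2)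
      + (c3 * p3 * x3\<^sup>2 - 2 * (a3 * p3) * x3 * y3 + c3 * p3 * y3\<^sup>2)"
      unfolding u J_lin J J' C1(1,3) C2(1,3) C3(1,3)
      by (simp add: adapted_simps[OF A] om_lin power2_eq_square algebra_simps)
    have "c * G u u = - (c * om u (J u))"
      using om_J_right[of u u] eps' by simp
    also have "om u (J u) =
        (c * x1\<^sup>2 - 2 * (a1 * p1) * x1 * y1 + c * y1\<^sup>2)
      + (c * x2\<^sup>2 - 2 * (a2 * p2) * x2 * y2 + c * y2\<^sup>2)
      + (c * x3\<^sup>2 - 2 * (a3 * p3) * x3 * y3 + c * y3\<^sup>2)"
      unfolding om_uu c ..
    finally have *: "c * G u u = 
      - (c * (c * x1\<^sup>2 - 2 * (a1 * p1) * x1 * y1 + c * y1\<^sup>2))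
      - (c * (c * x2\<^sup>2 - 2 * (a2 * p2) * x2 * y2 + c * y2\<^sup>2))
      - (c * (c * x3\<^sup>2 - 2 * (a3 * p3) * x3 * y3 + c * y3\<^sup>2))"
      by (simp add: algebra_simps)
    \<comment> \<open>Completing the square; multiplying by \<open>c\<close> beforehand treats both
      signs of \<open>c\<close> together.\<close>
    have "c * (c * x\<^sup>2 - 2 * h * x * y + c * y\<^sup>2) = (c * x - h * y)\<^sup>2 + r\<^sup>2 * y\<^sup>2" if "h\<^sup>2 + r\<^sup>2 = c\<^sup>2" for h r x y
      unfolding power2_eq_square using that by (simp add: power2_eq_square) algebra
    then have "c * (c * x\<^sup>2 - 2 * h * x * y + c * y\<^sup>2) \<ge> 0" if "h\<^sup>2 + r\<^sup>2 = c\<^sup>2" for h r x y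
      using that by (metis add_nonneg_nonneg mult_nonneg_nonneg zero_le_power2)
    from this[OF q(1), of x1 y1] this[OF q(2), of x2 y2] this[OF q(3), of x3 y3]
    show ?thesis unfolding * by linarith
  qed
  have "(\<forall>u. G u u \<ge> 0) \<or> (\<forall>u. G u u \<le> 0)"
    using le \<open>c \<noteq> 0\<close> by (cases "c > 0") (auto simp: mult_le_0_iff)
  then show ?thesis using eps' by simp
qed

end

section \<open>Left-invariant structures on the product group\<close>

text \<open>The matrix of the map \<open>cross3 x\<close>, that is, the usual identification of
  3-vectors with skew matrices, under which commutators become cross products.\<close>

definition cross_matrix :: "real^3 \<Rightarrow> real^3^3" where
  "cross_matrix x = vector [vector [0, - x$3, x$2], vector [x$3, 0, - x$1], vector [- x$2, x$1, 0]]"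

lemma cross_matrix_so3: "bij_betw cross_matrix UNIV so3"
proof (rule bij_betwI')
  show "cross_matrix x = cross_matrix y \<longleftrightarrow> x = y" for x y
    by (auto simp: cross_matrix_def vec_eq_iff forall_3)
  show "cross_matrix x \<in> so3" for x
    by (simp add: cross_matrix_def so3_def transpose_def vec_eq_iff forall_3)
  fix N :: "real^3^3" assume "N \<in> so3"
  then have t: "transpose N = - N" by (simp add: so3_def)
  have skew: "N $ j $ i = - (N $ i $ j)" for i j
  proof -
    have "N $ j $ i = transpose N $ i $ j" by (simp add: transpose_def)
    then show ?thesis by (simp add: t)
  qed
  have "N $ i $ i = 0" for i using skew[of i i] by linarith
  then show "\<exists>x\<in>UNIV. N = cross_matrix x"
    using skew[of 1 2] skew[of 1 3] skew[of 2 3]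
    by (intro bexI[of _ "vector [N $ 3 $ 2, N $ 1 $ 3, N $ 2 $ 1]"])
       (auto simp: cross_matrix_def vec_eq_iff forall_3)
qed

lemma cross_matrix_add: "cross_matrix (x + y) = cross_matrix x + cross_matrix y"
  and cross_matrix_scale: "cross_matrix (c *\<^sub>R x) = c *\<^sub>R cross_matrix x"
  and cross_matrix_cross3:
    "cross_matrix (cross3 x y) = cross_matrix x ** cross_matrix y - cross_matrix y ** cross_matrix x"
  by (simp_all add: cross_matrix_def vec_eq_iff forall_3 matrix_matrix_mult_def sum_3 cross_components)

lemma so3_lie_algebra_parametrization:
  assumes "has_lie_algebra_so3 A"
  obtains L where "bij_betw L UNIV (lie_algebra A)" "\<And>x y. L (x + y) = L x + L y"
    "\<And>c x. L (c *\<^sub>R x) = c *\<^sub>R L x" "\<And>x y. L (cross3 x y) = lie_bracket A (L x) (L y)"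
proof -
  obtain \<Phi> where \<Phi>: "bij_betw \<Phi> so3 (lie_algebra A)"
    "\<And>M N. M \<in> so3 \<Longrightarrow> N \<in> so3 \<Longrightarrow> \<Phi> (M + N) = \<Phi> M + \<Phi> N"
    "\<And>c M. M \<in> so3 \<Longrightarrow> \<Phi> (c *\<^sub>R M) = c *\<^sub>R \<Phi> M"
    "\<And>M N. M \<in> so3 \<Longrightarrow> N \<in> so3 \<Longrightarrow> \<Phi> (M ** N - N ** M) = lie_bracket A (\<Phi> M) (\<Phi> N)"
    using assms unfolding has_lie_algebra_so3_def by blast
  have so3: "cross_matrix x \<in> so3" for x using cross_matrix_so3 by (auto simp: bij_betw_def)
  show thesis
  proof (rule that[of "\<Phi> \<circ> cross_matrix"])
    show "bij_betw (\<Phi> \<circ> cross_matrix) UNIV (lie_algebra A)"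
      by (rule bij_betw_trans[OF cross_matrix_so3 \<Phi>(1)])
  qed (simp_all add: cross_matrix_add cross_matrix_scale cross_matrix_cross3 \<Phi>(2-4) so3)
qed

lemma (in lie_group_pair) left_invariant_nearly_kaehler_definite:
  assumes A: "has_lie_algebra_so3 A" and B: "has_lie_algebra_so3 B"
    and eps: "\<epsilon> = 1 \<or> \<epsilon> = -1"
    and nk: "nearly_eps_kaehler \<epsilon> M g J \<omega> nab" and li: "left_invariant_structure M g J \<omega>"
  shows "\<epsilon> = -1 \<and> \<not> indefinite_at M g m"
proof -
  obtain LA where LA: "bij_betw LA UNIV (lie_algebra A)" "\<And>x y. LA (x + y) = LA x + LA y"
    "\<And>c x. LA (c *\<^sub>R x) = c *\<^sub>R LA x" "\<And>x y. LA (cross3 x y) = lie_bracket A (LA x) (LA y)"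
    using so3_lie_algebra_parametrization[OF A] by blast
  obtain LB where LB: "bij_betw LB UNIV (lie_algebra B)" "\<And>x y. LB (x + y) = LB x + LB y"
    "\<And>c x. LB (c *\<^sub>R x) = c *\<^sub>R LB x" "\<And>x y. LB (cross3 x y) = lie_bracket B (LB x) (LB y)"
    using so3_lie_algebra_parametrization[OF B] by blast
  have LA_in: "LA x \<in> lie_algebra A" and LB_in: "LB y \<in> lie_algebra B" for x y
    using LA(1) LB(1) by (auto simp: bij_betw_def)
  define \<Psi> where "\<Psi> u = P.prod_lift (LA (fst u)) (LB (snd u))" for u
  define ev where "ev u = \<Psi> u 0" for u
  let ?T = "tangent_space M 0"
  have \<Psi>_add: "\<Psi> (u + v) = \<Psi> u + \<Psi> v" for u v
    by (simp add: \<Psi>_def LA(2) LB(2) P.prod_lift_add)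
  have \<Psi>_scale: "\<Psi> (c *\<^sub>R u) = c *\<^sub>R \<Psi> u" for c u
    by (simp add: \<Psi>_def LA(3) LB(3) P.prod_lift_scale)
  have \<Psi>_smooth: "\<Psi> u \<in> smooth_vfields M" for u
    unfolding \<Psi>_def
    by (intro P.prod_lift_smooth_vfield A.lie_algebra_smooth B.lie_algebra_smooth LA_in LB_in)
  have \<Psi>_bracket: "lie_bracket M (\<Psi> u) (\<Psi> v) = \<Psi> (so3_sum_bracket u v)" for u v
    unfolding \<Psi>_def so3_sum_bracket_def
    by (simp add: LA(4) LB(4) P.lie_bracket_prod_lift A.lie_algebra_smooth B.lie_algebra_smooth LA_in LB_in)
  have \<Psi>_translate: "\<Psi> u m = pushforward M ((+) m) 0 (\<Psi> u 0)" for u m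
    unfolding \<Psi>_def by (rule prod_lift_translate[OF LA_in LB_in])
  have ev_linear: "linear ev"
    by (rule linearI) (simp_all add: ev_def \<Psi>_add \<Psi>_scale, simp add: scaleR_fun_def)
  have ev_T: "ev u \<in> ?T" for u
    unfolding ev_def by (rule P.M.smooth_vfield_tangent[OF \<Psi>_smooth])
  have ev_inj: "u = 0" if "ev u = 0" for u
  proof -
    have "LA (fst u) = 0" "LB (snd u) = 0"
      using prod_lift_inj_at_0[OF LA_in LB_in] that by (auto simp: ev_def \<Psi>_def)
    moreover have "LA 0 = 0" "LB 0 = 0" using LA(3)[of 0 0] LB(3)[of 0 0] by simp_all
    ultimately have "fst u = 0" "snd u = 0"
      using LA(1) LB(1) by (metis bij_betw_def injD)+
    then show ?thesis by (simp add: prod_eq_iff)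
  qed
  have ev_surj: "\<exists>u. ev u = w" if w: "w \<in> ?T" for w
  proof -
    obtain X Y where XY: "X \<in> lie_algebra A" "Y \<in> lie_algebra B" "P.prod_lift X Y 0 = w"
      using prod_lift_surj_at_0[OF w] by blast
    have "X \<in> range LA" "Y \<in> range LB" using XY LA(1) LB(1) by (simp_all add: bij_betw_def)
    then obtain x y where "X = LA x" "Y = LB y" by blast
    then show ?thesis using XY by (intro exI[of _ "(x, y)"]) (simp add: ev_def \<Psi>_def)
  qed
  define iev where "iev w = (SOME u. ev u = w)" for w
  have ev_iev: "ev (iev w) = w" if "w \<in> ?T" for w
    unfolding iev_def by (rule someI_ex[OF ev_surj[OF that]])
  have ev_eqD: "u = v" if "ev u = ev v" for u v
    using ev_inj[of "u - v"] that by (simp add: linear_diff[OF ev_linear])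
  have ev_add: "ev (u + v) = ev u + ev v" and ev_scale: "ev (c *\<^sub>R u) = c *\<^sub>R ev u"
    and ev_diff: "ev (u - v) = ev u - ev v" for u v c
    by (rule linear_add[OF ev_linear] linear_scale[OF ev_linear] linear_diff[OF ev_linear])+

  have ah: "almost_eps_hermitian \<epsilon> M g J \<omega>" and lc: "levi_civita M g nab"
    and nk': "\<And>X. X \<in> smooth_vfields M \<Longrightarrow> cov_deriv_endo nab J X X = 0"
    using nk by (auto simp: nearly_eps_kaehler_def)
  have pr: "pseudo_riemannian_metric M g" and ef: "endomorphism_field M J"
    and JJ: "\<And>p u. u \<in> tangent_space M p \<Longrightarrow> J p (J p u) = \<epsilon> *\<^sub>R u"
    and gJJ: "\<And>p u v. u \<in> tangent_space M p \<Longrightarrow> v \<in> tangent_space M p \<Longrightarrow> g p (J p u) (J p v) = - \<epsilon> * g p u v"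
    using ah by (auto simp: almost_eps_hermitian_def)
  note pr' = pr[unfolded pseudo_riemannian_metric_def]
  have gsym: "\<And>p u v. u \<in> tangent_space M p \<Longrightarrow> v \<in> tangent_space M p \<Longrightarrow> g p u v = g p v u"
    and glin: "\<And>p u. u \<in> tangent_space M p \<Longrightarrow> linear_at M p (g p u)"
    and gnon: "\<And>p u. u \<in> tangent_space M p \<Longrightarrow> (\<And>v. v \<in> tangent_space M p \<Longrightarrow> g p u v = 0) \<Longrightarrow> u = 0"
    using conjunct1[OF pr'] conjunct1[OF conjunct2[OF pr']] conjunct1[OF conjunct2[OF conjunct2[OF pr']]]
    by (blast, blast, metis)
  have Jlin: "\<And>p. linear_at M p (J p)" and JT: "\<And>p u. u \<in> tangent_space M p \<Longrightarrow> J p u \<in> tangent_space M p"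
    using ef by (simp_all add: endomorphism_field_def del: split_paired_All)
  have ac: "affine_connection M nab"
    and tor: "\<And>X Y. X \<in> smooth_vfields M \<Longrightarrow> Y \<in> smooth_vfields M \<Longrightarrow> nab X Y - nab Y X = lie_bracket M X Y"
    and met: "\<And>X Y Z. X \<in> smooth_vfields M \<Longrightarrow> Y \<in> smooth_vfields M \<Longrightarrow> Z \<in> smooth_vfields M \<Longrightarrow>
      vderiv X (\<lambda>p. g p (Y p) (Z p)) = (\<lambda>p. g p (nab X Y p) (Z p) + g p (Y p) (nab X Z p))"
    using lc by (simp_all add: levi_civita_def)
  have nab_sm: "\<And>X Y. X \<in> smooth_vfields M \<Longrightarrow> Y \<in> smooth_vfields M \<Longrightarrow> nab X Y \<in> smooth_vfields M"
    and nab_add: "\<And>X X' Y. X \<in> smooth_vfields M \<Longrightarrow> X' \<in> smooth_vfields M \<Longrightarrow> Y \<in> smooth_vfields M \<Longrightarrow>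
        nab (X + X') Y = nab X Y + nab X' Y \<and> nab Y (X + X') = nab Y X + nab Y X'"
    and nab_scale: "\<And>f X Y. X \<in> smooth_vfields M \<Longrightarrow> Y \<in> smooth_vfields M \<Longrightarrow> smooth_fun M f \<Longrightarrow>
        nab (fscale f X) Y = fscale f (nab X Y) \<and>
        nab X (fscale f Y) = fscale (vderiv X f) Y + fscale f (nab X Y)"
    using ac by (simp_all add: affine_connection_def)
  have gli: "\<And>a p u v. u \<in> tangent_space M p \<Longrightarrow> v \<in> tangent_space M p \<Longrightarrow>
      g (a + p) (pushforward M ((+) a) p u) (pushforward M ((+) a) p v) = g p u v"
    and Jli: "\<And>a p u. u \<in> tangent_space M p \<Longrightarrow> J (a + p) (pushforward M ((+) a) p u) = pushforward M ((+) a) p (J p u)"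
    using li by (simp_all add: left_invariant_structure_def del: split_paired_All)

  define G where "G u v = g 0 (ev u) (ev v)" for u v
  define J' where "J' u = iev (J 0 (ev u))" for u
  \<comment> \<open>Only the value of \<open>nab\<close> at the identity enters. The metric, torsion
    and \<open>J\<close> conditions can all be evaluated at that point, without establishing that
    \<open>nab\<close> preserves left-invariant fields.\<close>
  define D where "D u v = iev (nab (\<Psi> u) (\<Psi> v) 0)" for u v
  have ev_J': "ev (J' u) = J 0 (ev u)" for u
    unfolding J'_def by (rule ev_iev[OF JT[OF ev_T]])
  have ev_D: "ev (D u v) = nab (\<Psi> u) (\<Psi> v) 0" for u v
    unfolding D_def by (rule ev_iev[OF P.M.smooth_vfield_tangent[OF nab_sm[OF \<Psi>_smooth \<Psi>_smooth]]])
  have vderiv_const: "vderiv X (\<lambda>m. c) = (\<lambda>m. 0)" if "X \<in> smooth_vfields M" for X and c :: real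
    unfolding vderiv_def using P.M.tangent_vector_const[OF P.M.smooth_vfield_tangent[OF that]] by simp
  have g_const: "g m (\<Psi> u m) (\<Psi> v m) = G u v" for m u v
    using gli[OF ev_T ev_T, of m u v] unfolding \<Psi>_translate[of u m] \<Psi>_translate[of v m] by (simp add: G_def ev_def)
  have \<Psi>_J: "endo_apply J (\<Psi> u) = \<Psi> (J' u)" for u
  proof
    fix m
    have "endo_apply J (\<Psi> u) m = pushforward M ((+) m) 0 (J 0 (ev u))"
      using Jli[OF ev_T, of m u] unfolding endo_apply_def \<Psi>_translate[of u m] by (simp add: ev_def)
    then show "endo_apply J (\<Psi> u) m = \<Psi> (J' u) m"
      unfolding \<Psi>_translate[of "J' u" m] ev_def[symmetric] ev_J' .
  qed
  have G_lin: "linear (G u)" for u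
    using glin[OF ev_T, of u] ev_T unfolding linear_at_def
    by (intro linearI) (simp_all add: G_def ev_add ev_scale)
  have G_sym: "G u v = G v u" for u v unfolding G_def by (rule gsym[OF ev_T ev_T])
  have sm_c: "smooth_fun M (\<lambda>m. c)" for c
    unfolding smooth_fun_def using P.M.smooth_at_const by blast
  \<comment> \<open>Homogeneity of \<open>nab\<close> is given for function multiples, so a scalar
    is treated as a constant function, whose derivative vanishes.\<close>
  have scale_fscale: "c *\<^sub>R X = fscale (\<lambda>m. c) X" for c and X :: "('a \<times> 'b) vfield"
    by (simp add: fscale_def scaleR_fun_def)
  have D_add: "D (u + u') v = D u v + D u' v" "D v (u + u') = D v u + D v u'" for u u' v
    by (rule ev_eqD; simp add: ev_add ev_D \<Psi>_add nab_add \<Psi>_smooth)+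
  have D_scale: "D (c *\<^sub>R u) v = c *\<^sub>R D u v" "D u (c *\<^sub>R v) = c *\<^sub>R D u v" for c u v
    by (rule ev_eqD; simp add: ev_scale ev_D \<Psi>_scale scale_fscale[of c "\<Psi> _"] nab_scale[OF \<Psi>_smooth \<Psi>_smooth sm_c]
        vderiv_const[OF \<Psi>_smooth]; simp add: fscale_def)+
  interpret so3_sum_nearly_kaehler \<epsilon> G J' D
  proof (rule so3_sum_nearly_kaehler.intro)
    show "\<epsilon> = 1 \<or> \<epsilon> = -1" by (rule eps)
    have "(\<lambda>v. G v u) = G u" for u by (rule ext) (rule G_sym)
    then show "bilinear G" unfolding bilinear_def using G_lin by simp
    show "G u v = G v u" for u v by (rule G_sym)
    show "u = 0" if "\<And>v. G u v = 0" for u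
    proof (rule ev_inj, rule gnon[OF ev_T])
      fix w assume "w \<in> ?T"
      then obtain v where "ev v = w" using ev_surj by blast
      then show "g 0 (ev u) w = 0" using that[of v] by (simp add: G_def)
    qed
    show "linear J'"
      using Jlin[of 0] ev_T unfolding linear_at_def
      by (intro linearI; intro ev_eqD) (simp_all add: ev_J' ev_add ev_scale)
    show "J' (J' u) = \<epsilon> *\<^sub>R u" for u
      by (rule ev_eqD) (simp add: ev_J' ev_scale JJ ev_T)
    show "G (J' u) (J' v) = - \<epsilon> * G u v" for u v
      using gJJ[OF ev_T ev_T] by (simp add: G_def ev_J')
    show "bilinear D" unfolding bilinear_def
      by (intro conjI allI linearI D_add D_scale)
    show "D u v - D v u = so3_sum_bracket u v" for u v
      using fun_cong[OF tor[OF \<Psi>_smooth \<Psi>_smooth, of u v], of 0]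
      by (intro ev_eqD) (simp add: ev_diff ev_D \<Psi>_bracket, simp add: ev_def)
    show "G (D u v) w + G v (D u w) = 0" for u v w
      using fun_cong[OF met[OF \<Psi>_smooth \<Psi>_smooth \<Psi>_smooth, of u v w], of 0]
      by (simp add: g_const vderiv_const[OF \<Psi>_smooth] G_def ev_D) (simp add: ev_def)
    show "D u (J' u) = J' (D u u)" for u
    proof (rule ev_eqD)
      have "nab (\<Psi> u) (\<Psi> (J' u)) - endo_apply J (nab (\<Psi> u) (\<Psi> u)) = 0"
        using nk'[OF \<Psi>_smooth, of u] by (simp add: cov_deriv_endo_def \<Psi>_J)
      from fun_cong[OF this, of 0] show "ev (D u (J' u)) = ev (J' (D u u))"
        by (simp add: ev_D ev_J' endo_apply_def)
    qed
  qed
  have "\<not> indefinite_at M g m"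
  proof
    assume "indefinite_at M g m"
    then obtain u v where uv: "u \<in> tangent_space M m" "g m u u > 0" "v \<in> tangent_space M m" "g m v v < 0"
      unfolding indefinite_at_def by blast
    \<comment> \<open>Left translation by \<open>- m\<close> carries vectors at \<open>m\<close>
      isometrically to the identity, so both signs at \<open>m\<close> would be attained by
      \<open>G\<close>.\<close>
    have "\<exists>x. G x x = g m w w" if w: "w \<in> tangent_space M m" for w
    proof -
      have "pushforward M ((+) (- m)) m w \<in> tangent_space M (- m + m)"
        by (rule prod_translation(2)[OF w])
      then have "pushforward M ((+) (- m)) m w \<in> ?T" by simp
      then obtain x where "ev x = pushforward M ((+) (- m)) m w" using ev_surj by blast
      then show ?thesis using gli[OF w w, of "- m"] by (intro exI[of _ x]) (simp add: G_def)
    qed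
    then obtain x y where "G x x > 0" "G y y < 0" using uv by metis
    then show False using definite by (meson not_less)
  qed
  then show ?thesis using definite by blast
qed

theorem proposition4p7:
  fixes A :: "('g::{t2_space,second_countable_topology,group_add}, 'e::euclidean_space) chart set"
    and B :: "('h::{t2_space,second_countable_topology,group_add}, 'f::euclidean_space) chart set"
  assumes "lie_group A" and "has_lie_algebra_so3 A"
    and "lie_group B" and "has_lie_algebra_so3 B"
  shows "\<not> (\<exists>g J \<omega> nab. nearly_para_kaehler (prod_atlas A B) g J \<omega> nab \<and>
                left_invariant_structure (prod_atlas A B) g J \<omega> \<and>
                (\<exists>p. sqnorm_nabla_J (prod_atlas A B) g J nab p \<noteq> 0)) \<and>
         \<not> (\<exists>g J \<omega> nab. nearly_pseudo_kaehler (prod_atlas A B) g J \<omega> nab \<and>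
                left_invariant_structure (prod_atlas A B) g J \<omega> \<and>
                (\<exists>p. indefinite_at (prod_atlas A B) g p))"
proof -
  interpret lie_group_pair A B
    using assms by unfold_locales (simp_all add: lie_group_def)
  note * = left_invariant_nearly_kaehler_definite[OF assms(2,4)]
  show ?thesis using *[of 1] *[of "-1"] by auto
qed

end
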